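(* Let $P,Q\in L^2([0,\pi])$ be complex-valued, let $bc\in\{Per^+,Per^-,Dir\}$, let $L=L_{bc}$ be the Dirac operator with potential matrix $v=\begin{pmatrix} 0 & P \\ Q & 0 \end{pmatrix}$ subject to the boundary conditions $bc$, and let $L^0=L^0_{bc}$ be the corresponding free operator ($v=0$). Then there is $N\in\mathbb{N}$ such that for all $n\in\Gamma_{bc}$ with $|n|>N$ the Riesz projections $$P_n=\frac{1}{2\pi i}\int_{C_n}(\lambda-L)^{-1}\,d\lambda,\qquad P_n^0=\frac{1}{2\pi i}\int_{C_n}(\lambda-L^0)^{-1}\,d\lambda,\qquad C_n=\{\lambda\in\mathbb{C}:|\lambda-n|=1/2\},$$ are well defined (that is, $C_n$ lies in the resolvent sets of $L$ and $L^0$), and $$\sum_{n\in\Gamma_{bc},\ |n|>N}\|P_n-P_n^0\|^2<\infty,$$ where $\|\cdot\|$ is the operator norm on $L^2([0,\pi])^2$.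
   Context: For $P,Q\in L^2([0,\pi])$ put $v(x)=\begin{pmatrix} 0 & P(x) \\ Q(x) & 0 \end{pmatrix}$ and consider the differential expression $$Ly=i\begin{pmatrix} 1 & 0 \\ 0 & -1 \end{pmatrix}\frac{dy}{dx}+v(x)y,\qquad y=\begin{pmatrix} y_1 \\ y_2 \end{pmatrix},\quad x\in[0,\pi],$$ in the Hilbert space $L^2([0,\pi])^2$ with scalar product $\langle F,G\rangle=\frac1\pi\int_0^\pi(f_1\overline{g_1}+f_2\overline{g_2})\,dx$. Boundary conditions: $Per^+$: $y(0)=y(\pi)$; $Per^-$: $y(0)=-y(\pi)$; $Dir$: $y_1(0)=y_2(0)$ and $y_1(\pi)=y_2(\pi)$. The closed operator $L_{bc}$ acts as $L$ on the domain of all $f=(f_1,f_2)$ whose components are absolutely continuous with derivative in $L^2([0,\pi])$ (Sobolev space of order one based on $L^2$) and which satisfy $bc$. $L^0_{bc}$ denotes $L_{bc}$ with $v=0$. The spectrum of $L^0_{bc}$ is $\Gamma_{bc}$, where $\Gamma_{Per^+}=2\mathbb{Z}$, $\Gamma_{Per^-}=1+2\mathbb{Z}$, $\Gamma_{Dir}=\mathbb{Z}$. Contours are positively oriented. *)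

theory Defs
  imports "HOL-Complex_Analysis.Complex_Analysis"
begin

section \<open>The Hilbert space of pairs of square integrable functions on \<open>[0, \<pi>]\<close>\<close>

definition square_integrable :: "(real \<Rightarrow> 'a::real_normed_vector) \<Rightarrow> bool" where
  "square_integrable f \<longleftrightarrow> f \<in> borel_measurable (lebesgue_on {0..pi}) \<and>
     integrable (lebesgue_on {0..pi}) (\<lambda>x. (norm (f x))\<^sup>2)"

definition L2_equiv :: "(real \<Rightarrow> complex \<times> complex) \<Rightarrow> (real \<Rightarrow> complex \<times> complex) \<Rightarrow> bool" where
  "L2_equiv f g \<longleftrightarrow> square_integrable f \<and> square_integrable g \<and>
     (AE x in lebesgue_on {0..pi}. f x = g x)"

lemma square_integrable_zero: "square_integrable (\<lambda>_. 0)"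
  by (simp add: square_integrable_def)

lemma square_integrable_add:
  fixes f g :: "real \<Rightarrow> 'a::euclidean_space"
  assumes "square_integrable f" "square_integrable g"
  shows "square_integrable (\<lambda>x. f x + g x)"
proof -
  have m: "(\<lambda>x. f x + g x) \<in> borel_measurable (lebesgue_on {0..pi})"
    using assms unfolding square_integrable_def by (intro borel_measurable_add) auto
  have le: "(norm (a + b))\<^sup>2 \<le> 2 * (norm a)\<^sup>2 + 2 * (norm b)\<^sup>2" for a b :: 'a
  proof -
    have "(norm (a + b))\<^sup>2 \<le> (norm a + norm b)\<^sup>2"
      by (intro power_mono norm_triangle_ineq) auto
    also have "\<dots> \<le> 2 * (norm a)\<^sup>2 + 2 * (norm b)\<^sup>2"
      using sum_squares_bound[of "norm a" "norm b"] by (simp add: power2_sum)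
    finally show ?thesis .
  qed
  have "integrable (lebesgue_on {0..pi}) (\<lambda>x. (norm (f x + g x))\<^sup>2)"
  proof (rule Bochner_Integration.integrable_bound)
    show "integrable (lebesgue_on {0..pi}) (\<lambda>x. 2 * (norm (f x))\<^sup>2 + 2 * (norm (g x))\<^sup>2)"
      using assms unfolding square_integrable_def by auto
    show "(\<lambda>x. (norm (f x + g x))\<^sup>2) \<in> borel_measurable (lebesgue_on {0..pi})"
      using m by measurable
  qed (use le in auto)
  with m show ?thesis by (simp add: square_integrable_def)
qed

lemma square_integrable_scaleR:
  fixes f :: "real \<Rightarrow> 'a::euclidean_space"
  assumes "square_integrable f"
  shows "square_integrable (\<lambda>x. r *\<^sub>R f x)"
  using assms unfolding square_integrable_def by (auto simp: power_mult_distrib)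

lemma square_integrable_inner:
  fixes f g :: "real \<Rightarrow> 'a::euclidean_space"
  assumes "square_integrable f" "square_integrable g"
  shows "integrable (lebesgue_on {0..pi}) (\<lambda>x. f x \<bullet> g x)"
proof (rule Bochner_Integration.integrable_bound)
  show "integrable (lebesgue_on {0..pi}) (\<lambda>x. (norm (f x))\<^sup>2 + (norm (g x))\<^sup>2)"
    using assms unfolding square_integrable_def by auto
  show "(\<lambda>x. f x \<bullet> g x) \<in> borel_measurable (lebesgue_on {0..pi})"
    using assms unfolding square_integrable_def by (intro borel_measurable_inner) auto
  have "\<bar>a \<bullet> b\<bar> \<le> (norm a)\<^sup>2 + (norm b)\<^sup>2" for a b :: 'a
    using Cauchy_Schwarz_ineq2[of a b] sum_squares_bound[of "norm a" "norm b"]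
      mult_nonneg_nonneg[of "norm a" "norm b"] by linarith
  then show "AE x in lebesgue_on {0..pi}.
      norm (f x \<bullet> g x) \<le> norm ((norm (f x))\<^sup>2 + (norm (g x))\<^sup>2)"
    by (auto simp: abs_of_nonneg)
qed

lemma part_equivp_L2_equiv: "part_equivp L2_equiv"
proof (rule part_equivpI)
  show "\<exists>f. L2_equiv f f"
    using square_integrable_zero by (auto simp: L2_equiv_def)
  show "symp L2_equiv"
    by (auto intro!: sympI simp: L2_equiv_def)
  show "transp L2_equiv"
    by (rule transpI) (auto simp: L2_equiv_def)
qed

quotient_type L2_space = "real \<Rightarrow> complex \<times> complex" / partial: L2_equiv
  by (rule part_equivp_L2_equiv)

text \<open>
  The real inner product is the real part of the complex scalar product
  \<open>\<langle>F, G\<rangle> = (1/\<pi>) \<integral> (f\<^sub>1 cnj g\<^sub>1 + f\<^sub>2 cnj g\<^sub>2) dx\<close>; the two induce the same norm.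
\<close>

instantiation L2_space :: real_inner
begin

lift_definition zero_L2_space :: L2_space is "\<lambda>_. 0"
  by (simp add: L2_equiv_def square_integrable_zero)

lift_definition plus_L2_space :: "L2_space \<Rightarrow> L2_space \<Rightarrow> L2_space" is "\<lambda>f g x. f x + g x"
  by (auto simp: L2_equiv_def intro: square_integrable_add)

lift_definition uminus_L2_space :: "L2_space \<Rightarrow> L2_space" is "\<lambda>f x. - f x"
  using square_integrable_scaleR[of _ "-1"] by (auto simp: L2_equiv_def)

definition minus_L2_space :: "L2_space \<Rightarrow> L2_space \<Rightarrow> L2_space" where
  "F - G = F + - (G::L2_space)"

lift_definition scaleR_L2_space :: "real \<Rightarrow> L2_space \<Rightarrow> L2_space" is "\<lambda>r f x. r *\<^sub>R f x"
  by (auto simp: L2_equiv_def intro: square_integrable_scaleR)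

lift_definition inner_L2_space :: "L2_space \<Rightarrow> L2_space \<Rightarrow> real" is
  "\<lambda>f g. (1 / pi) * (LINT x|lebesgue_on {0..pi}. f x \<bullet> g x)"
proof -
  fix f f' g g' :: "real \<Rightarrow> complex \<times> complex"
  assume "L2_equiv f f'" "L2_equiv g g'"
  then have "(LINT x|lebesgue_on {0..pi}. f x \<bullet> g x) = (LINT x|lebesgue_on {0..pi}. f' x \<bullet> g' x)"
    unfolding L2_equiv_def square_integrable_def
    by (intro integral_cong_AE) (auto intro!: borel_measurable_inner)
  then show "(1 / pi) * (LINT x|lebesgue_on {0..pi}. f x \<bullet> g x)
      = (1 / pi) * (LINT x|lebesgue_on {0..pi}. f' x \<bullet> g' x)"
    by simp
qed

definition norm_L2_space :: "L2_space \<Rightarrow> real" where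
  "norm F = sqrt (F \<bullet> (F::L2_space))"

definition sgn_L2_space :: "L2_space \<Rightarrow> L2_space" where
  "sgn F = inverse (norm F) *\<^sub>R (F::L2_space)"

definition dist_L2_space :: "L2_space \<Rightarrow> L2_space \<Rightarrow> real" where
  "dist F G = norm (F - (G::L2_space))"

definition uniformity_L2_space :: "(L2_space \<times> L2_space) filter" where
  "uniformity_L2_space = (INF e\<in>{0<..}. principal {(F, G). dist F (G::L2_space) < e})"

definition open_L2_space :: "L2_space set \<Rightarrow> bool" where
  "open_L2_space U \<longleftrightarrow> (\<forall>F\<in>U. \<forall>\<^sub>F (F', G) in uniformity. F' = F \<longrightarrow> G \<in> U)"

instance
proof
  fix a b :: real and F G H :: L2_space
  show "F + G + H = F + (G + H)"
    by transfer (auto simp: L2_equiv_def add.assoc intro!: square_integrable_add)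
  show "F + G = G + F"
    by transfer (auto simp: L2_equiv_def add.commute intro!: square_integrable_add)
  show "0 + F = F"
    by transfer (auto simp: L2_equiv_def)
  show "- F + F = 0"
    by transfer (auto simp: L2_equiv_def square_integrable_zero)
  show "F - G = F + - G"
    by (rule minus_L2_space_def)
  show "a *\<^sub>R (F + G) = a *\<^sub>R F + a *\<^sub>R G"
    by transfer (auto simp: L2_equiv_def scaleR_add_right
        intro!: square_integrable_add square_integrable_scaleR)
  show "(a + b) *\<^sub>R F = a *\<^sub>R F + b *\<^sub>R F"
    by transfer (auto simp: L2_equiv_def scaleR_add_left
        intro!: square_integrable_add square_integrable_scaleR)
  show "a *\<^sub>R b *\<^sub>R F = (a * b) *\<^sub>R F"
    by transfer (auto simp: L2_equiv_def intro!: square_integrable_scaleR)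
  show "1 *\<^sub>R F = F"
    by transfer (auto simp: L2_equiv_def)
  show "dist F G = norm (F - G)"
    by (rule dist_L2_space_def)
  show "sgn F = inverse (norm F) *\<^sub>R F"
    by (rule sgn_L2_space_def)
  show "uniformity = (INF e\<in>{0<..}. principal {(F, G). dist F (G::L2_space) < e})"
    by (rule uniformity_L2_space_def)
  show "open U = (\<forall>F\<in>U. \<forall>\<^sub>F (F', G) in uniformity. F' = F \<longrightarrow> G \<in> U)" for U :: "L2_space set"
    by (rule open_L2_space_def)
  show "F \<bullet> G = G \<bullet> F"
    by transfer (simp add: inner_commute)
  show "(F + G) \<bullet> H = F \<bullet> H + G \<bullet> H"
    by transfer (simp add: L2_equiv_def inner_add_left square_integrable_inner add_divide_distrib)
  show "a *\<^sub>R F \<bullet> G = a * (F \<bullet> G)"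
    by transfer simp
  show "0 \<le> F \<bullet> F"
    by transfer (auto intro!: integral_nonneg_AE)
  show "F \<bullet> F = 0 \<longleftrightarrow> F = 0"
  proof (transfer)
    fix f :: "real \<Rightarrow> complex \<times> complex"
    assume f: "L2_equiv f f"
    then have "integrable (lebesgue_on {0..pi}) (\<lambda>x. f x \<bullet> f x)"
      by (auto simp: L2_equiv_def intro: square_integrable_inner)
    then have "(LINT x|lebesgue_on {0..pi}. f x \<bullet> f x) = 0
        \<longleftrightarrow> (AE x in lebesgue_on {0..pi}. f x \<bullet> f x = 0)"
      by (intro integral_nonneg_eq_0_iff_AE) auto
    with f show "((1 / pi) * (LINT x|lebesgue_on {0..pi}. f x \<bullet> f x) = 0) = L2_equiv f (\<lambda>_. 0)"
      by (auto simp: L2_equiv_def square_integrable_zero)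
  qed
  show "norm F = sqrt (F \<bullet> F)"
    by (rule norm_L2_space_def)
qed

end

lift_definition scaleC_L2 :: "complex \<Rightarrow> L2_space \<Rightarrow> L2_space" is
  "\<lambda>c f x. (c * fst (f x), c * snd (f x))"
proof -
  fix c :: complex and f g :: "real \<Rightarrow> complex \<times> complex"
  assume fg: "L2_equiv f g"
  have eq: "(norm (c * fst z, c * snd z))\<^sup>2 = (cmod c)\<^sup>2 * (norm z)\<^sup>2" for z :: "complex \<times> complex"
    by (cases z) (simp add: norm_Pair norm_mult power_mult_distrib distrib_left)
  have "square_integrable (\<lambda>x. (c * fst (h x), c * snd (h x)))"
    if "square_integrable h" for h :: "real \<Rightarrow> complex \<times> complex"
  proof -
    have "continuous_on UNIV (\<lambda>z::complex \<times> complex. (c * fst z, c * snd z))"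
      by (intro continuous_intros)
    then have "(\<lambda>z::complex \<times> complex. (c * fst z, c * snd z)) \<in> borel_measurable borel"
      by (rule borel_measurable_continuous_onI)
    from measurable_compose[OF _ this] that show ?thesis
      unfolding square_integrable_def eq by auto
  qed
  moreover have "AE x in lebesgue_on {0..pi}. f x = g x"
    using fg by (simp add: L2_equiv_def)
  then have "AE x in lebesgue_on {0..pi}.
      (c * fst (f x), c * snd (f x)) = (c * fst (g x), c * snd (g x))"
    by (rule eventually_mono) simp
  ultimately show "L2_equiv (\<lambda>x. (c * fst (f x), c * snd (f x))) (\<lambda>x. (c * fst (g x), c * snd (g x)))"
    using fg unfolding L2_equiv_def by blast
qed

lemma norm_scaleC_L2: "norm (scaleC_L2 c F) = cmod c * norm F"
proof -
  have "scaleC_L2 c F \<bullet> scaleC_L2 c F = (cmod c)\<^sup>2 * (F \<bullet> F)"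
  proof transfer
    fix c :: complex and f :: "real \<Rightarrow> complex \<times> complex"
    have "(c * fst z, c * snd z) \<bullet> (c * fst z, c * snd z) = (cmod c)\<^sup>2 * (z \<bullet> z)"
      for z :: "complex \<times> complex"
      unfolding power2_norm_eq_inner[symmetric]
      by (cases z) (simp add: norm_Pair norm_mult power_mult_distrib distrib_left)
    then show "(1 / pi) * (LINT x|lebesgue_on {0..pi}.
          (c * fst (f x), c * snd (f x)) \<bullet> (c * fst (f x), c * snd (f x)))
        = (cmod c)\<^sup>2 * ((1 / pi) * (LINT x|lebesgue_on {0..pi}. f x \<bullet> f x))"
      by simp
  qed
  then show ?thesis
    by (simp add: norm_L2_space_def real_sqrt_mult)
qed

lemma L2_equiv_scaleC:
  "L2_equiv f g \<Longrightarrow> L2_equiv (\<lambda>x. (c * fst (f x), c * snd (f x))) (\<lambda>x. (c * fst (g x), c * snd (g x)))"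
  using scaleC_L2.rsp by (auto simp: rel_fun_def)

lemma bounded_linear_scaleC_L2: "bounded_linear (scaleC_L2 c)"
proof (rule bounded_linear_intro)
  show "scaleC_L2 c (F + G) = scaleC_L2 c F + scaleC_L2 c G" for F G
  proof transfer
    fix c :: complex and f g :: "real \<Rightarrow> complex \<times> complex"
    assume "L2_equiv f f" "L2_equiv g g"
    then have "L2_equiv (\<lambda>x. f x + g x) (\<lambda>x. f x + g x)"
      by (auto simp: L2_equiv_def intro: square_integrable_add)
    from L2_equiv_scaleC[OF this, of c]
    show "L2_equiv (\<lambda>x. (c * fst (f x + g x), c * snd (f x + g x)))
        (\<lambda>x. (c * fst (f x), c * snd (f x)) + (c * fst (g x), c * snd (g x)))"
      by (simp add: distrib_left)
  qed
  show "scaleC_L2 c (r *\<^sub>R F) = r *\<^sub>R scaleC_L2 c F" for r F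
  proof transfer
    fix c :: complex and r and f :: "real \<Rightarrow> complex \<times> complex"
    assume "L2_equiv f f"
    then have "L2_equiv (\<lambda>x. r *\<^sub>R f x) (\<lambda>x. r *\<^sub>R f x)"
      by (auto simp: L2_equiv_def intro: square_integrable_scaleR)
    from L2_equiv_scaleC[OF this, of c]
    show "L2_equiv (\<lambda>x. (c * fst (r *\<^sub>R f x), c * snd (r *\<^sub>R f x)))
        (\<lambda>x. r *\<^sub>R (c * fst (f x), c * snd (f x)))"
      by simp
  qed
  show "norm (scaleC_L2 c F) \<le> norm F * cmod c" for F
    by (simp add: norm_scaleC_L2 mult.commute)
qed

definition scaleC_op :: "complex \<Rightarrow> (L2_space \<Rightarrow>\<^sub>L L2_space) \<Rightarrow> (L2_space \<Rightarrow>\<^sub>L L2_space)" where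
  "scaleC_op c R = Blinfun (\<lambda>F. scaleC_L2 c (R F))"

lemma scaleC_op_apply: "blinfun_apply (scaleC_op c R) F = scaleC_L2 c (R F)"
  unfolding scaleC_op_def
  by (simp add: bounded_linear_Blinfun_apply bounded_linear_compose[OF bounded_linear_scaleC_L2]
      blinfun.bounded_linear_right)


section \<open>Absolute continuity and the Sobolev space\<close>

text \<open>
  Divisions are finite families of non-overlapping compact intervals;
  \<open>Inf k\<close> and \<open>Sup k\<close> are the endpoints of the interval \<open>k\<close>.
\<close>

definition absolutely_cont_on :: "real set \<Rightarrow> (real \<Rightarrow> 'a::real_normed_vector) \<Rightarrow> bool" where
  "absolutely_cont_on S f \<longleftrightarrow>
     (\<forall>\<epsilon>>0. \<exists>\<delta>>0. \<forall>\<D> T. \<D> division_of T \<and> T \<subseteq> S \<and> (\<Sum>k\<in>\<D>. Sup k - Inf k) < \<delta> \<longrightarrow>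
        (\<Sum>k\<in>\<D>. norm (f (Sup k) - f (Inf k))) < \<epsilon>)"

text \<open>
  The almost everywhere differentiability is implied by absolute continuity; it is listed because
  \<^const>\<open>vector_derivative\<close> is unspecified where the derivative does not exist.
\<close>

definition sobolev1 :: "(real \<Rightarrow> complex) \<Rightarrow> bool" where
  "sobolev1 f \<longleftrightarrow> absolutely_cont_on {0..pi} f \<and>
     (AE x in lebesgue_on {0..pi}. f differentiable (at x within {0..pi})) \<and>
     square_integrable (\<lambda>x. vector_derivative f (at x within {0..pi}))"


section \<open>Dirac operators\<close>

datatype bc = Per_plus | Per_minus | Dir

fun satisfies_bc :: "bc \<Rightarrow> (real \<Rightarrow> complex) \<Rightarrow> (real \<Rightarrow> complex) \<Rightarrow> bool" where
  "satisfies_bc Per_plus f1 f2 \<longleftrightarrow> f1 0 = f1 pi \<and> f2 0 = f2 pi"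
| "satisfies_bc Per_minus f1 f2 \<longleftrightarrow> f1 0 = - f1 pi \<and> f2 0 = - f2 pi"
| "satisfies_bc Dir f1 f2 \<longleftrightarrow> f1 0 = f2 0 \<and> f1 pi = f2 pi"

text \<open>The spectrum of the operator without potential, in explicit form.\<close>

fun free_spectrum :: "bc \<Rightarrow> int set" where
  "free_spectrum Per_plus = {n. even n}"
| "free_spectrum Per_minus = {n. odd n}"
| "free_spectrum Dir = UNIV"

definition L2_class :: "(real \<Rightarrow> complex) \<Rightarrow> (real \<Rightarrow> complex) \<Rightarrow> L2_space" where
  "L2_class f1 f2 = abs_L2_space (\<lambda>x. (f1 x, f2 x))"

definition dirac_domain :: "bc \<Rightarrow> L2_space set" where
  "dirac_domain b = {L2_class f1 f2 | f1 f2. sobolev1 f1 \<and> sobolev1 f2 \<and> satisfies_bc b f1 f2}"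

text \<open>
  An element of the Sobolev space has exactly one absolutely continuous representative on
  \<open>[0, \<pi>]\<close>, so the choice below does not matter on the domain (and off it the value is never used).
\<close>

definition dirac_op :: "(real \<Rightarrow> complex) \<Rightarrow> (real \<Rightarrow> complex) \<Rightarrow> L2_space \<Rightarrow> L2_space" where
  "dirac_op P Q F =
     (let (f1, f2) = (SOME (f1, f2). sobolev1 f1 \<and> sobolev1 f2 \<and> L2_class f1 f2 = F)
      in L2_class
           (\<lambda>x. \<i> * vector_derivative f1 (at x within {0..pi}) + P x * f2 x)
           (\<lambda>x. - \<i> * vector_derivative f2 (at x within {0..pi}) + Q x * f1 x))"


section \<open>Resolvents and Riesz projections of an operator \<open>A\<close> with domain \<open>D\<close>\<close>

definition resolvent_set :: "L2_space set \<Rightarrow> (L2_space \<Rightarrow> L2_space) \<Rightarrow> complex set" where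
  "resolvent_set D A =
     {z. bij_betw (\<lambda>F. scaleC_L2 z F - A F) D UNIV \<and>
         bounded_linear (inv_into D (\<lambda>F. scaleC_L2 z F - A F))}"

definition resolvent ::
    "L2_space set \<Rightarrow> (L2_space \<Rightarrow> L2_space) \<Rightarrow> complex \<Rightarrow> (L2_space \<Rightarrow>\<^sub>L L2_space)" where
  "resolvent D A z = Blinfun (inv_into D (\<lambda>F. scaleC_L2 z F - A F))"

text \<open>The operator valued counterpart of \<^const>\<open>contour_integral\<close>.\<close>

definition contour_integral_op ::
    "(real \<Rightarrow> complex) \<Rightarrow> (complex \<Rightarrow> (L2_space \<Rightarrow>\<^sub>L L2_space)) \<Rightarrow> (L2_space \<Rightarrow>\<^sub>L L2_space)" where
  "contour_integral_op g R =
     integral {0..1} (\<lambda>t. scaleC_op (vector_derivative g (at t within {0..1})) (R (g t)))"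

definition riesz_projection ::
    "L2_space set \<Rightarrow> (L2_space \<Rightarrow> L2_space) \<Rightarrow> int \<Rightarrow> (L2_space \<Rightarrow>\<^sub>L L2_space)" where
  "riesz_projection D A n =
     scaleC_op (1 / (2 * of_real pi * \<i>))
       (contour_integral_op (circlepath (of_int n) (1/2)) (resolvent D A))"

end

theory Submission
  imports Defs
begin

text \<open>
  Let \<open>\<lambda> = n + \<mu>\<close> with \<open>|\<mu>| = 1/2\<close>. Variation of constants gives the free resolvent
  \<open>S = (\<lambda> - L\<^sup>0)\<^sup>-\<^sup>1\<close> explicitly, and \<open>(\<lambda> - L) y = f\<close> becomes \<open>y = S (f + V y)\<close> for continuous \<open>y\<close>.
  Because \<open>V\<close> is off-diagonal, \<open>S V S\<close> contains the integrals of \<open>e\<^sup>2\<^sup>i\<^sup>n\<^sup>t P\<close> and \<open>e\<^sup>-\<^sup>2\<^sup>i\<^sup>n\<^sup>t Q\<close>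
  against functions that are controlled uniformly in \<open>\<mu>\<close>; integrating by parts bounds
  \<open>S V S\<close> by the primitives \<open>\<integral>\<^sub>0\<^sup>x e\<^sup>2\<^sup>i\<^sup>n\<^sup>t P\<close> and \<open>\<integral>\<^sub>0\<^sup>x e\<^sup>-\<^sup>2\<^sup>i\<^sup>n\<^sup>t Q\<close>, whose squares
  are summable over \<open>n\<close> by Bessel's inequality, with a bound independent of \<open>x\<close>.
  Hence \<open>(S V)\<^sup>3\<close> is a contraction in the supremum norm for large \<open>|n|\<close>, which gives the resolvent of \<open>L\<close>,
  and since \<open>y - S f = S V S (f + V y)\<close> the difference of the two resolvents on the circle is bounded
  by a square summable sequence in \<open>n\<close>, and so is the difference of the projections.
\<close>

text \<open>Bessel's inequality bounds the sum over n of the squares of \<open>B x\<close> at each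
  fixed x, but not the sum over n of their suprema over x. This shapes the estimates:
  \<open>norm_T2_le\<close> still contains \<open>B x\<close>, and one more application of
  \<open>T\<close> integrates it against \<open>v\<close>, so that \<open>norm_T3_le\<close> sees
  \<open>B\<close> only through \<open>\<beta>\<close>. When the resolvents are compared, the L2
  norm in x does the same job. By Cauchy-Schwarz both bounds reduce to \<open>\<theta>\<close>,
  built from \<open>B\<close> at pi and integrals of its square, where the sum over n can be taken
  under the integral. Since the sums of \<open>\<theta>\<close> over finite sets are bounded,
  \<open>\<kappa>\<close> exceeds 1/2 for finitely many n only. The other constants depend on
  \<open>M\<close>, \<open>P\<close> and \<open>Q\<close> alone: for |l - n| = 1/2 the exponentials
  on [0, pi] are at most exp (pi / 2) in modulus, and 1 - exp (2 i pi l) stays away from 0 uniformly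
  in n. The operator is defined by absolute continuity and pointwise derivatives, so both directions
  of the fundamental theorem of calculus for absolutely continuous functions are what connects it to
  integral equations.\<close>

section \<open>Absolutely continuous functions\<close>

text \<open>A gauge separates two kinds of tags. Off \<open>N\<close> differentiability gives the
  straddle estimate. Tags in \<open>N\<close> are confined to an open set around \<open>N\<close> of
  measure below \<delta>, where absolute continuity makes the total increment of \<open>F\<close>
  small. Integrability of \<open>f\<close> comes out with the conclusion.\<close>

lemma absolutely_cont_on_has_integral:
  fixes F :: "real \<Rightarrow> 'a::real_normed_vector"
  assumes ac: "absolutely_cont_on {a..b} F" and ab: "a \<le> b" and N: "negligible N"
    and der: "\<And>x. x \<in> {a..b} - N \<Longrightarrow> (F has_vector_derivative f x) (at x within {a..b})"
  shows "(f has_integral F b - F a) {a..b}"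
proof -
  \<comment> \<open>Zero on \<open>N\<close>, so that a tag in \<open>N\<close> leaves only an
    increment of \<open>F\<close>.\<close>
  define g where "g x = (if x \<in> N then 0 else f x)" for x
  have "(g has_integral F b - F a) {a..b}"
    unfolding has_integral_real
  proof (intro allI impI)
    fix e :: real assume "e > 0"
    \<comment> \<open>The added 1 keeps \<open>e1\<close> positive when a = b and makes e1 (b - a)
      strictly less than e / 2.\<close>
    define e1 where "e1 = e / (2 * (b - a + 1))"
    have e1: "e1 > 0" "e1 * (b - a) < e / 2"
      using \<open>e > 0\<close> ab by (auto simp: e1_def field_simps)
    obtain \<delta> where \<delta>: "\<delta> > 0"
      "\<And>D T. D division_of T \<Longrightarrow> T \<subseteq> {a..b} \<Longrightarrow> (\<Sum>k\<in>D. Sup k - Inf k) < \<delta> \<Longrightarrow>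
          (\<Sum>k\<in>D. norm (F (Sup k) - F (Inf k))) < e / 2"
      using ac \<open>e > 0\<close> unfolding absolutely_cont_on_def by (meson half_gt_zero)
    have N0: "N \<in> sets lebesgue" "emeasure lebesgue N = 0"
      using N by (auto simp: negligible_iff_null_sets null_sets_def)
    obtain U where U: "open U" "N \<subseteq> U" "U - N \<in> lmeasurable" "emeasure lebesgue (U - N) < ennreal \<delta>"
      using sets_lebesgue_outer_open[OF N0(1) \<delta>(1)] .
    have "N \<in> null_sets lebesgue" using N0 by (auto simp: null_sets_def)
    have "U \<in> sets lebesgue" using U(1) by auto
    then have eU: "emeasure lebesgue U < ennreal \<delta>"
      using U(4) \<open>N \<in> null_sets lebesgue\<close> by (simp add: emeasure_Diff_null_set)
    then have Ul: "U \<in> lmeasurable"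
      using \<open>U \<in> sets lebesgue\<close> by (auto simp: fmeasurable_def top.not_eq_extremum intro: less_trans)
    have mU: "measure lebesgue U < \<delta>"
      using eU \<delta>(1) by (simp add: emeasure_eq_measure2[OF Ul] ennreal_less_iff)
    have "\<exists>G. open G \<and> x \<in> G \<and> (x \<in> N \<longrightarrow> G \<subseteq> U) \<and>
        (x \<in> {a..b} - N \<longrightarrow> (\<forall>y\<in>G \<inter> {a..b}. norm (F y - F x - (y - x) *\<^sub>R g x) \<le> e1 * \<bar>y - x\<bar>))" for x
    proof (cases "x \<in> {a..b} - N")
      case True
      from der[OF this] e1(1) obtain d where d: "d > 0"
        "\<And>y. y \<in> {a..b} \<Longrightarrow> norm (y - x) < d \<Longrightarrow> norm (F y - F x - (y - x) *\<^sub>R f x) \<le> e1 * norm (y - x)"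
        unfolding has_vector_derivative_def has_derivative_within_alt by blast
      show ?thesis
        by (rule exI[of _ "ball x d"]) (use True d in \<open>auto simp: g_def dist_real_def\<close>)
    next
      case False
      then show ?thesis
        using U by (cases "x \<in> N") auto
    qed
    then obtain \<gamma> where \<gamma>: "\<And>x. open (\<gamma> x)" "\<And>x. x \<in> \<gamma> x" "\<And>x. x \<in> N \<Longrightarrow> \<gamma> x \<subseteq> U"
      "\<And>x y. x \<in> {a..b} - N \<Longrightarrow> y \<in> \<gamma> x \<inter> {a..b} \<Longrightarrow> norm (F y - F x - (y - x) *\<^sub>R g x) \<le> e1 * \<bar>y - x\<bar>"
      by metis
    show "\<exists>\<gamma>. gauge \<gamma> \<and> (\<forall>\<D>. \<D> tagged_division_of {a..b} \<and> \<gamma> fine \<D> \<longrightarrow>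
        norm ((\<Sum>(x,k)\<in>\<D>. measure lborel k *\<^sub>R g x) - (F b - F a)) < e)"
    proof (intro exI[of _ \<gamma>] conjI allI impI)
      show "gauge \<gamma>" using \<gamma> by (auto simp: gauge_def)
      fix p assume "p tagged_division_of {a..b} \<and> \<gamma> fine p"
      then have p: "p tagged_division_of {a..b}" and fine: "\<gamma> fine p" by auto
      note pD = tagged_division_ofD[OF p]
      define p1 where "p1 = {(x,K). (x,K) \<in> p \<and> x \<notin> N}"
      define p2 where "p2 = {(x,K). (x,K) \<in> p \<and> x \<in> N}"
      have pU: "p = p1 \<union> p2" "p1 \<inter> p2 = {}" "finite p1" "finite p2" "p1 \<subseteq> p" "p2 \<subseteq> p"
        using pD(1) by (auto simp: p1_def p2_def intro: finite_subset[OF _ pD(1)])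
      have part: "p2 tagged_partial_division_of {a..b}"
        using p by (intro tagged_partial_division_subset[OF _ pU(6)]) (simp add: tagged_division_of_def)
      let ?h = "\<lambda>(x,K). norm (measure lborel K *\<^sub>R g x - (F (Sup K) - F (Inf K)))"
      have "norm ((\<Sum>(x,k)\<in>p. measure lborel k *\<^sub>R g x) - (F b - F a))
          = norm (\<Sum>(x,K)\<in>p. measure lborel K *\<^sub>R g x - (F (Sup K) - F (Inf K)))"
        unfolding additive_tagged_division_1[OF ab p, symmetric]
        by (simp add: sum_subtractf case_prod_unfold)
      also have "\<dots> \<le> sum ?h p"
        by (rule order_trans[OF norm_sum]) (simp add: case_prod_unfold)
      also have "\<dots> = sum ?h p1 + sum ?h p2"
        using pU by (simp add: sum.union_disjoint)
      also have "sum ?h p1 \<le> (\<Sum>(x,K)\<in>p1. e1 * measure lborel K)"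
      proof (rule sum_mono, clarify)
        fix x K assume xK: "(x, K) \<in> p1"
        then have xp: "(x, K) \<in> p" "x \<notin> N" by (auto simp: p1_def)
        obtain u v where K: "K = {u..v}" using pD(4)[OF xp(1)] by auto
        have xuv: "u \<le> x" "x \<le> v" using pD(2)[OF xp(1)] K by auto
        have sub: "K \<subseteq> {a..b}" "K \<subseteq> \<gamma> x" using pD(3)[OF xp(1)] fine xp(1) by (auto simp: fine_def)
        have "u \<in> K" "v \<in> K" using K xuv by auto
        then have uv: "u \<in> \<gamma> x \<inter> {a..b}" "v \<in> \<gamma> x \<inter> {a..b}" using sub by auto
        have xab: "x \<in> {a..b} - N" using xp(2) pD(2)[OF xp(1)] sub by auto
        have "measure lborel K *\<^sub>R g x - (F (Sup K) - F (Inf K))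
            = (F u - F x - (u - x) *\<^sub>R g x) - (F v - F x - (v - x) *\<^sub>R g x)"
          using K xuv by (simp add: algebra_simps)
        also have "norm \<dots> \<le> e1 * \<bar>u - x\<bar> + e1 * \<bar>v - x\<bar>"
          by (rule order_trans[OF norm_triangle_ineq4 add_mono[OF \<gamma>(4)[OF xab uv(1)] \<gamma>(4)[OF xab uv(2)]]])
        also have "\<dots> = e1 * measure lborel K" using K xuv by (simp add: algebra_simps)
        finally show "norm (measure lborel K *\<^sub>R g x - (F (Sup K) - F (Inf K))) \<le> e1 * measure lborel K" .
      qed
      also have "\<dots> \<le> (\<Sum>(x,K)\<in>p. e1 * measure lborel K)"
        by (rule sum_mono2) (use pD(1) pU e1 in auto)
      also have "\<dots> = e1 * (b - a)"
        using additive_content_tagged_division[of p a b] p ab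
        by (simp add: case_prod_unfold sum_distrib_left[symmetric])
      also have "sum ?h p2 = (\<Sum>(x,K)\<in>p2. (\<lambda>K. if K = {} then 0 else norm (F (Sup K) - F (Inf K))) K)"
      proof (rule sum.cong, simp, clarify)
        fix x K assume "(x, K) \<in> p2"
        then have "x \<in> K" "g x = 0" using pD(2) by (auto simp: p2_def g_def)
        then show "norm (measure lborel K *\<^sub>R g x - (F (Sup K) - F (Inf K))) = (if K = {} then 0 else norm (F (Sup K) - F (Inf K)))"
          by (auto simp: norm_minus_commute)
      qed
      also have "\<dots> = (\<Sum>K\<in>snd ` p2. if K = {} then 0 else norm (F (Sup K) - F (Inf K)))"
        by (rule sum.over_tagged_division_lemma[OF tagged_partial_division_of_Union_self[OF part]])
          (auto simp: box_eq_empty)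
      also have "\<dots> = (\<Sum>K\<in>snd ` p2. norm (F (Sup K) - F (Inf K)))"
        using pD(2) pU(6) by (intro sum.cong[OF refl]) fastforce
      also have "\<dots> < e / 2"
      proof (rule \<delta>(2))
        show dv: "(snd ` p2) division_of (\<Union>(snd ` p2))"
          by (rule partial_division_of_tagged_division[OF part])
        show "\<Union>(snd ` p2) \<subseteq> {a..b}" using pD(3) pU(6) by force
        have "(\<Sum>k\<in>snd ` p2. Sup k - Inf k) = (\<Sum>k\<in>snd ` p2. measure lebesgue k)"
        proof (rule sum.cong[OF refl])
          fix k assume "k \<in> snd ` p2"
          then obtain x where "(x, k) \<in> p" using pU(6) by force
          with pD(2,4) obtain u v where "k = {u..v}" "x \<in> k" by (metis box_real(2))
          then show "Sup k - Inf k = measure lebesgue k" by auto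
        qed
        also have "\<dots> = measure lebesgue (\<Union>(snd ` p2))" by (rule content_division[OF dv])
        also have "\<dots> \<le> measure lebesgue U"
        proof (rule measure_mono_fmeasurable)
          show "\<Union>(snd ` p2) \<subseteq> U"
            using fine \<gamma>(3) by (fastforce simp: p2_def fine_def)
          show "\<Union>(snd ` p2) \<in> sets lebesgue" using lmeasurable_division[OF dv] by auto
        qed (rule Ul)
        finally show "(\<Sum>k\<in>snd ` p2. Sup k - Inf k) < \<delta>" using mU by simp
      qed
      finally show "norm ((\<Sum>(x,k)\<in>p. measure lborel k *\<^sub>R g x) - (F b - F a)) < e"
        using e1 by simp
    qed
  qed
  then show ?thesis
    by (rule has_integral_spike[OF N, rotated]) (auto simp: g_def)
qed

lemma division_of_real_intervalE:
  fixes k :: "real set"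
  assumes "D division_of T" "T \<subseteq> S" "k \<in> D"
  obtains u v where "k = {u..v}" "u \<le> v" "k \<subseteq> S"
proof -
  obtain u v where "k = cbox u v" using division_ofD(4)[OF assms(1,3)] by blast
  moreover have "k \<noteq> {}" "k \<subseteq> T" using division_ofD(2,3)[OF assms(1,3)] by auto
  ultimately show ?thesis using assms(2) by (intro that[of u v]) auto
qed

text \<open>Truncate |f| at a height n: the remainder has integral below e / 2 over the whole
  interval by dominated convergence, and the truncated part contributes at most n times the total
  length.\<close>

lemma absolutely_integrable_small_on_divisions:
  fixes f :: "real \<Rightarrow> 'a::euclidean_space"
  assumes f: "f absolutely_integrable_on {a..b}" and e: "e > 0"
  obtains d where "d > 0" "\<And>D T. D division_of T \<Longrightarrow> T \<subseteq> {a..b} \<Longrightarrow> (\<Sum>k\<in>D. Sup k - Inf k) < d \<Longrightarrow>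
          (\<Sum>k\<in>D. integral k (\<lambda>x. norm (f x))) < e"
proof -
  let ?g = "\<lambda>n x. min (norm (f x)) (real n)"
  have nf: "(\<lambda>x. norm (f x)) absolutely_integrable_on {a..b}"
    using f by (rule absolutely_integrable_norm[unfolded comp_def])
  have g: "?g n absolutely_integrable_on {a..b}" for n
    by (intro absolutely_integrable_min_1 nf) auto
  have "(\<lambda>n. integral {a..b} (?g n)) \<longlonglongrightarrow> integral {a..b} (\<lambda>x. norm (f x))"
  proof (rule dominated_convergence(2))
    show "?g n integrable_on {a..b}" for n using g by (rule absolutely_integrable_on_def[THEN iffD1, THEN conjunct1])
    show "(\<lambda>x. norm (f x)) integrable_on {a..b}" using nf absolutely_integrable_on_def by blast
    show "norm (?g n x) \<le> norm (f x)" for n x by auto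
    show "(\<lambda>n. ?g n x) \<longlonglongrightarrow> norm (f x)" for x
    proof (rule tendsto_eventually)
      obtain m where "norm (f x) \<le> real m" using real_arch_simple by blast
      then show "\<forall>\<^sub>F n in sequentially. ?g n x = norm (f x)"
        by (intro eventually_sequentiallyI[of m]) auto
    qed
  qed
  then obtain n where n: "\<bar>integral {a..b} (?g n) - integral {a..b} (\<lambda>x. norm (f x))\<bar> < e / 2"
    using e by (metis LIMSEQ_iff half_gt_zero order_refl real_norm_def)
  let ?r = "\<lambda>x. norm (f x) - ?g n x"
  have r: "?r absolutely_integrable_on {a..b}" using nf g by (rule set_integral_diff)
  have r2: "integral {a..b} ?r < e / 2"
  proof -
    have "integral {a..b} ?r = integral {a..b} (\<lambda>x. norm (f x)) - integral {a..b} (?g n)"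
      using nf g by (intro integral_diff) (auto simp: absolutely_integrable_on_def)
    then show ?thesis using n by linarith
  qed
  show ?thesis
  proof (rule that[of "e / (2 * (real n + 1))"])
    show "e / (2 * (real n + 1)) > 0" using e by simp
    fix D T assume D: "D division_of T" "T \<subseteq> {a..b}" "(\<Sum>k\<in>D. Sup k - Inf k) < e / (2 * (real n + 1))"
    have *: "integral k (\<lambda>x. norm (f x)) \<le> integral k ?r + (real n + 1) * (Sup k - Inf k)" if "k \<in> D" for k
    proof -
      obtain u v where k: "k = {u..v}" "u \<le> v" "k \<subseteq> {a..b}"
        using division_of_real_intervalE[OF D(1,2) \<open>k \<in> D\<close>] .
      have i: "(\<lambda>x. norm (f x)) integrable_on k" "?g n integrable_on k" "?r integrable_on k"
        using integrable_on_subinterval[of _ "{a..b}" u v] k nf g[of n] r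
        by (simp_all add: absolutely_integrable_on_def)
      have "integral k (\<lambda>x. norm (f x)) = integral k ?r + integral k (?g n)"
        using i integral_add[OF i(3,2)] by simp
      also have "integral k (?g n) \<le> integral k (\<lambda>x. real n + 1)"
        by (rule integral_le[OF i(2)]) (use k in auto)
      also have "\<dots> = (real n + 1) * (Sup k - Inf k)" using k by simp
      finally show ?thesis by simp
    qed
    have "(\<Sum>k\<in>D. integral k (\<lambda>x. norm (f x))) \<le> (\<Sum>k\<in>D. integral k ?r + (real n + 1) * (Sup k - Inf k))"
      by (rule sum_mono) (rule *)
    also have "\<dots> = integral T ?r + (real n + 1) * (\<Sum>k\<in>D. Sup k - Inf k)"
    proof -
      have "?r integrable_on T"
        using D r integrable_on_subdivision absolutely_integrable_on_def by blast
      from integral_combine_division_topdown[OF this D(1)] show ?thesis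
        by (simp add: sum.distrib sum_distrib_left)
    qed
    also have "integral T ?r \<le> integral {a..b} ?r"
    proof (rule integral_subset_le)
      show "?r integrable_on {a..b}" using r by (simp add: absolutely_integrable_on_def)
      then show "?r integrable_on T" using D integrable_on_subdivision by blast
    qed (use D in auto)
    also have "(real n + 1) * (\<Sum>k\<in>D. Sup k - Inf k) < e / 2"
      using D(3) e by (simp add: field_simps)
    finally show "(\<Sum>k\<in>D. integral k (\<lambda>x. norm (f x))) < e" using r2 by simp
  qed
qed

lemma absolutely_cont_on_indefinite_integral:
  fixes f :: "real \<Rightarrow> 'a::euclidean_space"
  assumes f: "f absolutely_integrable_on {a..b}"
  shows "absolutely_cont_on {a..b} (\<lambda>x. integral {a..x} f)"
  unfolding absolutely_cont_on_def
proof (intro allI impI)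
  fix e :: real assume "e > 0"
  obtain d where d: "d > 0" "\<And>D T. D division_of T \<Longrightarrow> T \<subseteq> {a..b} \<Longrightarrow> (\<Sum>k\<in>D. Sup k - Inf k) < d \<Longrightarrow>
          (\<Sum>k\<in>D. integral k (\<lambda>x. norm (f x))) < e"
    using absolutely_integrable_small_on_divisions[OF f \<open>e > 0\<close>] by blast
  show "\<exists>\<delta>>0. \<forall>D T. D division_of T \<and> T \<subseteq> {a..b} \<and> (\<Sum>k\<in>D. Sup k - Inf k) < \<delta> \<longrightarrow>
        (\<Sum>k\<in>D. norm (integral {a..Sup k} f - integral {a..Inf k} f)) < e"
  proof (rule exI[of _ d], intro conjI allI impI d(1), elim conjE)
    fix D T assume D: "D division_of T" "T \<subseteq> {a..b}" "(\<Sum>k\<in>D. Sup k - Inf k) < d"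
    have "(\<Sum>k\<in>D. norm (integral {a..Sup k} f - integral {a..Inf k} f)) \<le> (\<Sum>k\<in>D. integral k (\<lambda>x. norm (f x)))"
    proof (rule sum_mono)
      fix k assume "k \<in> D"
      then obtain u v where k: "k = {u..v}" "u \<le> v" "k \<subseteq> {a..b}"
        by (rule division_of_real_intervalE[OF D(1,2)])
      have i: "f integrable_on {a..v}" "(\<lambda>x. norm (f x)) integrable_on k" "f integrable_on k"
        using f k by (auto intro: integrable_on_subinterval simp: absolutely_integrable_on_def)
      have "integral {a..v} f - integral {a..u} f = integral k f"
        using Henstock_Kurzweil_Integration.integral_combine[OF _ k(2) i(1)] k by (simp add: algebra_simps)
      moreover have "norm (integral k f) \<le> integral k (\<lambda>x. norm (f x))"
        by (rule integral_norm_bound_integral) (use i in auto)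
      ultimately show "norm (integral {a..Sup k} f - integral {a..Inf k} f) \<le> integral k (\<lambda>x. norm (f x))"
        using k by simp
    qed
    also have "\<dots> < e" by (rule d(2)[OF D])
    finally show "(\<Sum>k\<in>D. norm (integral {a..Sup k} f - integral {a..Inf k} f)) < e" .
  qed
qed

text \<open>Lebesgue differentiation from Henstock's lemma. At points x of \<open>E k\<close> there
  are arbitrarily short intervals from x to y over which the increment misses (y - x) f(x) by more
  than |y - x| / (k + 1). Vitali's theorem selects disjoint ones that cover \<open>E k\<close> up to
  a null set; Henstock's lemma bounds the sum of their deviations by e / (k + 1), hence their total
  length by e.\<close>

lemma indefinite_integral_derivative_ae:
  fixes f :: "real \<Rightarrow> 'a::euclidean_space"
  assumes f: "f integrable_on {a..b}"
  obtains N where "negligible N"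
    "\<And>x. x \<in> {a..b} - N \<Longrightarrow> ((\<lambda>x. integral {a..x} f) has_vector_derivative f x) (at x within {a..b})"
proof -
  define F where "F x = integral {a..x} f" for x
  define bad where "bad k x y \<longleftrightarrow> x \<in> {a..b} \<and> y \<in> {a..b} \<and> x \<noteq> y \<and>
      \<bar>y - x\<bar> < (real k + 1) * norm (F y - F x - (y - x) *\<^sub>R f x)" for k x y
  define E where "E k = {x. \<forall>d>0. \<exists>y. bad k x y \<and> \<bar>y - x\<bar> < d}" for k
  have F_diff: "F v - F u = integral {u..v} f" if "a \<le> u" "u \<le> v" "v \<le> b" for u v
  proof -
    have "f integrable_on {a..v}" using f that by (auto intro: integrable_on_subinterval)
    from Henstock_Kurzweil_Integration.integral_combine[OF that(1,2) this] show ?thesis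
      by (simp add: F_def algebra_simps)
  qed
  have "negligible (E k)" for k
    unfolding negligible_outer_le
  proof (intro allI impI)
    fix e :: real assume e: "e > 0"
    then have e': "e / (real k + 1) > 0" by simp
    obtain \<gamma> where \<gamma>: "gauge \<gamma>"
      "\<And>p. \<lbrakk>p tagged_partial_division_of {a..b}; \<gamma> fine p\<rbrakk> \<Longrightarrow>
             sum (\<lambda>(x,k). norm(measure lborel k *\<^sub>R f x - integral k f)) p < e / (real k + 1)"
      by (rule Henstock_lemma[of f a b, unfolded box_real, OF f e']) (erule that, blast)
    \<comment> \<open>The closed interval between the two entries of the pair, written as a ball
      because the Vitali covering theorem is about balls.\<close>
    define J where "J i = cball ((fst i + snd i) / 2) (\<bar>snd i - fst i\<bar> / 2)" for i :: "real \<times> real"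
    have J: "J (x, y) = {min x y..max x y}" for x y
      by (auto simp: J_def cball_eq_atLeastAtMost min_def max_def field_simps)
    \<comment> \<open>Intervals inside the gauge set of their first endpoint: finite disjoint
      subfamilies, tagged by that endpoint, are fine partial divisions to which Henstock's lemma
      applies.\<close>
    define K where "K = {(x, y). bad k x y \<and> J (x, y) \<subseteq> \<gamma> x}"
    obtain C where C: "countable C" "C \<subseteq> K" "pairwise (\<lambda>i j. disjnt (J i) (J j)) C"
      "negligible (E k - (\<Union>i\<in>C. J i))"
      unfolding J_def
    proof (rule Vitali_covering_theorem_cballs[of K "\<lambda>i. \<bar>snd i - fst i\<bar> / 2" "E k" "\<lambda>i. (fst i + snd i) / 2"])
      show "0 < \<bar>snd i - fst i\<bar> / 2" if "i \<in> K" for i using that by (auto simp: K_def bad_def)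
      fix x d :: real assume x: "x \<in> E k" and d: "0 < d"
      have "open (\<gamma> x)" "x \<in> \<gamma> x" using \<gamma>(1) by (auto simp: gauge_def)
      then obtain r where r: "r > 0" "ball x r \<subseteq> \<gamma> x" using openE by blast
      obtain y where y: "bad k x y" "\<bar>y - x\<bar> < min d r"
      proof -
        have "min d r > 0" using d r by simp
        then show ?thesis using x that unfolding E_def by blast
      qed
      have "J (x, y) \<subseteq> ball x r" using y by (auto simp: J dist_real_def)
      then have "(x, y) \<in> K" using y r by (auto simp: K_def)
      moreover have "x \<in> J (x, y)" by (simp add: J)
      ultimately show "\<exists>i. i \<in> K \<and> x \<in> cball ((fst i + snd i) / 2) (\<bar>snd i - fst i\<bar> / 2) \<and> \<bar>snd i - fst i\<bar> / 2 < d"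
        using y by (intro exI[of _ "(x, y)"]) (auto simp: J_def)
    qed blast
    have bound: "measure lebesgue (\<Union>i\<in>I. J i) \<le> e" if I: "I \<subseteq> C" "finite I" for I
    proof -
      have ne: "fst i \<in> J i" for i by (cases i) (simp add: J)
      have disj: "J i \<inter> J j = {}" if "i \<in> I" "j \<in> I" "i \<noteq> j" for i j
        using C(3) that I unfolding pairwise_def disjnt_def by blast
      let ?p = "(\<lambda>i. (fst i, J i)) ` I"
      have inj: "inj_on (\<lambda>i. (fst i, J i)) I"
        using disj ne by (intro inj_onI) (metis Int_iff Pair_inject empty_iff)
      have JI: "\<exists>x y. i = (x, y) \<and> bad k x y \<and> J i \<subseteq> \<gamma> x" if "i \<in> I" for i
        using that I C(2) by (auto simp: K_def)
      have p: "?p tagged_partial_division_of {a..b}"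
        unfolding tagged_partial_division_of_def
      proof (intro conjI allI impI)
        show "finite ?p" using I by simp
        fix x L assume xL: "(x, L) \<in> ?p"
        then obtain i where i: "i \<in> I" "x = fst i" "L = J i" by auto
        show "x \<in> L" using ne i by auto
        obtain u v where uv: "i = (u, v)" "bad k u v" using JI i by blast
        show "L \<subseteq> {a..b}" using uv i by (auto simp: J bad_def)
        show "\<exists>u v. L = cbox u v" using uv i by (auto simp: J)
      next
        fix x1 x2 K1 K2 assume "(x1, K1) \<in> ?p \<and> (x2, K2) \<in> ?p \<and> (x1, K1) \<noteq> (x2, K2)"
        then obtain i j where ij: "i \<in> I" "K1 = J i" "j \<in> I" "K2 = J j" "i \<noteq> j" by auto
        then show "interior K1 \<inter> interior K2 = {}"
          using disj[of i j] interior_subset[of K1] interior_subset[of K2] by auto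
      qed
      have fine: "\<gamma> fine ?p" using JI by (fastforce simp: fine_def)
      have "measure lebesgue (\<Union>i\<in>I. J i) \<le> (\<Sum>i\<in>I. measure lebesgue (J i))"
        using I by (intro measure_UNION_le) (auto simp: J_def)
      also have "\<dots> \<le> (\<Sum>i\<in>I. (real k + 1) * norm (measure lborel (J i) *\<^sub>R f (fst i) - integral (J i) f))"
      proof (rule sum_mono)
        fix i assume "i \<in> I"
        then obtain x y where i: "i = (x, y)" "bad k x y" using JI by blast
        have xy: "x \<in> {a..b}" "y \<in> {a..b}" "x \<noteq> y" using i by (auto simp: bad_def)
        have "norm (F y - F x - (y - x) *\<^sub>R f x) = norm (measure lborel (J i) *\<^sub>R f x - integral (J i) f)"
        proof (cases "x \<le> y")
          case True
          then show ?thesis using xy F_diff[of x y] by (simp add: i J norm_minus_commute)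
        next
          case False
          have "F y - F x - (y - x) *\<^sub>R f x = (x - y) *\<^sub>R f x - (F x - F y)"
            by (simp add: algebra_simps)
          then show ?thesis
            unfolding \<open>F y - F x - (y - x) *\<^sub>R f x = _\<close> using False xy F_diff[of y x] by (simp add: i J)
        qed
        moreover have "measure lebesgue (J i) = \<bar>y - x\<bar>" by (cases "x \<le> y") (simp_all add: i J)
        ultimately show "measure lebesgue (J i) \<le> (real k + 1) * norm (measure lborel (J i) *\<^sub>R f (fst i) - integral (J i) f)"
          using i by (simp add: bad_def)
      qed
      also have "\<dots> = (real k + 1) * sum (\<lambda>(x,k). norm(measure lborel k *\<^sub>R f x - integral k f)) ?p"
        by (simp add: sum.reindex[OF inj] sum_distrib_left)
      also have "\<dots> \<le> (real k + 1) * (e / (real k + 1))"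
        using \<gamma>(2)[OF p fine] by (intro mult_left_mono) auto
      finally show ?thesis by simp
    qed
    have 1: "(\<Union>i\<in>C. J i) \<in> lmeasurable" "measure lebesgue (\<Union>i\<in>C. J i) \<le> e"
      using fmeasurable_UN_bound[OF C(1) _ bound] measure_UN_bound[OF C(1) _ bound]
      by (auto simp: J_def)
    let ?N = "E k - (\<Union>i\<in>C. J i)"
    have 2: "?N \<in> lmeasurable" "measure lebesgue ?N = 0"
      using C(4) by (auto simp: negligible_imp_measurable negligible_imp_measure0)
    show "\<exists>T. E k \<subseteq> T \<and> T \<in> lmeasurable \<and> measure lebesgue T \<le> e"
    proof (intro exI[of _ "?N \<union> (\<Union>i\<in>C. J i)"] conjI)
      show "measure lebesgue (?N \<union> (\<Union>i\<in>C. J i)) \<le> e"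
        using measure_Un_le[of ?N lebesgue "\<Union>i\<in>C. J i"] 1 2 by auto
      show "?N \<union> (\<Union>i\<in>C. J i) \<in> lmeasurable" using 1 2 by (intro fmeasurable.Un)
    qed auto
  qed
  then have N: "negligible (\<Union>k. E k)" by (intro negligible_countable_Union) auto
  show ?thesis
  proof (rule that[OF N])
    fix x assume x: "x \<in> {a..b} - (\<Union>k. E k)"
    show "((\<lambda>x. integral {a..x} f) has_vector_derivative f x) (at x within {a..b})"
      unfolding has_vector_derivative_def has_derivative_within_alt F_def[symmetric]
    proof (intro conjI allI impI bounded_linear_scaleR_left)
      fix e :: real assume "e > 0"
      then obtain k where k: "1 / (real k + 1) < e"
        by (rule nat_approx_posE) (simp add: that add.commute)
      from x obtain d where d: "d > 0" "\<And>y. bad k x y \<Longrightarrow> \<not> \<bar>y - x\<bar> < d"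
        by (force simp: E_def)
      show "\<exists>d>0. \<forall>y\<in>{a..b}. norm (y - x) < d \<longrightarrow> norm (F y - F x - (y - x) *\<^sub>R f x) \<le> e * norm (y - x)"
      proof (intro exI[of _ d] conjI ballI impI d(1))
        fix y assume y: "y \<in> {a..b}" "norm (y - x) < d"
        show "norm (F y - F x - (y - x) *\<^sub>R f x) \<le> e * norm (y - x)"
        proof (cases "y = x")
          case False
          then have "(real k + 1) * norm (F y - F x - (y - x) *\<^sub>R f x) \<le> \<bar>y - x\<bar>"
            using d(2)[of y] x y by (intro leI) (auto simp: bad_def)
          then have "norm (F y - F x - (y - x) *\<^sub>R f x) \<le> 1 / (real k + 1) * \<bar>y - x\<bar>"
            by (simp add: field_simps)
          also have "\<dots> \<le> e * \<bar>y - x\<bar>" using k by (intro mult_right_mono) auto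
          finally show ?thesis by simp
        qed simp
      qed
    qed
  qed
qed

text \<open>The integral form of "F is absolutely continuous with derivative f almost everywhere".
  It does not see changes of \<open>f\<close> on null sets (\<open>ac_primitive_spike\<close>), and
  it is translated from and to the differential form by \<open>ac_primitiveI\<close>,
  \<open>ac_primitive_imp_absolutely_cont_on\<close> and
  \<open>ac_primitive_has_vector_derivative_ae\<close>.\<close>

definition ac_primitive :: "real \<Rightarrow> real \<Rightarrow> (real \<Rightarrow> 'a::euclidean_space) \<Rightarrow> (real \<Rightarrow> 'a) \<Rightarrow> bool" where
  "ac_primitive a b f F \<longleftrightarrow> f absolutely_integrable_on {a..b} \<and>
     (\<forall>x\<in>{a..b}. F x = F a + integral {a..x} f)"

lemma ac_primitiveD:
  assumes "ac_primitive a b f F"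
  shows "f absolutely_integrable_on {a..b}" "f integrable_on {a..b}"
    "\<And>x. x \<in> {a..b} \<Longrightarrow> F x = F a + integral {a..x} f"
  using assms unfolding ac_primitive_def absolutely_integrable_on_def by blast+

lemma ac_primitive_cong:
  assumes "ac_primitive a b f F" "\<And>x. x \<in> {a..b} \<Longrightarrow> G x = F x" "a \<le> b"
  shows "ac_primitive a b f G"
  unfolding ac_primitive_def
proof (intro conjI ballI)
  fix x assume x: "x \<in> {a..b}"
  show "G x = G a + integral {a..x} f"
    using ac_primitiveD(3)[OF assms(1) x] assms(2)[OF x] assms(2)[of a] assms(3) by simp
qed (rule ac_primitiveD(1)[OF assms(1)])

lemma absolutely_cont_on_add_const:
  "absolutely_cont_on S F \<Longrightarrow> absolutely_cont_on S (\<lambda>x. c + F x)"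
  by (simp add: absolutely_cont_on_def)

lemma absolutely_cont_on_cong:
  assumes "absolutely_cont_on S F" "\<And>x. x \<in> S \<Longrightarrow> G x = F x"
  shows "absolutely_cont_on S G"
  unfolding absolutely_cont_on_def
proof (intro allI impI)
  fix e :: real assume "e > 0"
  then obtain d where d: "d > 0" "\<And>D T. D division_of T \<and> T \<subseteq> S \<and> (\<Sum>k\<in>D. Sup k - Inf k) < d \<Longrightarrow>
        (\<Sum>k\<in>D. norm (F (Sup k) - F (Inf k))) < e"
    using assms(1) unfolding absolutely_cont_on_def by blast
  have "(\<Sum>k\<in>D. norm (G (Sup k) - G (Inf k))) = (\<Sum>k\<in>D. norm (F (Sup k) - F (Inf k)))"
    if DT: "D division_of T" "T \<subseteq> S" for D T
  proof (rule sum.cong[OF refl])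
    fix k assume "k \<in> D"
    then obtain u v where "k = {u..v}" "u \<le> v" "k \<subseteq> S"
      by (rule division_of_real_intervalE[OF DT])
    then show "norm (G (Sup k) - G (Inf k)) = norm (F (Sup k) - F (Inf k))"
      using assms(2) by (auto simp: subset_iff)
  qed
  then show "\<exists>\<delta>>0. \<forall>D T. D division_of T \<and> T \<subseteq> S \<and> (\<Sum>k\<in>D. Sup k - Inf k) < \<delta> \<longrightarrow>
        (\<Sum>k\<in>D. norm (G (Sup k) - G (Inf k))) < e"
    using d by metis
qed

lemma ac_primitive_imp_absolutely_cont_on:
  assumes "ac_primitive a b f F"
  shows "absolutely_cont_on {a..b} F"
  using absolutely_cont_on_cong[OF absolutely_cont_on_add_const[OF absolutely_cont_on_indefinite_integral]]
    assms unfolding ac_primitive_def by blast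

lemma ac_primitive_imp_continuous_on:
  assumes "ac_primitive a b f F"
  shows "continuous_on {a..b} F"
proof -
  have "continuous_on {a..b} (\<lambda>x. F a + integral {a..x} f)"
    by (intro continuous_intros indefinite_integral_continuous_1 ac_primitiveD(2)[OF assms])
  then show ?thesis
    by (rule continuous_on_eq) (rule ac_primitiveD(3)[OF assms, symmetric])
qed

lemma ac_primitive_has_vector_derivative_ae:
  assumes "ac_primitive a b f F"
  obtains N where "negligible N"
    "\<And>x. x \<in> {a..b} - N \<Longrightarrow> (F has_vector_derivative f x) (at x within {a..b})"
proof -
  have i: "f integrable_on {a..b}" by (rule ac_primitiveD(2)[OF assms])
  obtain N where N: "negligible N"
    "\<And>x. x \<in> {a..b} - N \<Longrightarrow> ((\<lambda>x. integral {a..x} f) has_vector_derivative f x) (at x within {a..b})"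
    by (rule indefinite_integral_derivative_ae[OF i]) (erule that, blast)
  show ?thesis
  proof (rule that[OF N(1)])
    fix x assume x: "x \<in> {a..b} - N"
    have "((\<lambda>x. F a + integral {a..x} f) has_vector_derivative f x) (at x within {a..b})"
      using N(2)[OF x] by (auto intro!: derivative_eq_intros)
    then show "(F has_vector_derivative f x) (at x within {a..b})"
      by (rule has_vector_derivative_transform[rotated 2]) (use x in \<open>auto intro: ac_primitiveD(3)[OF assms]\<close>)
  qed
qed

lemma ac_primitiveI:
  assumes ac: "absolutely_cont_on {a..b} F" and f: "f absolutely_integrable_on {a..b}" and N: "negligible N"
    and der: "\<And>x. x \<in> {a..b} - N \<Longrightarrow> (F has_vector_derivative f x) (at x within {a..b})"
  shows "ac_primitive a b f F"
  unfolding ac_primitive_def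
proof (intro conjI f ballI)
  fix x assume x: "x \<in> {a..b}"
  have "(f has_integral F x - F a) {a..x}"
  proof (rule absolutely_cont_on_has_integral[OF _ _ N])
    show "absolutely_cont_on {a..x} F"
      using ac x unfolding absolutely_cont_on_def
      by (meson atLeastatMost_subset_iff atLeastAtMost_iff order_refl order_trans)
    show "(F has_vector_derivative f y) (at y within {a..x})" if "y \<in> {a..x} - N" for y
      using has_vector_derivative_within_subset[OF der, of y "{a..x}"] that x by auto
  qed (use x in auto)
  then show "F x = F a + integral {a..x} f" by (simp add: integral_unique)
qed

lemma ac_primitive_spike:
  assumes "ac_primitive a b f F" "negligible N" "\<And>x. x \<in> {a..b} - N \<Longrightarrow> g x = f x"
  shows "ac_primitive a b g F"
proof -
  have "integral {a..x} g = integral {a..x} f" if "x \<in> {a..b}" for x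
    by (rule integral_spike[OF assms(2)]) (use assms(3) that in auto)
  moreover have "g absolutely_integrable_on {a..b}"
    using assms unfolding ac_primitive_def by (blast intro: absolutely_integrable_spike)
  ultimately show ?thesis using assms(1) unfolding ac_primitive_def by metis
qed

lemma ac_primitive_C1:
  assumes "\<And>x. x \<in> {a..b} \<Longrightarrow> (F has_vector_derivative f x) (at x within {a..b})" "continuous_on {a..b} f"
  shows "ac_primitive a b f F"
  unfolding ac_primitive_def
proof (intro conjI ballI)
  show "f absolutely_integrable_on {a..b}"
    using assms(2) by (rule absolutely_integrable_continuous_real)
  fix x assume x: "x \<in> {a..b}"
  have "(f has_integral F x - F a) {a..x}"
    by (rule fundamental_theorem_of_calculus)
      (use x in \<open>auto intro!: has_vector_derivative_within_subset[OF assms(1)]\<close>)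
  then show "F x = F a + integral {a..x} f" by (simp add: integral_unique)
qed

lemma abs_int_mult_continuous:
  fixes f g :: "real \<Rightarrow> 'a::{euclidean_space,real_normed_field}"
  assumes "f absolutely_integrable_on {a..b}" "continuous_on {a..b} g"
  shows "(\<lambda>x. f x * g x) absolutely_integrable_on {a..b}" "(\<lambda>x. g x * f x) absolutely_integrable_on {a..b}"
proof -
  have "compact (g ` {a..b})" using assms(2) by (intro compact_continuous_image) auto
  then have "bounded (g ` {a..b})" by (rule compact_imp_bounded)
  moreover have "g \<in> borel_measurable (lebesgue_on {a..b})"
    using assms(2) by (intro continuous_imp_measurable_on_sets_lebesgue) auto
  ultimately have "(\<lambda>x. g x * f x) absolutely_integrable_on {a..b}"
    using assms(1) by (intro absolutely_integrable_bounded_measurable_product[where h="(*)"]) 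
      (auto simp: bounded_bilinear_mult bilinear_conv_bounded_bilinear)
  then show "(\<lambda>x. g x * f x) absolutely_integrable_on {a..b}" "(\<lambda>x. f x * g x) absolutely_integrable_on {a..b}"
    by (simp_all add: mult.commute)
qed

lemma absolutely_cont_on_mult:
  fixes F G :: "real \<Rightarrow> complex"
  assumes F: "absolutely_cont_on {a..b} F" and G: "absolutely_cont_on {a..b} G"
    and cF: "continuous_on {a..b} F" and cG: "continuous_on {a..b} G"
  shows "absolutely_cont_on {a..b} (\<lambda>x. F x * G x)"
  unfolding absolutely_cont_on_def
proof (intro allI impI)
  fix e :: real assume e: "e > 0"
  have "bounded (F ` {a..b})" "bounded (G ` {a..b})"
    using cF cG by (auto intro!: compact_imp_bounded compact_continuous_image)
  then obtain A B where AB: "\<And>x. x \<in> {a..b} \<Longrightarrow> norm (F x) \<le> A" "\<And>x. x \<in> {a..b} \<Longrightarrow> norm (G x) \<le> B"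
    "A > 0" "B > 0"
    unfolding bounded_pos ball_simps by (metis image_eqI)
  have AB': "e / (2 * A) > 0" "e / (2 * B) > 0" using e AB by auto
  obtain d1 where d1: "d1 > 0" "\<And>D T. D division_of T \<and> T \<subseteq> {a..b} \<and> (\<Sum>k\<in>D. Sup k - Inf k) < d1 \<Longrightarrow>
        (\<Sum>k\<in>D. norm (F (Sup k) - F (Inf k))) < e / (2 * B)"
    using F AB'(2) unfolding absolutely_cont_on_def by blast
  obtain d2 where d2: "d2 > 0" "\<And>D T. D division_of T \<and> T \<subseteq> {a..b} \<and> (\<Sum>k\<in>D. Sup k - Inf k) < d2 \<Longrightarrow>
        (\<Sum>k\<in>D. norm (G (Sup k) - G (Inf k))) < e / (2 * A)"
    using G AB'(1) unfolding absolutely_cont_on_def by blast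
  show "\<exists>\<delta>>0. \<forall>D T. D division_of T \<and> T \<subseteq> {a..b} \<and> (\<Sum>k\<in>D. Sup k - Inf k) < \<delta> \<longrightarrow>
        (\<Sum>k\<in>D. norm (F (Sup k) * G (Sup k) - F (Inf k) * G (Inf k))) < e"
  proof (rule exI[of _ "min d1 d2"], intro conjI allI impI)
    show "min d1 d2 > 0" using d1 d2 by simp
    fix D T assume D: "D division_of T \<and> T \<subseteq> {a..b} \<and> (\<Sum>k\<in>D. Sup k - Inf k) < min d1 d2"
    have "(\<Sum>k\<in>D. norm (F (Sup k) * G (Sup k) - F (Inf k) * G (Inf k)))
        \<le> (\<Sum>k\<in>D. B * norm (F (Sup k) - F (Inf k)) + A * norm (G (Sup k) - G (Inf k)))"
    proof (rule sum_mono)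
      fix k assume "k \<in> D"
      then obtain u v where k: "k = {u..v}" "u \<le> v" "k \<subseteq> {a..b}"
        using D division_of_real_intervalE[of D T "{a..b}" k] by metis
      then have uv: "u \<in> {a..b}" "v \<in> {a..b}" by (auto simp: subset_iff)
      have "F v * G v - F u * G u = (F v - F u) * G v + F u * (G v - G u)"
        by (simp add: algebra_simps)
      also have "norm \<dots> \<le> norm (F v - F u) * norm (G v) + norm (F u) * norm (G v - G u)"
        by (metis norm_mult norm_triangle_ineq)
      also have "\<dots> \<le> norm (F v - F u) * B + A * norm (G v - G u)"
        using AB uv by (intro add_mono mult_left_mono mult_right_mono) auto
      finally show "norm (F (Sup k) * G (Sup k) - F (Inf k) * G (Inf k))
        \<le> B * norm (F (Sup k) - F (Inf k)) + A * norm (G (Sup k) - G (Inf k))"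
        using k by (simp add: mult.commute)
    qed
    also have "\<dots> = B * (\<Sum>k\<in>D. norm (F (Sup k) - F (Inf k))) + A * (\<Sum>k\<in>D. norm (G (Sup k) - G (Inf k)))"
      by (simp add: sum.distrib sum_distrib_left)
    also have "\<dots> < B * (e / (2 * B)) + A * (e / (2 * A))"
      using D d1(2)[of D T] d2(2)[of D T] AB by (intro add_strict_mono mult_strict_left_mono) auto
    also have "\<dots> = e" using AB by simp
    finally show "(\<Sum>k\<in>D. norm (F (Sup k) * G (Sup k) - F (Inf k) * G (Inf k))) < e" .
  qed
qed

text \<open>The pointwise product rule holds off two null sets, and absolute continuity of the
  product allows it to be integrated back. It provides both integrating factors and integration by
  parts.\<close>

lemma ac_primitive_mult:
  fixes F G :: "real \<Rightarrow> complex"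
  assumes F: "ac_primitive a b f F" and G: "ac_primitive a b g G"
  shows "ac_primitive a b (\<lambda>x. f x * G x + F x * g x) (\<lambda>x. F x * G x)"
proof -
  obtain N1 where N1: "negligible N1" "\<And>x. x \<in> {a..b} - N1 \<Longrightarrow> (F has_vector_derivative f x) (at x within {a..b})"
    by (rule ac_primitive_has_vector_derivative_ae[OF F]) (erule that, blast)
  obtain N2 where N2: "negligible N2" "\<And>x. x \<in> {a..b} - N2 \<Longrightarrow> (G has_vector_derivative g x) (at x within {a..b})"
    by (rule ac_primitive_has_vector_derivative_ae[OF G]) (erule that, blast)
  note c = ac_primitive_imp_continuous_on[OF F] ac_primitive_imp_continuous_on[OF G]
  note ac = ac_primitive_imp_absolutely_cont_on[OF F] ac_primitive_imp_absolutely_cont_on[OF G]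
  show ?thesis
  proof (rule ac_primitiveI[where N = "N1 \<union> N2"])
    show "absolutely_cont_on {a..b} (\<lambda>x. F x * G x)" by (rule absolutely_cont_on_mult[OF ac c])
    show "(\<lambda>x. f x * G x + F x * g x) absolutely_integrable_on {a..b}"
      by (intro set_integral_add abs_int_mult_continuous ac_primitiveD(1)[OF F] ac_primitiveD(1)[OF G] c)
    fix x assume "x \<in> {a..b} - (N1 \<union> N2)"
    then show "((\<lambda>x. F x * G x) has_vector_derivative f x * G x + F x * g x) (at x within {a..b})"
      using has_vector_derivative_mult[OF N1(2)[of x] N2(2)[of x]] by (simp add: add.commute)
  qed (use N1 N2 in auto)
qed

section \<open>Completeness of the space of square integrable functions\<close>

lemma L2_space_eq_abs:
  obtains f where "square_integrable f" "F = abs_L2_space f"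
proof -
  have "L2_equiv (rep_L2_space F) (rep_L2_space F)"
    using Quotient_L2_space by (metis Quotient_rep_reflp)
  moreover have "F = abs_L2_space (rep_L2_space F)"
    using Quotient_L2_space by (metis Quotient_abs_rep)
  ultimately show ?thesis by (auto simp: L2_equiv_def intro: that)
qed

lemma L2_equiv_refl_iff: "L2_equiv f f \<longleftrightarrow> square_integrable f"
  by (auto simp: L2_equiv_def)

lemma abs_L2_space_diff:
  assumes "square_integrable f" "square_integrable g"
  shows "abs_L2_space f - abs_L2_space g = abs_L2_space (\<lambda>x. f x - g x)"
  using assms square_integrable_scaleR[of g "-1"]
  by (simp add: minus_L2_space_def uminus_L2_space.abs_eq plus_L2_space.abs_eq L2_equiv_refl_iff)

lemma norm_abs_L2_space:
  assumes "square_integrable f"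
  shows "(norm (abs_L2_space f))\<^sup>2 = (1 / pi) * (LINT x|lebesgue_on {0..pi}. (norm (f x))\<^sup>2)"
proof -
  have "(norm (abs_L2_space f))\<^sup>2 = abs_L2_space f \<bullet> abs_L2_space f"
    by (rule power2_norm_eq_inner)
  then show ?thesis using assms
    by (simp add: inner_L2_space.abs_eq L2_equiv_refl_iff power2_norm_eq_inner)
qed

lemma square_integrable_diff:
  fixes f g :: "real \<Rightarrow> 'a::euclidean_space"
  assumes "square_integrable f" "square_integrable g"
  shows "square_integrable (\<lambda>x. f x - g x)"
  using square_integrable_add[OF assms(1) square_integrable_scaleR[OF assms(2), of "-1"]] by simp

text \<open>Expand (t - 2 e)^2 >= 0. With e free this turns smallness in L2 into smallness in L1 on
  a space of finite measure.\<close>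

lemma norm_le_square_weighted:
  fixes t :: real assumes "e > 0" shows "t \<le> t\<^sup>2 / (4 * e) + e"
proof -
  have "0 \<le> (t - 2 * e)\<^sup>2" by simp
  then show ?thesis using assms by (simp add: field_simps power2_eq_square)
qed

lemma square_integrable_imp_integrable:
  fixes f :: "real \<Rightarrow> 'a::{banach,second_countable_topology}"
  assumes "square_integrable f"
  shows "integrable (lebesgue_on {0..pi}) f"
proof (rule Bochner_Integration.integrable_bound)
  show "integrable (lebesgue_on {0..pi}) (\<lambda>x. (norm (f x))\<^sup>2 / 4 + 1)"
    using assms by (auto simp: square_integrable_def finite_measure_lebesgue_on 
        intro!: Bochner_Integration.integrable_add finite_measure.integrable_const)
  show "f \<in> borel_measurable (lebesgue_on {0..pi})"
    using assms by (auto simp: square_integrable_def)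
  show "AE x in lebesgue_on {0..pi}. norm (f x) \<le> norm ((norm (f x))\<^sup>2 / 4 + 1)"
    using norm_le_square_weighted[of 1] by auto
qed

text \<open>Riesz-Fischer: a Cauchy sequence in L2 is Cauchy in L1, has a subsequence converging
  almost everywhere, and Fatou's lemma identifies its limit as the limit in L2. Completeness carries
  over to the space of bounded operators, where it makes continuous operator valued functions on the
  circle integrable.\<close>

instance L2_space :: banach
proof
  fix X :: "nat \<Rightarrow> L2_space" assume X: "Cauchy X"
  let ?M = "lebesgue_on {0..pi}"
  have fin: "finite_measure ?M" by (simp add: finite_measure_lebesgue_on)
  obtain s where s: "\<And>n. square_integrable (s n)" "\<And>n. X n = abs_L2_space (s n)"
  proof -
    have "\<forall>n. \<exists>f. square_integrable f \<and> X n = abs_L2_space f" using L2_space_eq_abs by blast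
    from choice[OF this] show ?thesis using that by blast
  qed
  have m[measurable]: "s n \<in> borel_measurable ?M" for n using s(1) unfolding square_integrable_def by blast
  have d: "(LINT x|?M. (norm (s i x - s j x))\<^sup>2) = pi * (norm (X i - X j))\<^sup>2" for i j
    using norm_abs_L2_space[OF square_integrable_diff[OF s(1)[of i] s(1)[of j]]] s
    by (simp add: abs_L2_space_diff)
  have int2: "integrable ?M (\<lambda>x. (norm (s i x - s j x))\<^sup>2)" for i j
    using square_integrable_diff[OF s(1)[of i] s(1)[of j]] by (simp add: square_integrable_def)
  have l1: "(LINT x|?M. norm (s i x - s j x)) \<le> pi * (norm (X i - X j))\<^sup>2 / (4 * e) + pi * e" if "e > 0" for e i j
  proof -
    have "(LINT x|?M. norm (s i x - s j x)) \<le> (LINT x|?M. (norm (s i x - s j x))\<^sup>2 / (4 * e) + e)"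
      using square_integrable_imp_integrable[OF square_integrable_diff[OF s(1)[of i] s(1)[of j]]] int2 fin
      by (intro integral_mono norm_le_square_weighted that Bochner_Integration.integrable_add
          finite_measure.integrable_const integrable_norm) auto
    also have "\<dots> = pi * (norm (X i - X j))\<^sup>2 / (4 * e) + pi * e"
      using int2 fin by (subst Bochner_Integration.integral_add) (auto simp: d finite_measure.integrable_const measure_restrict_space)
    finally show ?thesis .
  qed
  have cau: "\<exists>N. \<forall>i\<ge>N. \<forall>j\<ge>N. (LINT x|?M. norm (s i x - s j x)) < e" if e: "e > 0" for e
  proof -
    \<comment> \<open>Makes the bound pi c / 4 + pi c equal to 5 e / 16.\<close>
    define c where "c = e / (4 * pi)"
    have c: "c > 0" using e by (simp add: c_def)
    then obtain N where N: "\<And>i j. i \<ge> N \<Longrightarrow> j \<ge> N \<Longrightarrow> norm (X i - X j) < c"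
      using X unfolding Cauchy_iff by metis
    show ?thesis
    proof (intro exI allI impI)
      fix i j assume "N \<le> i" "N \<le> j"
      then have "(norm (X i - X j))\<^sup>2 \<le> c\<^sup>2" using N[of i j] by (intro power_mono) auto
      then have "pi * (norm (X i - X j))\<^sup>2 / (4 * c) \<le> pi * c\<^sup>2 / (4 * c)"
        using c by (intro divide_right_mono mult_left_mono) auto
      also have "\<dots> = pi * c / 4" using c by (simp add: power2_eq_square)
      finally have "(LINT x|?M. norm (s i x - s j x)) \<le> pi * c / 4 + pi * c"
        using l1[OF c, of i j] by linarith
      also have "\<dots> < e" using e by (simp add: c_def)
      finally show "(LINT x|?M. norm (s i x - s j x)) < e" .
    qed
  qed
  obtain r where r: "strict_mono r" "AE x in ?M. Cauchy (\<lambda>i. s (r i) x)"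
    using cauchy_L1_AE_cauchy_subseq[of ?M s, OF square_integrable_imp_integrable[OF s(1)] cau] by blast
  define f where "f x = lim (\<lambda>i. s (r i) x)" for x
  have lim: "AE x in ?M. (\<lambda>i. s (r i) x) \<longlonglongrightarrow> f x"
    using r(2) by eventually_elim (auto simp: f_def Cauchy_convergent_iff convergent_LIMSEQ_iff)
  have fm[measurable]: "f \<in> borel_measurable ?M"
    unfolding f_def by measurable
  \<comment> \<open>Only the second index runs along the subsequence; with i arbitrary the bound
    yields convergence of the whole sequence.\<close>
  have fatou: "(\<integral>\<^sup>+x. ennreal ((norm (s i x - f x))\<^sup>2) \<partial>?M) \<le> ennreal (pi * e\<^sup>2)"
    if "\<And>j. j \<ge> N \<Longrightarrow> norm (X i - X j) \<le> e" for e i N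
  proof -
    have "(\<integral>\<^sup>+x. ennreal ((norm (s i x - f x))\<^sup>2) \<partial>?M)
        = (\<integral>\<^sup>+x. liminf (\<lambda>j. ennreal ((norm (s i x - s (r j) x))\<^sup>2)) \<partial>?M)"
    proof (rule nn_integral_cong_AE, use lim in eventually_elim)
      fix x assume "(\<lambda>j. s (r j) x) \<longlonglongrightarrow> f x"
      then have "(\<lambda>j. ennreal ((norm (s i x - s (r j) x))\<^sup>2)) \<longlonglongrightarrow> ennreal ((norm (s i x - f x))\<^sup>2)"
        by (intro tendsto_intros)
      then show "ennreal ((norm (s i x - f x))\<^sup>2) = liminf (\<lambda>j. ennreal ((norm (s i x - s (r j) x))\<^sup>2))"
        by (rule lim_imp_Liminf[OF trivial_limit_sequentially, symmetric])
    qed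
    also have "\<dots> \<le> liminf (\<lambda>j. \<integral>\<^sup>+x. ennreal ((norm (s i x - s (r j) x))\<^sup>2) \<partial>?M)"
      by (rule nn_integral_liminf) measurable
    also have "\<dots> \<le> ennreal (pi * e\<^sup>2)"
    proof (rule Liminf_le)
      have "(\<integral>\<^sup>+x. ennreal ((norm (s i x - s (r j) x))\<^sup>2) \<partial>?M) \<le> ennreal (pi * e\<^sup>2)" if "j \<ge> N" for j
      proof -
        have "(\<integral>\<^sup>+x. ennreal ((norm (s i x - s (r j) x))\<^sup>2) \<partial>?M) = ennreal (pi * (norm (X i - X (r j)))\<^sup>2)"
          using int2 by (subst nn_integral_eq_integral) (auto simp: d)
        also have "\<dots> \<le> ennreal (pi * e\<^sup>2)"
          using \<open>\<And>j. j \<ge> N \<Longrightarrow> norm (X i - X j) \<le> e\<close>[of "r j"] strict_mono_imp_increasing[OF r(1), of j] \<open>j \<ge> N\<close>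
          by (intro ennreal_leI mult_left_mono power_mono) auto
        finally show ?thesis .
      qed
      then show "\<forall>\<^sub>F j in sequentially. (\<integral>\<^sup>+x. ennreal ((norm (s i x - s (r j) x))\<^sup>2) \<partial>?M) \<le> ennreal (pi * e\<^sup>2)"
        by (intro eventually_sequentiallyI)
    qed simp
    finally show ?thesis .
  qed
  have Xd: "\<exists>N. \<forall>i\<ge>N. \<forall>j\<ge>N. norm (X i - X j) \<le> e" if "e > 0" for e
    using X that unfolding Cauchy_iff by (meson less_imp_le)
  have si_d: "square_integrable (\<lambda>x. s i x - f x)" if "\<And>j. j \<ge> N \<Longrightarrow> norm (X i - X j) \<le> e" for i N e
    unfolding square_integrable_def
  proof (intro conjI integrableI_bounded)
    show "(\<integral>\<^sup>+x. ennreal (norm ((norm (s i x - f x))\<^sup>2)) \<partial>?M) < \<infinity>"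
      using fatou[of N i e, OF that] by (auto intro: le_less_trans)
  qed measurable
  obtain N where "\<And>j. j \<ge> N \<Longrightarrow> norm (X N - X j) \<le> 1" using Xd[of 1] by auto
  from square_integrable_diff[OF s(1)[of N] si_d[OF this]] have sf: "square_integrable f" by simp
  have "X \<longlonglongrightarrow> abs_L2_space f"
    unfolding LIMSEQ_iff
  proof (intro allI impI)
    fix e :: real assume e: "e > 0"
    then obtain N where N: "\<And>i j. i \<ge> N \<Longrightarrow> j \<ge> N \<Longrightarrow> norm (X i - X j) \<le> e / 2"
      using Xd[of "e / 2"] by auto
    have "norm (X i - abs_L2_space f) < e" if "i \<ge> N" for i
    proof -
      have sd: "square_integrable (\<lambda>x. s i x - f x)" using s sf by (intro square_integrable_diff)
      have "ennreal (LINT x|?M. (norm (s i x - f x))\<^sup>2) \<le> ennreal (pi * (e / 2)\<^sup>2)"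
      proof -
        have "integrable ?M (\<lambda>x. (norm (s i x - f x))\<^sup>2)" using sd by (simp add: square_integrable_def)
        then show ?thesis
          using fatou[of N i "e / 2", OF N[OF that]] nn_integral_eq_integral[of ?M "\<lambda>x. (norm (s i x - f x))\<^sup>2"] by simp
      qed
      then have "(LINT x|?M. (norm (s i x - f x))\<^sup>2) \<le> pi * (e / 2)\<^sup>2" by (simp add: ennreal_le_iff)
      then have "(norm (X i - abs_L2_space f))\<^sup>2 \<le> (e / 2)\<^sup>2"
        using norm_abs_L2_space[OF sd] pi_gt_zero
        unfolding s(2) abs_L2_space_diff[OF s(1) sf] by (simp add: divide_le_eq mult.commute)
      then have "norm (X i - abs_L2_space f) \<le> e / 2" using e by (auto intro: power2_le_imp_le)
      then show ?thesis using e by simp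
    qed
    then show "\<exists>no. \<forall>n\<ge>no. norm (X n - abs_L2_space f) < e" by blast
  qed
  then show "convergent X" by (auto simp: convergent_def)
qed

section \<open>Square integrable and Sobolev functions\<close>

lemma integrable_lebesgue_on_iff:
  "integrable (lebesgue_on {a..b::real}) f \<longleftrightarrow> f absolutely_integrable_on {a..b}"
  by (simp add: set_integrable_def integrable_restrict_space)

lemma AE_lebesgue_on_iff:
  assumes "S \<in> sets lebesgue"
  shows "(AE x in lebesgue_on S. P x) \<longleftrightarrow> (\<exists>N. negligible N \<and> (\<forall>x\<in>S - N. P x))"
proof -
  have "(AE x in lebesgue_on S. P x) \<longleftrightarrow> (AE x in lebesgue. x \<in> S \<longrightarrow> P x)"
    using assms by (simp add: AE_restrict_space_iff)
  also have "\<dots> \<longleftrightarrow> (\<exists>N. negligible N \<and> {x. \<not> (x \<in> S \<longrightarrow> P x)} \<subseteq> N)"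
    by (rule eventually_ae_filter_negligible)
  also have "\<dots> \<longleftrightarrow> (\<exists>N. negligible N \<and> (\<forall>x\<in>S - N. P x))"
    by (rule ex_cong1) blast
  finally show ?thesis .
qed

lemma square_integrableD:
  fixes f :: "real \<Rightarrow> 'a::euclidean_space"
  assumes "square_integrable f"
  shows "f absolutely_integrable_on {0..pi}" "f integrable_on {0..pi}"
    "f \<in> borel_measurable (lebesgue_on {0..pi})"
    "(\<lambda>x. (norm (f x))\<^sup>2) absolutely_integrable_on {0..pi}"
    "(\<lambda>x. (norm (f x))\<^sup>2) integrable_on {0..pi}"
    "(\<lambda>x. norm (f x)) absolutely_integrable_on {0..pi}"
    "(\<lambda>x. norm (f x)) integrable_on {0..pi}"
proof -
  show 1: "f absolutely_integrable_on {0..pi}" "(\<lambda>x. (norm (f x))\<^sup>2) absolutely_integrable_on {0..pi}"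
    using assms square_integrable_imp_integrable[OF assms]
    by (auto simp: integrable_lebesgue_on_iff square_integrable_def)
  then show "f integrable_on {0..pi}" "(\<lambda>x. (norm (f x))\<^sup>2) integrable_on {0..pi}"
    by (auto simp: absolutely_integrable_on_def)
  show 2: "(\<lambda>x. norm (f x)) absolutely_integrable_on {0..pi}"
    by (rule absolutely_integrable_norm[unfolded comp_def, OF 1(1)])
  then show "(\<lambda>x. norm (f x)) integrable_on {0..pi}"
    by (auto simp: absolutely_integrable_on_def)
  show "f \<in> borel_measurable (lebesgue_on {0..pi})" using assms by (simp add: square_integrable_def)
qed

lemma square_integrable_bound:
  fixes f :: "real \<Rightarrow> 'a::euclidean_space" and g :: "real \<Rightarrow> 'b::euclidean_space"
  assumes "f \<in> borel_measurable (lebesgue_on {0..pi})" "square_integrable g"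
    "\<And>x. x \<in> {0..pi} \<Longrightarrow> norm (f x) \<le> norm (g x)"
  shows "square_integrable f"
  unfolding square_integrable_def integrable_lebesgue_on_iff
proof
  show "(\<lambda>x. (norm (f x))\<^sup>2) absolutely_integrable_on {0..pi}"
  proof (rule measurable_bounded_by_integrable_imp_absolutely_integrable)
    show "(\<lambda>x. (norm (f x))\<^sup>2) \<in> borel_measurable (lebesgue_on {0..pi})" using assms(1) by measurable
    show "(\<lambda>x. (norm (g x))\<^sup>2) integrable_on {0..pi}" by (rule square_integrableD(5)[OF assms(2)])
    show "norm ((norm (f x))\<^sup>2) \<le> (norm (g x))\<^sup>2" if "x \<in> {0..pi}" for x
      using assms(3)[OF that] by (simp add: power_mono)
  qed auto
qed (rule assms(1))

lemma square_integrable_const: "square_integrable (\<lambda>_. c::'a::euclidean_space)"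
  unfolding square_integrable_def integrable_lebesgue_on_iff
  by (auto intro!: absolutely_integrable_continuous_real)

lemma borel_measurable_continuous_lebesgue_on:
  "continuous_on {a..b::real} f \<Longrightarrow> f \<in> borel_measurable (lebesgue_on {a..b})"
  by (rule continuous_imp_measurable_on_sets_lebesgue) auto

lemma bounded_continuous_Icc:
  fixes g :: "real \<Rightarrow> 'a::real_normed_vector"
  assumes "continuous_on {a..b} g"
  obtains B where "B > 0" "\<And>x. x \<in> {a..b} \<Longrightarrow> norm (g x) \<le> B"
proof -
  have "bounded (g ` {a..b})" using assms by (intro compact_imp_bounded compact_continuous_image) auto
  then show ?thesis using that unfolding bounded_pos by blast
qed

lemma square_integrable_continuous:
  fixes g :: "real \<Rightarrow> 'a::euclidean_space"
  assumes "continuous_on {0..pi} g" shows "square_integrable g"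
proof -
  obtain B where "B > 0" "\<And>x. x \<in> {0..pi} \<Longrightarrow> norm (g x) \<le> B" 
    by (rule bounded_continuous_Icc[OF assms]) (erule that, blast)
  then show ?thesis
    using assms by (intro square_integrable_bound[OF _ square_integrable_const[of B]] borel_measurable_continuous_lebesgue_on) auto
qed

lemma square_integrable_mult_continuous:
  fixes f g :: "real \<Rightarrow> complex"
  assumes f: "square_integrable f" and g: "continuous_on {0..pi} g"
  shows "square_integrable (\<lambda>x. g x * f x)" "square_integrable (\<lambda>x. f x * g x)"
proof -
  obtain B where B: "B > 0" "\<And>x. x \<in> {0..pi} \<Longrightarrow> norm (g x) \<le> B" 
    by (rule bounded_continuous_Icc[OF g]) (erule that, blast)
  show "square_integrable (\<lambda>x. g x * f x)"
  proof (rule square_integrable_bound[OF _ square_integrable_scaleR[OF f, of B]])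
    show "(\<lambda>x. g x * f x) \<in> borel_measurable (lebesgue_on {0..pi})"
      by (intro borel_measurable_times borel_measurable_continuous_lebesgue_on g square_integrableD(3)[OF f])
    show "norm (g x * f x) \<le> norm (B *\<^sub>R f x)" if "x \<in> {0..pi}" for x
      using B(2)[OF that] B(1) by (simp add: norm_mult mult_right_mono)
  qed
  then show "square_integrable (\<lambda>x. f x * g x)" by (simp add: mult.commute)
qed

lemma square_integrable_spike:
  fixes f g :: "real \<Rightarrow> 'a::euclidean_space"
  assumes g: "square_integrable g" and N: "negligible N" "\<And>x. x \<in> {0..pi} - N \<Longrightarrow> f x = g x"
  shows "square_integrable f"
  unfolding square_integrable_def integrable_lebesgue_on_iff
proof
  have "f absolutely_integrable_on {0..pi}"
    by (rule absolutely_integrable_spike[OF square_integrableD(1)[OF g] N])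
  then show "f \<in> borel_measurable (lebesgue_on {0..pi})"
    by (rule absolutely_integrable_imp_borel_measurable) auto
  show "(\<lambda>x. (norm (f x))\<^sup>2) absolutely_integrable_on {0..pi}"
    by (rule absolutely_integrable_spike[OF square_integrableD(4)[OF g] N(1)]) (simp add: N(2))
qed

lemma square_integrable_Pair_iff:
  fixes f g :: "real \<Rightarrow> complex"
  shows "square_integrable (\<lambda>x. (f x, g x)) \<longleftrightarrow> square_integrable f \<and> square_integrable g"
proof
  assume fg: "square_integrable (\<lambda>x. (f x, g x))"
  have "(\<lambda>x. fst (f x, g x)) \<in> borel_measurable (lebesgue_on {0..pi})"
    "(\<lambda>x. snd (f x, g x)) \<in> borel_measurable (lebesgue_on {0..pi})"
    using square_integrableD(3)[OF fg]
    by (auto intro!: borel_measurable_continuous_on[of fst] borel_measurable_continuous_on[of snd] continuous_intros simp del: fst_conv snd_conv)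
  then show "square_integrable f \<and> square_integrable g"
    by (auto intro!: square_integrable_bound[OF _ fg] norm_fst_le norm_snd_le)
next
  assume fg: "square_integrable f \<and> square_integrable g"
  have "(\<lambda>x. (f x, g x)) \<in> borel_measurable (lebesgue_on {0..pi})"
    using fg square_integrableD(3) by (intro borel_measurable_Pair) auto
  moreover have "(\<lambda>x. (norm (f x))\<^sup>2 + (norm (g x))\<^sup>2) absolutely_integrable_on {0..pi}"
    using fg square_integrableD(4) by (intro set_integral_add) auto
  ultimately show "square_integrable (\<lambda>x. (f x, g x))"
    by (simp add: square_integrable_def integrable_lebesgue_on_iff norm_Pair)
qed

lemma integral_Cauchy_Schwarz:
  fixes f g :: "real \<Rightarrow> real"
  assumes f: "(\<lambda>x. (f x)\<^sup>2) integrable_on S" and g: "(\<lambda>x. (g x)\<^sup>2) integrable_on S"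
    and fg: "(\<lambda>x. f x * g x) integrable_on S"
  shows "(integral S (\<lambda>x. f x * g x))\<^sup>2 \<le> integral S (\<lambda>x. (f x)\<^sup>2) * integral S (\<lambda>x. (g x)\<^sup>2)"
proof -
  define A B C where "A = integral S (\<lambda>x. (f x)\<^sup>2)" and "B = integral S (\<lambda>x. (g x)\<^sup>2)"
    and "C = integral S (\<lambda>x. f x * g x)"
  have q: "0 \<le> A - 2 * t * C + t\<^sup>2 * B" for t
  proof -
    have "((\<lambda>x. (f x)\<^sup>2 - 2 * t * (f x * g x) + t\<^sup>2 * (g x)\<^sup>2) has_integral A - 2 * t * C + t\<^sup>2 * B) S"
      using f g fg unfolding A_def B_def C_def
      by (intro has_integral_add has_integral_diff has_integral_mult_right integrable_integral)
    moreover have "(f x)\<^sup>2 - 2 * t * (f x * g x) + t\<^sup>2 * (g x)\<^sup>2 = (f x - t * g x)\<^sup>2" for x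
      by (simp add: power2_eq_square algebra_simps)
    ultimately show ?thesis by (auto intro: has_integral_nonneg)
  qed
  have "0 \<le> A" using q[of 0] by simp
  have "0 \<le> B" unfolding B_def by (rule integral_nonneg[OF g]) simp
  show ?thesis
    unfolding A_def[symmetric] B_def[symmetric] C_def[symmetric]
  proof (cases "B = 0")
    case True
    have "C = 0"
    proof (rule ccontr)
      assume "C \<noteq> 0"
      \<comment> \<open>With B = 0 the polynomial is linear in t, and at this t it equals
        -1.\<close>
      then show False using q[of "(A + 1) / (2 * C)"] True by (simp add: field_simps)
    qed
    then show "C\<^sup>2 \<le> A * B" using True by simp
  next
    case False
    then have "B > 0" using \<open>0 \<le> B\<close> by simp
    then show "C\<^sup>2 \<le> A * B" using q[of "C / B"] by (simp add: field_simps power2_eq_square)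
  qed
qed

lemma L2_class_eq_iff:
  assumes "square_integrable f1" "square_integrable f2" "square_integrable g1" "square_integrable g2"
  shows "L2_class f1 f2 = L2_class g1 g2 \<longleftrightarrow>
    (\<exists>N. negligible N \<and> (\<forall>x\<in>{0..pi} - N. f1 x = g1 x \<and> f2 x = g2 x))"
proof -
  have "L2_class f1 f2 = L2_class g1 g2 \<longleftrightarrow> L2_equiv (\<lambda>x. (f1 x, f2 x)) (\<lambda>x. (g1 x, g2 x))"
    unfolding L2_class_def
    using assms Quotient_rel[OF Quotient_L2_space, of "\<lambda>x. (f1 x, f2 x)" "\<lambda>x. (g1 x, g2 x)"]
    by (simp add: L2_equiv_refl_iff square_integrable_Pair_iff)
  also have "\<dots> \<longleftrightarrow> (AE x in lebesgue_on {0..pi}. f1 x = g1 x \<and> f2 x = g2 x)"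
    using assms by (simp add: L2_equiv_def square_integrable_Pair_iff)
  finally show ?thesis by (subst (asm) AE_lebesgue_on_iff) auto
qed

lemma L2_class_exhaust:
  obtains f1 f2 where "square_integrable f1" "square_integrable f2" "F = L2_class f1 f2"
proof -
  obtain f where f: "square_integrable f" "F = abs_L2_space f" by (rule L2_space_eq_abs)
  have "f = (\<lambda>x. (fst (f x), snd (f x)))" by simp
  with f square_integrable_Pair_iff[of "\<lambda>x. fst (f x)" "\<lambda>x. snd (f x)"] show ?thesis
    by (intro that[of "\<lambda>x. fst (f x)" "\<lambda>x. snd (f x)"]) (auto simp: L2_class_def)
qed

context
  fixes f1 f2 g1 g2 :: "real \<Rightarrow> complex"
  assumes fg: "square_integrable f1" "square_integrable f2" "square_integrable g1" "square_integrable g2"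
begin

lemma L2_class_add: "L2_class f1 f2 + L2_class g1 g2 = L2_class (\<lambda>x. f1 x + g1 x) (\<lambda>x. f2 x + g2 x)"
  using fg by (simp add: L2_class_def plus_L2_space.abs_eq L2_equiv_refl_iff square_integrable_Pair_iff)

lemma L2_class_diff: "L2_class f1 f2 - L2_class g1 g2 = L2_class (\<lambda>x. f1 x - g1 x) (\<lambda>x. f2 x - g2 x)"
  using fg by (simp add: L2_class_def abs_L2_space_diff square_integrable_Pair_iff)

lemma scaleC_L2_class: "scaleC_L2 c (L2_class f1 f2) = L2_class (\<lambda>x. c * f1 x) (\<lambda>x. c * f2 x)"
  using fg by (simp add: L2_class_def scaleC_L2.abs_eq L2_equiv_refl_iff square_integrable_Pair_iff)

lemma norm_L2_class:
  "(norm (L2_class f1 f2))\<^sup>2 =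
     (1 / pi) * (integral {0..pi} (\<lambda>x. (cmod (f1 x))\<^sup>2) + integral {0..pi} (\<lambda>x. (cmod (f2 x))\<^sup>2))"
proof -
  have 1: "(\<lambda>x. (cmod (f1 x))\<^sup>2 + (cmod (f2 x))\<^sup>2) absolutely_integrable_on {0..pi}"
    using fg square_integrableD(4) by (intro set_integral_add) auto
  have "(norm (L2_class f1 f2))\<^sup>2 = (1 / pi) * (LINT x|lebesgue_on {0..pi}. (cmod (f1 x))\<^sup>2 + (cmod (f2 x))\<^sup>2)"
    using fg unfolding L2_class_def
    by (subst norm_abs_L2_space) (simp_all add: square_integrable_Pair_iff norm_Pair)
  also have "(LINT x|lebesgue_on {0..pi}. (cmod (f1 x))\<^sup>2 + (cmod (f2 x))\<^sup>2) =
      integral {0..pi} (\<lambda>x. (cmod (f1 x))\<^sup>2 + (cmod (f2 x))\<^sup>2)"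
    using 1 by (intro lebesgue_integral_eq_integral) (auto simp: integrable_lebesgue_on_iff)
  also have "\<dots> = integral {0..pi} (\<lambda>x. (cmod (f1 x))\<^sup>2) + integral {0..pi} (\<lambda>x. (cmod (f2 x))\<^sup>2)"
    using fg square_integrableD(5) by (intro integral_add) auto
  finally show ?thesis .
qed

end

text \<open>Each component contributes at most the integral of h^2; the factor 1 / pi in the norm
  absorbs the resulting 2.\<close>

lemma norm_L2_class_le:
  assumes f: "square_integrable f1" "square_integrable f2"
    and h: "(\<lambda>x. (h x)\<^sup>2) integrable_on {0..pi}"
    and le: "\<And>x. x \<in> {0..pi} \<Longrightarrow> cmod (f1 x) \<le> h x" "\<And>x. x \<in> {0..pi} \<Longrightarrow> cmod (f2 x) \<le> h x"
  shows "(norm (L2_class f1 f2))\<^sup>2 \<le> integral {0..pi} (\<lambda>x. (h x)\<^sup>2)"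
proof -
  have "integral {0..pi} (\<lambda>x. (cmod (f1 x))\<^sup>2) \<le> integral {0..pi} (\<lambda>x. (h x)\<^sup>2)"
    "integral {0..pi} (\<lambda>x. (cmod (f2 x))\<^sup>2) \<le> integral {0..pi} (\<lambda>x. (h x)\<^sup>2)"
    using f square_integrableD(5) h le by (auto intro!: integral_le power_mono)
  moreover have "integral {0..pi} (\<lambda>x. (h x)\<^sup>2) \<ge> 0" by (rule integral_nonneg[OF h]) simp
  moreover have "2 \<le> pi" using pi_gt3 by simp
  ultimately have "integral {0..pi} (\<lambda>x. (cmod (f1 x))\<^sup>2) + integral {0..pi} (\<lambda>x. (cmod (f2 x))\<^sup>2)
      \<le> pi * integral {0..pi} (\<lambda>x. (h x)\<^sup>2)"
    using mult_right_mono[of 2 pi "integral {0..pi} (\<lambda>x. (h x)\<^sup>2)"] by linarith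
  then show ?thesis
    unfolding norm_L2_class[OF f f] by (simp add: divide_le_eq mult.commute)
qed

lemma sobolev1_has_ac_primitive:
  assumes "sobolev1 f"
  shows "ac_primitive 0 pi (\<lambda>x. vector_derivative f (at x within {0..pi})) f"
    "square_integrable (\<lambda>x. vector_derivative f (at x within {0..pi}))"
proof -
  show si: "square_integrable (\<lambda>x. vector_derivative f (at x within {0..pi}))"
    using assms by (simp add: sobolev1_def)
  from assms obtain N where N: "negligible N" "\<forall>x\<in>{0..pi} - N. f differentiable (at x within {0..pi})"
    unfolding sobolev1_def by (auto simp: AE_lebesgue_on_iff)
  show "ac_primitive 0 pi (\<lambda>x. vector_derivative f (at x within {0..pi})) f"
    by (rule ac_primitiveI[OF _ square_integrableD(1)[OF si] N(1)])
      (use assms N(2) in \<open>auto simp: sobolev1_def vector_derivative_works[symmetric]\<close>)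
qed

lemma ac_primitive_vector_derivative:
  assumes "ac_primitive 0 pi g f"
  obtains N where "negligible N" "\<And>x. x \<in> {0..pi} - N \<Longrightarrow> f differentiable (at x within {0..pi})"
    "\<And>x. x \<in> {0..pi} - N \<Longrightarrow> vector_derivative f (at x within {0..pi}) = g x"
proof -
  obtain N where N: "negligible N"
    "\<And>x. x \<in> {0..pi} - N \<Longrightarrow> (f has_vector_derivative g x) (at x within {0..pi})"
    by (rule ac_primitive_has_vector_derivative_ae[OF assms]) (erule that, blast)
  show ?thesis
  proof (rule that[OF N(1)])
    fix x assume x: "x \<in> {0..pi} - N"
    show "f differentiable (at x within {0..pi})"
      using N(2)[OF x] by (auto simp: has_vector_derivative_def differentiable_def)
    show "vector_derivative f (at x within {0..pi}) = g x"
      by (rule vector_derivative_within_closed_interval[OF _ _ N(2)[OF x]]) (use x in auto)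
  qed
qed

lemma sobolev1I:
  assumes "ac_primitive 0 pi g f" "square_integrable g"
  shows "sobolev1 f"
proof -
  obtain N where N: "negligible N" "\<And>x. x \<in> {0..pi} - N \<Longrightarrow> f differentiable (at x within {0..pi})"
    "\<And>x. x \<in> {0..pi} - N \<Longrightarrow> vector_derivative f (at x within {0..pi}) = g x"
    by (rule ac_primitive_vector_derivative[OF assms(1)]) (erule that, blast, blast)
  show ?thesis
    unfolding sobolev1_def
  proof (intro conjI)
    show "AE x in lebesgue_on {0..pi}. f differentiable at x within {0..pi}"
      using N by (subst AE_lebesgue_on_iff) auto
    show "square_integrable (\<lambda>x. vector_derivative f (at x within {0..pi}))"
      by (rule square_integrable_spike[OF assms(2) N(1,3)])
  qed (rule ac_primitive_imp_absolutely_cont_on[OF assms(1)])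
qed

lemma sobolev1_continuous_on: "sobolev1 f \<Longrightarrow> continuous_on {0..pi} f"
  by (rule ac_primitive_imp_continuous_on[OF sobolev1_has_ac_primitive(1)])

lemma sobolev1_square_integrable: "sobolev1 f \<Longrightarrow> square_integrable f"
  by (intro square_integrable_continuous sobolev1_continuous_on)

lemma continuous_on_ae_eq_imp_eq:
  fixes f g :: "real \<Rightarrow> 'a::real_normed_vector"
  assumes "continuous_on {a..b} f" "continuous_on {a..b} g" "a < b" "negligible N"
    "\<And>x. x \<in> {a..b} - N \<Longrightarrow> f x = g x" "x \<in> {a..b}"
  shows "f x = g x"
proof -
  have "((\<lambda>x. norm (f x - g x)) has_integral 0) {a..b}"
    by (rule has_integral_spike[OF assms(4) _ has_integral_0]) (simp add: assms(5))
  then have "norm (f x - g x) = 0"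
    using assms by (intro has_integral_0_cbox_imp_0[of a b "\<lambda>x. norm (f x - g x)" x]) (auto intro!: continuous_intros)
  then show ?thesis by simp
qed

text \<open>Removes the choice in \<open>dirac_op\<close>: the chosen Sobolev representatives and
  the given ones are continuous and agree almost everywhere, so they agree on all of [0, pi], and
  with them their derivatives within that interval.\<close>

lemma dirac_op_L2_class:
  assumes y: "sobolev1 y1" "sobolev1 y2" and PQ: "square_integrable P" "square_integrable Q"
  shows "dirac_op P Q (L2_class y1 y2) = L2_class
           (\<lambda>x. \<i> * vector_derivative y1 (at x within {0..pi}) + P x * y2 x)
           (\<lambda>x. - \<i> * vector_derivative y2 (at x within {0..pi}) + Q x * y1 x)"
proof -
  let ?R = "\<lambda>(z1, z2). sobolev1 z1 \<and> sobolev1 z2 \<and> L2_class z1 z2 = L2_class y1 y2"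
  obtain z1 z2 where z: "(SOME z. ?R z) = (z1, z2)" by fastforce
  have "?R (SOME z. ?R z)" by (rule someI[of ?R "(y1, y2)"]) (use y in simp)
  then have z': "sobolev1 z1" "sobolev1 z2" "L2_class z1 z2 = L2_class y1 y2" unfolding z by auto
  then obtain N where N: "negligible N" "\<And>x. x \<in> {0..pi} - N \<Longrightarrow> z1 x = y1 x \<and> z2 x = y2 x"
    using y by (subst (asm) L2_class_eq_iff) (auto intro: sobolev1_square_integrable)
  have eq: "z1 x = y1 x" "z2 x = y2 x" if "x \<in> {0..pi}" for x
    using continuous_on_ae_eq_imp_eq[OF _ _ pi_gt_zero N(1) _ that] N(2) y z' sobolev1_continuous_on by metis+
  have vd: "vector_derivative z1 (at x within {0..pi}) = vector_derivative y1 (at x within {0..pi})"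
    "vector_derivative z2 (at x within {0..pi}) = vector_derivative y2 (at x within {0..pi})" if "x \<in> {0..pi}" for x
    using eq that
    by (auto intro!: vector_derivative_cong_eq simp: eventually_at_filter)
  have si1: "square_integrable (\<lambda>x. \<i> * vector_derivative w1 (at x within {0..pi}) + P x * w2 x)"
    and si2: "square_integrable (\<lambda>x. - \<i> * vector_derivative w1 (at x within {0..pi}) + Q x * w2 x)"
    if "sobolev1 w1" "sobolev1 w2" for w1 w2
    by (intro square_integrable_add square_integrable_mult_continuous sobolev1_has_ac_primitive(2)
        sobolev1_continuous_on continuous_intros that PQ)+
  have "dirac_op P Q (L2_class y1 y2) = L2_class
           (\<lambda>x. \<i> * vector_derivative z1 (at x within {0..pi}) + P x * z2 x)
           (\<lambda>x. - \<i> * vector_derivative z2 (at x within {0..pi}) + Q x * z1 x)"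
    unfolding dirac_op_def z by simp
  also have "\<dots> = L2_class
           (\<lambda>x. \<i> * vector_derivative y1 (at x within {0..pi}) + P x * y2 x)
           (\<lambda>x. - \<i> * vector_derivative y2 (at x within {0..pi}) + Q x * y1 x)"
    by (subst L2_class_eq_iff)
      (intro si1 si2 y z' exI[of _ "{}"] conjI ballI | simp add: vd eq)+
  finally show ?thesis .
qed

section \<open>The resolvent equation as an integral equation\<close>

lemma ac_primitive_exp:
  fixes c :: complex
  shows "ac_primitive a b (\<lambda>x. c * exp (c * of_real x)) (\<lambda>x. exp (c * of_real x))"
proof (rule ac_primitive_C1)
  show "((\<lambda>x. exp (c * of_real x)) has_vector_derivative c * exp (c * of_real x)) (at x within {a..b})" for x
    by (rule has_vector_derivative_real_field[where f = "\<lambda>z. exp (c * z)"])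
      (auto intro!: derivative_eq_intros)
qed (intro continuous_intros)

lemma abs_int_cmult:
  fixes f :: "real \<Rightarrow> 'a::{euclidean_space,real_normed_field}"
  assumes "f absolutely_integrable_on {a..b}"
  shows "(\<lambda>x. c * f x) absolutely_integrable_on {a..b}"
  by (intro abs_int_mult_continuous(2) assms continuous_intros)

lemma abs_int_exp_mult:
  fixes c :: complex
  assumes "f absolutely_integrable_on {a..b}"
  shows "(\<lambda>x. exp (c * of_real x) * f x) absolutely_integrable_on {a..b}"
  by (intro abs_int_mult_continuous(2) assms continuous_intros)

lemma ac_primitive_integral:
  assumes "f absolutely_integrable_on {a..b}"
  shows "ac_primitive a b f (\<lambda>x. c + integral {a..x} f)"
  using assms by (auto simp: ac_primitive_def)

lemma abs_int_initial_segment: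
  fixes f :: "real \<Rightarrow> 'a::euclidean_space"
  assumes "f absolutely_integrable_on {a..b}" "x \<in> {a..b}"
  shows "f integrable_on {a..x}"
  using assms by (auto simp: absolutely_integrable_on_def intro: integrable_on_subinterval)

text \<open>Variation of constants: the product rule with the integrating factor exp (- c x) removes
  the term c y, and multiplying by exp (c x) restores it.\<close>

lemma ac_primitive_linear_ode_iff:
  fixes h y :: "real \<Rightarrow> complex"
  assumes h: "h absolutely_integrable_on {0..b}" and b: "0 \<le> b"
  shows "ac_primitive 0 b (\<lambda>x. c * y x + h x) y \<longleftrightarrow>
    (\<forall>x\<in>{0..b}. y x = exp (c * of_real x) * (y 0 + integral {0..x} (\<lambda>t. exp (- c * of_real t) * h t)))"
    (is "?L \<longleftrightarrow> ?R")
proof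
  assume L: ?L
  have "ac_primitive 0 b (\<lambda>x. - c * exp (- c * of_real x) * y x + exp (- c * of_real x) * (c * y x + h x))
      (\<lambda>x. exp (- c * of_real x) * y x)"
    by (rule ac_primitive_mult[OF ac_primitive_exp L])
  then have "exp (- c * of_real x) * y x = y 0 + integral {0..x} (\<lambda>t. exp (- c * of_real t) * h t)" if "x \<in> {0..b}" for x
    using ac_primitiveD(3)[OF _ that] by (fastforce simp: algebra_simps)
  note 1 = this
  show ?R
  proof
    fix x assume x: "x \<in> {0..b}"
    have "y x = exp (c * of_real x) * exp (- c * of_real x) * y x"
      by (simp add: exp_add[symmetric])
    then show "y x = exp (c * of_real x) * (y 0 + integral {0..x} (\<lambda>t. exp (- c * of_real t) * h t))"
      unfolding 1[OF x, symmetric] by (simp only: mult.assoc)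
  qed
next
  assume R: ?R
  define u where "u x = y 0 + integral {0..x} (\<lambda>t. exp (- c * of_real t) * h t)" for x
  have y: "y x = exp (c * of_real x) * u x" if "x \<in> {0..b}" for x using R that unfolding u_def by blast
  have "ac_primitive 0 b (\<lambda>x. exp (- c * of_real x) * h x) u"
    unfolding u_def by (rule ac_primitive_integral[OF abs_int_exp_mult[OF h]])
  from ac_primitive_mult[OF ac_primitive_exp this, of c]
  have "ac_primitive 0 b (\<lambda>x. c * exp (c * of_real x) * u x + exp (c * of_real x) * (exp (- c * of_real x) * h x)) y"
    by (rule ac_primitive_cong) (use y b in auto)
  then show ?L
  proof (rule ac_primitive_spike[where N="{}"])
    fix x assume x: "x \<in> {0..b} - {}"
    have "exp (c * of_real x) * (exp (- c * of_real x) * h x) = h x"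
      by (simp add: exp_add[symmetric] mult.assoc[symmetric])
    then show "c * y x + h x = c * exp (c * of_real x) * u x + exp (c * of_real x) * (exp (- c * of_real x) * h x)"
      using y x by (simp only: mult.assoc) simp
  qed simp
qed

text \<open>Integration by parts against a primitive that may be much smaller than its derivative.\<close>

lemma norm_integral_oscillatory_le:
  fixes h q r :: "real \<Rightarrow> complex" and \<rho> :: "real \<Rightarrow> real"
  assumes h: "h absolutely_integrable_on {0..b}" and q: "ac_primitive 0 b r q"
    and A: "\<And>t. t \<in> {0..b} \<Longrightarrow> cmod (q t) \<le> A"
    and \<rho>: "\<And>t. t \<in> {0..b} \<Longrightarrow> cmod (r t) \<le> \<rho> t" "\<rho> absolutely_integrable_on {0..b}"
    and x: "x \<in> {0..b}"
  shows "cmod (integral {0..x} (\<lambda>t. h t * q t))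
    \<le> cmod (integral {0..x} h) * A + integral {0..b} (\<lambda>t. cmod (integral {0..t} h) * \<rho> t)"
proof -
  let ?H = "\<lambda>x. integral {0..x} h"
  have H: "ac_primitive 0 b h ?H"
    using ac_primitive_integral[OF h, of 0] by simp
  note cH = ac_primitive_imp_continuous_on[OF H]
  note cq = ac_primitive_imp_continuous_on[OF q]
  have i1: "(\<lambda>t. h t * q t) absolutely_integrable_on {0..b}"
    by (intro abs_int_mult_continuous h cq)
  have i2: "(\<lambda>t. ?H t * r t) absolutely_integrable_on {0..b}"
    by (intro abs_int_mult_continuous ac_primitiveD(1)[OF q] cH)
  have i3: "(\<lambda>t. cmod (?H t) * \<rho> t) absolutely_integrable_on {0..b}"
    by (intro abs_int_mult_continuous \<rho> continuous_intros cH)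
  note sub = abs_int_initial_segment[OF _ x]
  have "?H x * q x = integral {0..x} (\<lambda>t. h t * q t + ?H t * r t)"
    using ac_primitiveD(3)[OF ac_primitive_mult[OF H q] x] by simp
  also have "\<dots> = integral {0..x} (\<lambda>t. h t * q t) + integral {0..x} (\<lambda>t. ?H t * r t)"
    using sub i1 i2 by (intro integral_add)
  finally have eq: "integral {0..x} (\<lambda>t. h t * q t) = ?H x * q x - integral {0..x} (\<lambda>t. ?H t * r t)"
    by simp
  have "cmod (integral {0..x} (\<lambda>t. ?H t * r t)) \<le> integral {0..x} (\<lambda>t. cmod (?H t) * \<rho> t)"
    by (rule integral_norm_bound_integral) (use sub i2 i3 x \<rho>(1) in \<open>auto simp: norm_mult mult_left_mono\<close>)
  also have "\<dots> \<le> integral {0..b} (\<lambda>t. cmod (?H t) * \<rho> t)"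
  proof (rule integral_subset_le)
    show "(\<lambda>t. cmod (?H t) * \<rho> t) integrable_on {0..b}" using i3 by (simp add: absolutely_integrable_on_def)
    show "\<forall>t\<in>{0..b}. 0 \<le> cmod (?H t) * \<rho> t"
      by (intro ballI mult_nonneg_nonneg norm_ge_zero order_trans[OF norm_ge_zero \<rho>(1)])
  qed (use x sub i3 in auto)
  finally show ?thesis
    unfolding eq using A[OF x]
    by (intro order_trans[OF norm_triangle_ineq4]) (auto simp: norm_mult mult_left_mono intro!: add_mono)
qed

lemma abs_int_fst_snd:
  fixes g :: "real \<Rightarrow> complex \<times> complex"
  assumes "g absolutely_integrable_on S"
  shows "(\<lambda>x. fst (g x)) absolutely_integrable_on S" "(\<lambda>x. snd (g x)) absolutely_integrable_on S"
  using absolutely_integrable_linear[OF assms bounded_linear_fst] absolutely_integrable_linear[OF assms bounded_linear_snd]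
  by (simp_all add: comp_def)

lemma abs_int_Pair:
  fixes f g :: "real \<Rightarrow> complex"
  assumes "f absolutely_integrable_on S" "g absolutely_integrable_on S"
  shows "(\<lambda>x. (f x, g x)) absolutely_integrable_on S"
proof -
  have bl: "bounded_linear (\<lambda>a::complex. (a, 0::complex))" "bounded_linear (\<lambda>a::complex. (0::complex, a))"
    by (auto intro!: bounded_linear_Pair bounded_linear_ident bounded_linear_zero)
  have "(\<lambda>x. (f x, 0) + (0, g x)) absolutely_integrable_on S"
    using absolutely_integrable_linear[OF assms(1) bl(1)] absolutely_integrable_linear[OF assms(2) bl(2)]
    by (intro set_integral_add) (auto simp: comp_def)
  then show ?thesis by simp
qed

lemma norm_exp_imaginary_le:
  assumes "\<bar>Im l\<bar> \<le> 1/2" "x \<in> {0..pi}"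
  shows "cmod (exp (\<i> * l * of_real x)) \<le> exp (pi / 2)" "cmod (exp (- (\<i> * l) * of_real x)) \<le> exp (pi / 2)"
proof -
  have "\<bar>Im l * x\<bar> \<le> 1/2 * pi" using assms unfolding abs_mult by (intro mult_mono) auto
  then show "cmod (exp (\<i> * l * of_real x)) \<le> exp (pi / 2)" "cmod (exp (- (\<i> * l) * of_real x)) \<le> exp (pi / 2)"
    by (auto simp: norm_exp_eq_Re)
qed

section \<open>The free resolvent at a point near an integer\<close>

abbreviation abs_int :: "(real \<Rightarrow> 'a::euclidean_space) \<Rightarrow> bool" where
  "abs_int f \<equiv> f absolutely_integrable_on {0..pi}"

text \<open>
  The coefficients \<open>m\<^sub>i\<^sub>j\<close> solve the boundary conditions: they express \<open>y(0)\<close> through the integrals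
  \<open>\<phi>\<^sub>1, \<phi>\<^sub>2\<close> of the inhomogeneity over the whole interval.
\<close>

locale dirac_bvp =
  fixes b :: bc and l :: complex and n :: int and m11 m12 m21 m22 :: complex and M :: real
    and P Q :: "real \<Rightarrow> complex"
  assumes l: "cmod (l - of_int n) \<le> 1/2"
    and M: "cmod m11 \<le> M" "cmod m12 \<le> M" "cmod m21 \<le> M" "cmod m22 \<le> M"
    and bc_iff: "\<And>y1 y2 \<phi>1 \<phi>2. y1 pi = exp (- (\<i> * l) * of_real pi) * (y1 0 + \<phi>1) \<Longrightarrow>
        y2 pi = exp (\<i> * l * of_real pi) * (y2 0 + \<phi>2) \<Longrightarrow>
        satisfies_bc b y1 y2 \<longleftrightarrow> y1 0 = m11 * \<phi>1 + m12 * \<phi>2 \<and> y2 0 = m21 * \<phi>1 + m22 * \<phi>2"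
    and P: "square_integrable P" and Q: "square_integrable Q"
begin

text \<open>For the free operator, (l - L) y = g reads y1' = - i l y1 + i g1 and y2' = i l y2 - i
  g2; the integrating factors exp (i l t) and exp (- i l t) turn the inhomogeneities into these two
  integrals.\<close>

definition \<Phi>1 :: "(real \<Rightarrow> complex \<times> complex) \<Rightarrow> real \<Rightarrow> complex" where
  "\<Phi>1 g x = integral {0..x} (\<lambda>t. exp (\<i> * l * of_real t) * (\<i> * fst (g t)))"

definition \<Phi>2 :: "(real \<Rightarrow> complex \<times> complex) \<Rightarrow> real \<Rightarrow> complex" where
  "\<Phi>2 g x = integral {0..x} (\<lambda>t. exp (- (\<i> * l) * of_real t) * (- \<i> * snd (g t)))"

text \<open>The amplitude left when the exponential is split off from the solution; the terms with
  \<open>m11\<close> and \<open>m12\<close> are its value at 0. Its derivative carries no factor l,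
  which keeps the later integration by parts uniform in n.\<close>

definition u1 :: "(real \<Rightarrow> complex \<times> complex) \<Rightarrow> real \<Rightarrow> complex" where
  "u1 g x = m11 * \<Phi>1 g pi + m12 * \<Phi>2 g pi + \<Phi>1 g x"

definition u2 :: "(real \<Rightarrow> complex \<times> complex) \<Rightarrow> real \<Rightarrow> complex" where
  "u2 g x = m21 * \<Phi>1 g pi + m22 * \<Phi>2 g pi + \<Phi>2 g x"

definition S :: "(real \<Rightarrow> complex \<times> complex) \<Rightarrow> real \<Rightarrow> complex \<times> complex" where
  "S g x = (exp (- (\<i> * l) * of_real x) * u1 g x, exp (\<i> * l * of_real x) * u2 g x)"

definition V :: "(real \<Rightarrow> complex \<times> complex) \<Rightarrow> real \<Rightarrow> complex \<times> complex" where
  "V y x = (P x * snd (y x), Q x * fst (y x))"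

definition E :: real where "E = exp (pi / 2)"

text \<open>Equal to 2 E^2 A0^2 (\<open>K_eq\<close>), the constant that arises in the bound for
  \<open>S V S\<close>. It dominates 2 E A0, the constant for \<open>S\<close> itself, and so serves
  both.\<close>

definition K :: real where "K = 2 * (2 * M + 1)\<^sup>2 * E ^ 4"

definition HP :: "real \<Rightarrow> complex" where
  "HP x = integral {0..x} (\<lambda>t. exp (2 * \<i> * of_int n * of_real t) * P t)"

definition HQ :: "real \<Rightarrow> complex" where
  "HQ x = integral {0..x} (\<lambda>t. exp (- (2 * \<i> * of_int n) * of_real t) * Q t)"

definition B :: "real \<Rightarrow> real" where "B x = cmod (HP x) + cmod (HQ x)"

definition v :: "real \<Rightarrow> real" where "v x = cmod (P x) + cmod (Q x)"

lemma M0: "0 \<le> M" using M(1) norm_ge_zero[of m11] by linarith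

lemma E1: "1 \<le> E" by (simp add: E_def)

lemma Im_l: "\<bar>Im l\<bar> \<le> 1/2"
  using abs_Im_le_cmod[of "l - of_int n"] l by simp

lemma exp_le: "x \<in> {0..pi} \<Longrightarrow> cmod (exp (\<i> * l * of_real x)) \<le> E"
  "x \<in> {0..pi} \<Longrightarrow> cmod (exp (- (\<i> * l) * of_real x)) \<le> E"
  using norm_exp_imaginary_le[OF Im_l] by (auto simp: E_def)

lemma S_solves:
  assumes g: "abs_int g"
  shows "ac_primitive 0 pi (\<lambda>x. - (\<i> * l) * fst (S g x) + \<i> * fst (g x)) (\<lambda>x. fst (S g x))"
    "ac_primitive 0 pi (\<lambda>x. \<i> * l * snd (S g x) + - \<i> * snd (g x)) (\<lambda>x. snd (S g x))"
    "satisfies_bc b (\<lambda>x. fst (S g x)) (\<lambda>x. snd (S g x))"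
proof -
  have 0: "fst (S g 0) = m11 * \<Phi>1 g pi + m12 * \<Phi>2 g pi" "snd (S g 0) = m21 * \<Phi>1 g pi + m22 * \<Phi>2 g pi"
    by (simp_all add: S_def u1_def u2_def \<Phi>1_def \<Phi>2_def)
  show "ac_primitive 0 pi (\<lambda>x. - (\<i> * l) * fst (S g x) + \<i> * fst (g x)) (\<lambda>x. fst (S g x))"
  proof (rule ac_primitive_linear_ode_iff[THEN iffD2])
    show "\<forall>x\<in>{0..pi}. fst (S g x) = exp (- (\<i> * l) * of_real x) *
        (fst (S g 0) + integral {0..x} (\<lambda>t. exp (- (- (\<i> * l)) * of_real t) * (\<i> * fst (g t))))"
      by (intro ballI, subst 0) (simp add: S_def u1_def \<Phi>1_def)
  qed (auto intro!: abs_int_cmult abs_int_fst_snd g)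
  show "ac_primitive 0 pi (\<lambda>x. \<i> * l * snd (S g x) + - \<i> * snd (g x)) (\<lambda>x. snd (S g x))"
  proof (rule ac_primitive_linear_ode_iff[THEN iffD2])
    show "\<forall>x\<in>{0..pi}. snd (S g x) = exp (\<i> * l * of_real x) *
        (snd (S g 0) + integral {0..x} (\<lambda>t. exp (- (\<i> * l) * of_real t) * (- \<i> * snd (g t))))"
      by (intro ballI, subst 0) (simp add: S_def u2_def \<Phi>2_def)
    show "abs_int (\<lambda>x. - \<i> * snd (g x))"
      by (intro abs_int_cmult abs_int_fst_snd g)
  qed auto
  show "satisfies_bc b (\<lambda>x. fst (S g x)) (\<lambda>x. snd (S g x))"
    by (subst bc_iff[where ?\<phi>1.0 = "\<Phi>1 g pi" and ?\<phi>2.0 = "\<Phi>2 g pi"]) (simp_all only: 0, simp_all add: S_def u1_def u2_def)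
qed

lemma S_unique:
  assumes g: "abs_int g"
    and y: "ac_primitive 0 pi (\<lambda>x. - (\<i> * l) * y1 x + \<i> * fst (g x)) y1"
    "ac_primitive 0 pi (\<lambda>x. \<i> * l * y2 x + - \<i> * snd (g x)) y2"
    "satisfies_bc b y1 y2" and x: "x \<in> {0..pi}"
  shows "(y1 x, y2 x) = S g x"
proof -
  have 1: "y1 x = exp (- (\<i> * l) * of_real x) * (y1 0 + \<Phi>1 g x)" if "x \<in> {0..pi}" for x
    using ac_primitive_linear_ode_iff[THEN iffD1, OF _ _ y(1), rule_format, OF _ _ that] unfolding \<Phi>1_def
    by (simp add: abs_int_cmult abs_int_fst_snd g)
  have 2: "y2 x = exp (\<i> * l * of_real x) * (y2 0 + \<Phi>2 g x)" if "x \<in> {0..pi}" for x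
    unfolding \<Phi>2_def
    by (rule ac_primitive_linear_ode_iff[THEN iffD1, OF _ _ y(2), rule_format])
      (intro abs_int_cmult abs_int_fst_snd g pi_ge_zero that)+
  have "y1 0 = m11 * \<Phi>1 g pi + m12 * \<Phi>2 g pi \<and> y2 0 = m21 * \<Phi>1 g pi + m22 * \<Phi>2 g pi"
    using bc_iff[of y1 "\<Phi>1 g pi" y2 "\<Phi>2 g pi", OF 1 2] y(3) by auto
  then show ?thesis using 1[OF x] 2[OF x] by (simp add: S_def u1_def u2_def)
qed

lemma S_continuous_on:
  assumes "abs_int g" shows "continuous_on {0..pi} (S g)"
proof -
  have "continuous_on {0..pi} (\<lambda>x. (fst (S g x), snd (S g x)))"
    by (intro continuous_on_Pair ac_primitive_imp_continuous_on[OF S_solves(1)[OF assms]]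
        ac_primitive_imp_continuous_on[OF S_solves(2)[OF assms]])
  then show ?thesis by simp
qed

lemma S_cong:
  assumes "\<And>x. x \<in> {0..pi} \<Longrightarrow> g x = h x" "x \<in> {0..pi}"
  shows "S g x = S h x"
proof -
  have "\<Phi>1 g y = \<Phi>1 h y" "\<Phi>2 g y = \<Phi>2 h y" if "y \<in> {0..pi}" for y
    unfolding \<Phi>1_def \<Phi>2_def using assms(1) that by (auto intro!: integral_cong)
  then show ?thesis using assms(2) by (simp add: S_def u1_def u2_def)
qed

lemma S_diff:
  assumes g: "abs_int g" and h: "abs_int h" and x: "x \<in> {0..pi}"
  shows "S (\<lambda>x. g x - h x) x = S g x - S h x"
proof -
  have i: "(\<lambda>t. exp (\<i> * l * of_real t) * (\<i> * fst (g t))) integrable_on {0..y}"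
    "(\<lambda>t. exp (- (\<i> * l) * of_real t) * (- \<i> * snd (g t))) integrable_on {0..y}"
    if "y \<in> {0..pi}" "abs_int g" for y g
    by (intro abs_int_initial_segment[OF _ that(1)] abs_int_exp_mult
        abs_int_cmult abs_int_fst_snd that(2))+
  have "\<Phi>1 (\<lambda>x. g x - h x) y = \<Phi>1 g y - \<Phi>1 h y" "\<Phi>2 (\<lambda>x. g x - h x) y = \<Phi>2 g y - \<Phi>2 h y" if "y \<in> {0..pi}" for y
    unfolding \<Phi>1_def \<Phi>2_def
    using integral_diff[OF i(1)[OF that g] i(1)[OF that h]] integral_diff[OF i(2)[OF that g] i(2)[OF that h]]
    by (auto simp: algebra_simps)
  note eq = this[OF x] this[of pi, simplified]
  show ?thesis unfolding S_def u1_def u2_def eq by (simp add: algebra_simps)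
qed

lemma V_abs_int:
  assumes "continuous_on {0..pi} y" shows "abs_int (V y)"
  unfolding V_def[abs_def]
  by (intro abs_int_Pair abs_int_mult_continuous square_integrableD P Q
      continuous_intros assms)

lemma norm_V_le: "norm (V y x) \<le> v x * norm (y x)"
proof -
  have "norm (V y x) \<le> cmod (P x) * cmod (snd (y x)) + cmod (Q x) * cmod (fst (y x))"
    unfolding V_def by (rule order_trans[OF norm_Pair_le]) (simp add: norm_mult)
  also have "\<dots> \<le> cmod (P x) * norm (y x) + cmod (Q x) * norm (y x)"
    by (intro add_mono mult_left_mono) (auto intro: norm_fst_le norm_snd_le simp: norm_fst_le[of "fst (y x)" "snd (y x)", simplified] norm_snd_le[of "snd (y x)" "fst (y x)", simplified])
  finally show ?thesis by (simp add: v_def algebra_simps)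
qed

end

lemma integral_initial_segment_le:
  fixes f :: "real \<Rightarrow> complex" and \<rho> :: "real \<Rightarrow> real"
  assumes f: "f absolutely_integrable_on {a..b}" and \<rho>: "\<rho> absolutely_integrable_on {a..b}"
    and le: "\<And>t. t \<in> {a..b} \<Longrightarrow> cmod (f t) \<le> \<rho> t" and x: "x \<in> {a..b}"
  shows "cmod (integral {a..x} f) \<le> integral {a..b} \<rho>"
proof -
  have "cmod (integral {a..x} f) \<le> integral {a..x} \<rho>"
    by (rule integral_norm_bound_integral)
      (use x le abs_int_initial_segment[OF _ x] f \<rho> in auto)
  also have "\<dots> \<le> integral {a..b} \<rho>"
    by (rule integral_subset_le[OF _ abs_int_initial_segment[OF \<rho> x]])
      (use x \<rho> order_trans[OF norm_ge_zero le] in \<open>auto simp: absolutely_integrable_on_def\<close>)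
  finally show ?thesis .
qed

lemma phase_split:
  fixes i l n t :: complex
  shows "i * l * t + i * l * t = 2 * i * n * t + 2 * i * (l - n) * t"
    "- (i * l) * t + - (i * l) * t = - (2 * i * n) * t + - (2 * i * (l - n)) * t"
  by (simp_all add: algebra_simps)

lemmas abs_int_imp_int = absolutely_integrable_on_def[THEN iffD1, THEN conjunct1]

lemma abs_int_norm:
  fixes g :: "real \<Rightarrow> 'z::euclidean_space"
  shows "abs_int g \<Longrightarrow> abs_int (\<lambda>t. norm (g t))"
  by (rule absolutely_integrable_norm[unfolded comp_def])

lemma norm_fst_snd_le: "cmod (fst z) \<le> norm z" "cmod (snd z) \<le> norm z" for z :: "complex \<times> complex"
  by (metis norm_fst_le norm_snd_le prod.collapse)+

section \<open>Supremum bounds for \<open>S\<close> and the oscillatory gain in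
  \<open>S V S\<close>\<close>

context dirac_bvp
begin

text \<open>The L1 norm: \<open>S\<close> is estimated from L1 into the supremum norm, so
  \<open>V\<close> applied to a continuous function is an admissible argument.\<close>

definition N :: "(real \<Rightarrow> complex \<times> complex) \<Rightarrow> real" where
  "N g = integral {0..pi} (\<lambda>t. norm (g t))"

lemma N_nonneg: "abs_int g \<Longrightarrow> 0 \<le> N g"
  unfolding N_def using abs_int_norm by (intro integral_nonneg) (auto simp: absolutely_integrable_on_def)

lemma norm_Phi_le:
  assumes g: "abs_int g" and x: "x \<in> {0..pi}"
  shows "cmod (\<Phi>1 g x) \<le> E * N g" "cmod (\<Phi>2 g x) \<le> E * N g"
proof -
  have r: "abs_int (\<lambda>t. E * norm (g t))"
    by (intro abs_int_cmult abs_int_norm g)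
  have *: "cmod (e * (c * z)) \<le> E * norm w" if "cmod e \<le> E" "cmod c = 1" "cmod z \<le> norm w"
    for e c z :: complex and w :: "complex \<times> complex"
    unfolding norm_mult that(2) using that E1 by (auto intro!: mult_mono)
  have "cmod (\<Phi>1 g x) \<le> integral {0..pi} (\<lambda>t. E * norm (g t))"
    unfolding \<Phi>1_def
    by (intro integral_initial_segment_le[OF _ r _ x] abs_int_exp_mult
        abs_int_cmult abs_int_fst_snd g * exp_le norm_fst_snd_le) auto
  then show "cmod (\<Phi>1 g x) \<le> E * N g" by (simp add: N_def)
  have "cmod (\<Phi>2 g x) \<le> integral {0..pi} (\<lambda>t. E * norm (g t))"
    unfolding \<Phi>2_def
    by (intro integral_initial_segment_le[OF _ r _ x] abs_int_exp_mult
        abs_int_cmult abs_int_fst_snd g * exp_le norm_fst_snd_le) auto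
  then show "cmod (\<Phi>2 g x) \<le> E * N g" by (simp add: N_def)
qed

lemma norm_lincomb_le:
  fixes m m' p q r :: complex
  assumes "cmod m \<le> M" "cmod m' \<le> M" "cmod p \<le> A" "cmod q \<le> A" "cmod r \<le> A'"
  shows "cmod (m * p + m' * q + r) \<le> 2 * M * A + A'"
proof -
  have "cmod (m * p + m' * q + r) \<le> cmod m * cmod p + cmod m' * cmod q + cmod r"
    by (metis (no_types, opaque_lifting) add.commute add_le_cancel_left add_mono_thms_linordered_semiring(3) norm_mult norm_triangle_ineq order_trans)
  also have "\<dots> \<le> M * A + M * A + A'"
    using assms M0 by (intro add_mono mult_mono) auto
  finally show ?thesis by (simp add: algebra_simps)
qed

definition A0 :: real where "A0 = (2 * M + 1) * E"

lemma norm_u_le: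
  assumes g: "abs_int g" and x: "x \<in> {0..pi}"
  shows "cmod (u1 g x) \<le> A0 * N g" "cmod (u2 g x) \<le> A0 * N g"
  using norm_lincomb_le[OF M(1,2) norm_Phi_le[OF g, of pi] norm_Phi_le(1)[OF g x]]
    norm_lincomb_le[OF M(3,4) norm_Phi_le[OF g, of pi] norm_Phi_le(2)[OF g x]]
  by (simp_all add: u1_def u2_def A0_def algebra_simps)

lemma norm_S_le_u:
  assumes "cmod (u1 g x) \<le> A" "cmod (u2 g x) \<le> A" "x \<in> {0..pi}"
  shows "norm (S g x) \<le> 2 * E * A"
proof -
  have A: "0 \<le> A" using assms(1) norm_ge_zero order_trans by blast
  have "norm (S g x) \<le> cmod (fst (S g x)) + cmod (snd (S g x))"
    by (metis norm_Pair_le prod.collapse)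
  also have "\<dots> \<le> E * A + E * A"
    unfolding S_def fst_conv snd_conv norm_mult
    using exp_le[OF assms(3)] assms E1 A by (intro add_mono mult_mono) auto
  finally show ?thesis by (simp add: algebra_simps)
qed

lemma A0_ge: "E \<le> A0" "0 \<le> A0" "1 \<le> A0"
proof -
  have "1 * E \<le> A0" unfolding A0_def using M0 E1 by (intro mult_right_mono) auto
  then show "E \<le> A0" "0 \<le> A0" "1 \<le> A0" using E1 by auto
qed

lemma K_eq: "K = 2 * E\<^sup>2 * A0\<^sup>2"
  by (simp add: K_def A0_def power2_eq_square power4_eq_xxxx algebra_simps)

lemma K_ge: "2 * E * A0 \<le> K" "0 \<le> K" "1 \<le> K"
proof -
  have "E * A0 * 1 \<le> E * A0 * (E * A0)"
    using E1 A0_ge mult_mono[of 1 E 1 A0] by (intro mult_left_mono) auto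
  then show "2 * E * A0 \<le> K" by (simp add: K_eq power2_eq_square algebra_simps)
  moreover have "1 * 1 \<le> E * A0" using E1 A0_ge by (intro mult_mono) auto
  ultimately show "0 \<le> K" "1 \<le> K" by auto
qed

lemma norm_S_le:
  assumes g: "abs_int g" and x: "x \<in> {0..pi}"
  shows "norm (S g x) \<le> K * N g"
proof -
  have "norm (S g x) \<le> 2 * E * (A0 * N g)"
    by (intro norm_S_le_u norm_u_le g x)
  also have "\<dots> \<le> K * N g"
    using mult_right_mono[OF K_ge(1) N_nonneg[OF g]] by (simp add: mult.assoc)
  finally show ?thesis .
qed

lemma HP_continuous_on: "continuous_on {0..pi} HP"
  unfolding HP_def
  by (intro indefinite_integral_continuous_1 abs_int_imp_int
      abs_int_exp_mult square_integrableD(1) P)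

lemma HQ_continuous_on: "continuous_on {0..pi} HQ"
  unfolding HQ_def
  by (intro indefinite_integral_continuous_1 abs_int_imp_int
      abs_int_exp_mult square_integrableD(1) Q)

lemma B_continuous_on: "continuous_on {0..pi} B"
  unfolding B_def by (intro continuous_intros HP_continuous_on HQ_continuous_on)

lemma B_nonneg: "0 \<le> B x" by (simp add: B_def)

text \<open>What integration by parts leaves under the integral: \<open>B\<close> bounds the
  oscillating primitive, and N g + |g| bounds, up to a constant, the derivative of the remaining
  factor.\<close>

definition J :: "(real \<Rightarrow> complex \<times> complex) \<Rightarrow> real" where
  "J g = integral {0..pi} (\<lambda>t. B t * (N g + norm (g t)))"

lemma abs_int_N_plus:
  assumes "abs_int g"
  shows "abs_int (\<lambda>t. N g + norm (g t))"
  by (intro set_integral_add abs_int_norm assms absolutely_integrable_continuous_real continuous_intros)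

lemma abs_int_J:
  assumes "abs_int g"
  shows "abs_int (\<lambda>t. B t * (N g + norm (g t)))"
  by (intro abs_int_mult_continuous B_continuous_on abs_int_N_plus assms)

lemma norm_exp_phase_le: "x \<in> {0..pi} \<Longrightarrow> cmod (exp (2 * \<i> * (l - of_int n) * of_real x)) \<le> E\<^sup>2"
  "x \<in> {0..pi} \<Longrightarrow> cmod (exp (- (2 * \<i> * (l - of_int n)) * of_real x)) \<le> E\<^sup>2"
proof -
  assume x: "x \<in> {0..pi}"
  have "\<bar>Im l * x\<bar> \<le> 1/2 * pi" using Im_l x unfolding abs_mult by (intro mult_mono) auto
  moreover have "E\<^sup>2 = exp pi" by (simp add: E_def exp_double[symmetric])
  ultimately show "cmod (exp (2 * \<i> * (l - of_int n) * of_real x)) \<le> E\<^sup>2"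
    "cmod (exp (- (2 * \<i> * (l - of_int n)) * of_real x)) \<le> E\<^sup>2"
    by (auto simp: norm_exp_eq_Re)
qed

text \<open>
  After splitting off the integer part of the spectral parameter, all remaining factors under the
  integral are controlled uniformly on the circle, so that only the primitives of
  \<open>exp (2 i n t) P\<close> and \<open>exp (- 2 i n t) Q\<close> enter the bound.
\<close>

lemma norm_oscillatory_factor_le:
  fixes c d k h :: complex and p :: "real \<Rightarrow> complex"
  assumes g: "abs_int g" and x: "x \<in> {0..pi}"
    and p: "abs_int p"
    and u: "ac_primitive 0 pi (\<lambda>t. exp (d * of_real t) * (k * w t)) u"
    and w: "\<And>t. t \<in> {0..pi} \<Longrightarrow> cmod (w t) \<le> norm (g t)"
    and k: "cmod k = 1" "cmod h = 1" and c: "cmod c \<le> 1"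
    and cexp: "\<And>t. t \<in> {0..pi} \<Longrightarrow> cmod (exp (c * of_real t)) \<le> E\<^sup>2"
    and dexp: "\<And>t. t \<in> {0..pi} \<Longrightarrow> cmod (exp (d * of_real t)) \<le> E"
    and ule: "\<And>t. t \<in> {0..pi} \<Longrightarrow> cmod (u t) \<le> A0 * N g"
    and HB: "\<And>t. t \<in> {0..pi} \<Longrightarrow> cmod (integral {0..t} p) \<le> B t"
  shows "cmod (integral {0..x} (\<lambda>t. p t * (h * (exp (c * of_real t) * u t)))) \<le> E\<^sup>2 * A0 * (B x * N g + J g)"
proof -
  let ?q = "\<lambda>t. h * (exp (c * of_real t) * u t)"
  \<comment> \<open>The zero summand is the derivative of the constant \<open>h\<close>; with it the
    term has exactly the shape given by \<open>ac_primitive_mult\<close>.\<close>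
  let ?r = "\<lambda>t. 0 * (exp (c * of_real t) * u t) +
      h * (c * exp (c * of_real t) * u t + exp (c * of_real t) * (exp (d * of_real t) * (k * w t)))"
  have const: "ac_primitive 0 pi (\<lambda>_. 0) (\<lambda>_. h)"
    by (simp add: ac_primitive_def)
  have q: "ac_primitive 0 pi ?r ?q"
    by (rule ac_primitive_mult[OF const ac_primitive_mult[OF ac_primitive_exp u]])
  let ?\<rho> = "\<lambda>t. E\<^sup>2 * A0 * (N g + norm (g t))"
  have eu: "cmod (exp (c * of_real t) * u t) \<le> E\<^sup>2 * (A0 * N g)" if "t \<in> {0..pi}" for t
    unfolding norm_mult using cexp[OF that] ule[OF that] by (intro mult_mono) auto
  have "cmod (integral {0..x} (\<lambda>t. p t * ?q t)) \<le> cmod (integral {0..x} p) * (E\<^sup>2 * A0 * N g)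
      + integral {0..pi} (\<lambda>t. cmod (integral {0..t} p) * ?\<rho> t)"
  proof (rule norm_integral_oscillatory_le[OF p q _ _ _ x])
    show "cmod (?q t) \<le> E\<^sup>2 * A0 * N g" if "t \<in> {0..pi}" for t
      using eu[OF that] k by (simp add: norm_mult mult.assoc)
    show "?\<rho> absolutely_integrable_on {0..pi}"
      by (intro abs_int_cmult abs_int_N_plus g)
    show "cmod (?r t) \<le> ?\<rho> t" if t: "t \<in> {0..pi}" for t
    proof -
      have "cmod (?r t) \<le> cmod c * cmod (exp (c * of_real t) * u t) + cmod (exp (c * of_real t)) * (cmod (exp (d * of_real t)) * cmod (w t))"
        using norm_triangle_ineq[of "c * (exp (c * of_real t) * u t)" "exp (c * of_real t) * (exp (d * of_real t) * (k * w t))"] k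
        by (simp add: norm_mult mult.assoc)
      also have "\<dots> \<le> 1 * (E\<^sup>2 * (A0 * N g)) + E\<^sup>2 * (A0 * norm (g t))"
        using c eu[OF t] cexp[OF t] dexp[OF t] w[OF t] A0_ge E1
        by (intro add_mono mult_mono) auto
      finally show ?thesis by (simp add: algebra_simps)
    qed
  qed
  also have "\<dots> \<le> B x * (E\<^sup>2 * A0 * N g) + integral {0..pi} (\<lambda>t. B t * ?\<rho> t)"
  proof (intro add_mono mult_right_mono integral_le HB x)
    show "0 \<le> E\<^sup>2 * A0 * N g" using A0_ge N_nonneg[OF g] by simp
    have "continuous_on {0..pi} (\<lambda>t. integral {0..t} p)"
      using p by (intro indefinite_integral_continuous_1) (simp add: absolutely_integrable_on_def)
    then have "abs_int (\<lambda>t. cmod (integral {0..t} p) * ?\<rho> t)"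
      by (intro abs_int_mult_continuous abs_int_cmult abs_int_N_plus g continuous_intros)
    then show "(\<lambda>t. cmod (integral {0..t} p) * ?\<rho> t) integrable_on {0..pi}"
      by (simp add: absolutely_integrable_on_def)
    have "abs_int (\<lambda>t. B t * ?\<rho> t)"
      by (intro abs_int_mult_continuous abs_int_cmult abs_int_N_plus g B_continuous_on)
    then show "(\<lambda>t. B t * ?\<rho> t) integrable_on {0..pi}"
      by (simp add: absolutely_integrable_on_def)
    show "0 \<le> ?\<rho> t" if "t \<in> {0..pi}" for t using A0_ge N_nonneg[OF g] by simp
  qed
  also have "integral {0..pi} (\<lambda>t. B t * ?\<rho> t) = E\<^sup>2 * A0 * J g"
    unfolding J_def by (subst integral_mult_right[symmetric]) (simp add: algebra_simps)
  finally show ?thesis by (simp add: algebra_simps)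
qed

lemma u_has_ac_primitive:
  assumes g: "abs_int g"
  shows "ac_primitive 0 pi (\<lambda>t. exp (\<i> * l * of_real t) * (\<i> * fst (g t))) (u1 g)"
    "ac_primitive 0 pi (\<lambda>t. exp (- (\<i> * l) * of_real t) * (- \<i> * snd (g t))) (u2 g)"
  unfolding u1_def u2_def \<Phi>1_def[where x = x for x] \<Phi>2_def[where x = x for x]
  by (intro ac_primitive_integral abs_int_exp_mult
      abs_int_cmult abs_int_fst_snd g)+

text \<open>\<open>V\<close> swaps the components, so exp (i l t) in \<open>\<Phi>1\<close> meets
  the second component of \<open>S g\<close>, which carries the same exponential: the phases add up
  instead of cancelling. \<open>phase_split\<close> separates the doubled phase into an integer
  frequency, which together with P gives \<open>HP\<close>, and a remainder of frequency at most 1.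
  The second component is the mirror image, with Q and \<open>HQ\<close>.\<close>

lemma norm_Phi_V_S_le:
  assumes g: "abs_int g" and x: "x \<in> {0..pi}"
  shows "cmod (\<Phi>1 (V (S g)) x) \<le> E\<^sup>2 * A0 * (B x * N g + J g)"
    "cmod (\<Phi>2 (V (S g)) x) \<le> E\<^sup>2 * A0 * (B x * N g + J g)"
proof -
  have hP: "abs_int (\<lambda>t. exp (2 * \<i> * of_int n * of_real t) * P t)"
    and hQ: "abs_int (\<lambda>t. exp (- (2 * \<i> * of_int n) * of_real t) * Q t)"
    by (intro abs_int_exp_mult square_integrableD(1) P Q)+
  have B: "cmod (integral {0..t} (\<lambda>t. exp (2 * \<i> * of_int n * of_real t) * P t)) \<le> B t"
    "cmod (integral {0..t} (\<lambda>t. exp (- (2 * \<i> * of_int n) * of_real t) * Q t)) \<le> B t" for t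
    unfolding B_def HP_def HQ_def by simp_all
  have c: "cmod (2 * \<i> * (l - of_int n)) \<le> 1" "cmod (- (2 * \<i> * (l - of_int n))) \<le> 1"
    using l by (simp_all add: norm_mult)
  have eq1: "\<Phi>1 (V (S g)) x = integral {0..x} (\<lambda>t. exp (2 * \<i> * of_int n * of_real t) * P t *
      (\<i> * (exp (2 * \<i> * (l - of_int n) * of_real t) * u2 g t)))"
    unfolding \<Phi>1_def
  proof (rule integral_cong)
    fix t
    have "exp (\<i> * l * of_real t) * exp (\<i> * l * of_real t)
        = exp (2 * \<i> * of_int n * of_real t) * exp (2 * \<i> * (l - of_int n) * of_real t)"
      unfolding exp_add[symmetric] phase_split(1)[of \<i> l "of_real t" "of_int n"] by (rule refl)
    moreover have "exp (\<i> * l * of_real t) * (\<i> * fst (V (S g) t))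
        = (exp (\<i> * l * of_real t) * exp (\<i> * l * of_real t)) * (P t * \<i> * u2 g t)"
      by (simp add: V_def S_def)
    ultimately show "exp (\<i> * l * of_real t) * (\<i> * fst (V (S g) t))
        = exp (2 * \<i> * of_int n * of_real t) * P t * (\<i> * (exp (2 * \<i> * (l - of_int n) * of_real t) * u2 g t))"
      by simp
  qed
  show "cmod (\<Phi>1 (V (S g)) x) \<le> E\<^sup>2 * A0 * (B x * N g + J g)"
    unfolding eq1
    by (rule norm_oscillatory_factor_le[OF g x hP u_has_ac_primitive(2)[OF g] norm_fst_snd_le(2) _ _ c(1) norm_exp_phase_le(1) exp_le(2) norm_u_le(2)[OF g] B(1)])
      simp_all
  have eq2: "\<Phi>2 (V (S g)) x = integral {0..x} (\<lambda>t. exp (- (2 * \<i> * of_int n) * of_real t) * Q t *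
      (- \<i> * (exp (- (2 * \<i> * (l - of_int n)) * of_real t) * u1 g t)))"
    unfolding \<Phi>2_def
  proof (rule integral_cong)
    fix t
    have "- (\<i> * l) * of_real t + - (\<i> * l) * of_real t
        = - (2 * \<i> * of_int n) * of_real t + - (2 * \<i> * (l - of_int n)) * of_real t"
      by (rule phase_split(2))
    then have "exp (- (\<i> * l) * of_real t) * exp (- (\<i> * l) * of_real t)
        = exp (- (2 * \<i> * of_int n) * of_real t) * exp (- (2 * \<i> * (l - of_int n)) * of_real t)"
      unfolding exp_add[symmetric] by (rule arg_cong)
    moreover have "exp (- (\<i> * l) * of_real t) * (- \<i> * snd (V (S g) t))
        = (exp (- (\<i> * l) * of_real t) * exp (- (\<i> * l) * of_real t)) * (Q t * - \<i> * u1 g t)"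
      by (simp add: V_def S_def)
    ultimately show "exp (- (\<i> * l) * of_real t) * (- \<i> * snd (V (S g) t))
        = exp (- (2 * \<i> * of_int n) * of_real t) * Q t * (- \<i> * (exp (- (2 * \<i> * (l - of_int n)) * of_real t) * u1 g t))"
      by simp
  qed
  show "cmod (\<Phi>2 (V (S g)) x) \<le> E\<^sup>2 * A0 * (B x * N g + J g)"
    unfolding eq2
    by (rule norm_oscillatory_factor_le[OF g x hQ u_has_ac_primitive(1)[OF g] norm_fst_snd_le(1) _ _ c(2) norm_exp_phase_le(2) exp_le(1) norm_u_le(1)[OF g] B(2)])
      simp_all
qed

text \<open>\<open>B pi\<close> enters through the value at 0, which the boundary conditions express
  by integrals over the whole interval, and \<open>B x\<close> through the integral up to x.\<close>

lemma norm_S_V_S_le: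
  assumes g: "abs_int g" and x: "x \<in> {0..pi}"
  shows "norm (S (V (S g)) x) \<le> K * ((B pi + B x) * N g + J g)"
proof -
  have p: "pi \<in> {0..pi}" by simp
  let ?C = "E\<^sup>2 * A0" and ?D = "(B pi + B x) * N g + J g"
  have C: "0 \<le> ?C" using A0_ge by simp
  have "B pi * N g + J g \<le> ?D" "B x * N g + J g \<le> ?D"
    using mult_nonneg_nonneg[OF B_nonneg[of x] N_nonneg[OF g]] mult_nonneg_nonneg[OF B_nonneg[of pi] N_nonneg[OF g]]
    by (simp_all add: algebra_simps)
  then have le: "?C * (B pi * N g + J g) \<le> ?C * ?D" "?C * (B x * N g + J g) \<le> ?C * ?D"
    using C by (intro mult_left_mono; simp)+
  note P1 = order_trans[OF norm_Phi_V_S_le(1)[OF g p] le(1)] order_trans[OF norm_Phi_V_S_le(2)[OF g p] le(1)]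
  have "cmod (u1 (V (S g)) x) \<le> 2 * M * (?C * ?D) + ?C * ?D" "cmod (u2 (V (S g)) x) \<le> 2 * M * (?C * ?D) + ?C * ?D"
    unfolding u1_def u2_def
    by (intro norm_lincomb_le M P1 order_trans[OF norm_Phi_V_S_le(1)[OF g x] le(2)] order_trans[OF norm_Phi_V_S_le(2)[OF g x] le(2)])+
  from norm_S_le_u[OF this x] show ?thesis
    by (simp add: K_eq A0_def power2_eq_square algebra_simps)
qed

end

section \<open>The perturbed equation as a fixed point problem\<close>

context dirac_bvp
begin

definition T :: "(real \<Rightarrow> complex \<times> complex) \<Rightarrow> real \<Rightarrow> complex \<times> complex" where
  "T y = S (V y)"

definition nv :: real where "nv = integral {0..pi} v"

abbreviation intB :: real where "intB \<equiv> integral {0..pi} B"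

abbreviation intBv :: real where "intBv \<equiv> integral {0..pi} (\<lambda>t. B t * v t)"

abbreviation intB2 :: real where "intB2 \<equiv> integral {0..pi} (\<lambda>t. (B t)\<^sup>2)"

abbreviation intB2v :: real where "intB2v \<equiv> integral {0..pi} (\<lambda>t. (B t)\<^sup>2 * v t)"

text \<open>Everything through which \<open>B\<close> enters the estimates once its value at the
  point of evaluation has been integrated out.\<close>

definition \<beta> :: real where
  "\<beta> = B pi + intB + intBv"

text \<open>The Lipschitz constant of the third iterate of \<open>T\<close> in the supremum norm
  that \<open>norm_T3_le\<close> provides.\<close>

definition \<kappa> :: real where "\<kappa> = K\<^sup>2 * nv * (nv + 2) * \<beta>"

text \<open>A bound for the solution operator from L1 to the supremum norm: \<open>K\<close> for
  \<open>S\<close>, the terms 1, T, T^2 of the Neumann series with |T| <= K nv, and the factor 2 = 1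
  / (1 - 1/2) for absorbing the third iterate.\<close>

definition L :: real where "L = 2 * K * (1 + K * nv + (K * nv)\<^sup>2)"

lemma v_nonneg: "0 \<le> v t" by (simp add: v_def)

lemma v_abs_int: "abs_int v"
  unfolding v_def[abs_def]
  by (intro set_integral_add square_integrableD(6) P Q)

lemma Bv_abs_int: "abs_int (\<lambda>t. B t * v t)"
  by (intro abs_int_mult_continuous B_continuous_on v_abs_int)

lemma B_abs_int: "B absolutely_integrable_on {0..pi}"
  by (intro absolutely_integrable_continuous_real B_continuous_on)

lemma nv_nonneg: "0 \<le> nv"
  unfolding nv_def by (intro integral_nonneg abs_int_imp_int v_abs_int v_nonneg)

lemma B_int_nonneg: "0 \<le> intB" "0 \<le> intBv"
  by (intro integral_nonneg abs_int_imp_int B_abs_int Bv_abs_int mult_nonneg_nonneg B_nonneg v_nonneg)+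

lemma \<beta>_nonneg: "0 \<le> \<beta>"
  unfolding \<beta>_def using B_int_nonneg B_nonneg[of pi] by simp

lemma N_V_le:
  assumes y: "continuous_on {0..pi} y" and h: "continuous_on {0..pi} h"
    and le: "\<And>t. t \<in> {0..pi} \<Longrightarrow> norm (y t) \<le> h t"
  shows "N (V y) \<le> integral {0..pi} (\<lambda>t. v t * h t)"
  unfolding N_def
proof (rule integral_le)
  show "(\<lambda>t. norm (V y t)) integrable_on {0..pi}"
    by (intro abs_int_imp_int abs_int_norm V_abs_int y)
  show "(\<lambda>t. v t * h t) integrable_on {0..pi}"
    by (intro abs_int_imp_int abs_int_mult_continuous h v_abs_int)
  show "norm (V y t) \<le> v t * h t" if "t \<in> {0..pi}" for t
    using norm_V_le[of y t] mult_left_mono[OF le[OF that] v_nonneg[of t]] by linarith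
qed

lemma N_V_le_const:
  assumes y: "continuous_on {0..pi} y" and le: "\<And>t. t \<in> {0..pi} \<Longrightarrow> norm (y t) \<le> Y"
  shows "N (V y) \<le> nv * Y"
  using N_V_le[OF y _ le] by (simp add: nv_def)

lemma T_continuous_on: "continuous_on {0..pi} y \<Longrightarrow> continuous_on {0..pi} (T y)"
  unfolding T_def by (intro S_continuous_on V_abs_int)

lemma V_cong: "(\<And>t. t \<in> {0..pi} \<Longrightarrow> y t = z t) \<Longrightarrow> t \<in> {0..pi} \<Longrightarrow> V y t = V z t"
  by (simp add: V_def)

lemma T_cong:
  assumes "\<And>t. t \<in> {0..pi} \<Longrightarrow> y t = z t" "x \<in> {0..pi}"
  shows "T y x = T z x"
  unfolding T_def by (intro S_cong V_cong assms)

lemma T_diff: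
  assumes "continuous_on {0..pi} y" "continuous_on {0..pi} z" "x \<in> {0..pi}"
  shows "T (\<lambda>t. y t - z t) x = T y x - T z x"
proof -
  have "V (\<lambda>t. y t - z t) = (\<lambda>t. V y t - V z t)"
    by (simp add: V_def fun_eq_iff algebra_simps)
  then show ?thesis unfolding T_def using S_diff[OF V_abs_int V_abs_int] assms by simp
qed

lemma norm_T_le:
  assumes y: "continuous_on {0..pi} y" and le: "\<And>t. t \<in> {0..pi} \<Longrightarrow> norm (y t) \<le> Y" and x: "x \<in> {0..pi}"
  shows "norm (T y x) \<le> K * nv * Y"
proof -
  have "norm (T y x) \<le> K * N (V y)"
    unfolding T_def by (intro norm_S_le V_abs_int y x)
  also have "\<dots> \<le> K * (nv * Y)" by (intro mult_left_mono N_V_le_const y le K_ge)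
  finally show ?thesis by (simp add: mult.assoc)
qed

text \<open>T (T y) is \<open>S V S\<close> applied to V y, so the oscillatory bound applies once;
  the value \<open>B x\<close> at the point of evaluation survives.\<close>

lemma norm_T2_le:
  assumes y: "continuous_on {0..pi} y" and le: "\<And>t. t \<in> {0..pi} \<Longrightarrow> norm (y t) \<le> Y" and x: "x \<in> {0..pi}"
  shows "norm (T (T y) x) \<le> K * Y * (nv * B x + (nv + 1) * \<beta>)"
proof -
  have Y: "0 \<le> Y" using le[OF x] norm_ge_zero order_trans by blast
  have g: "abs_int (V y)" by (rule V_abs_int[OF y])
  have NV: "N (V y) \<le> nv * Y" by (rule N_V_le_const[OF y le])
  have "J (V y) \<le> integral {0..pi} (\<lambda>t. nv * Y * B t + Y * (B t * v t))"
    unfolding J_def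
  proof (rule integral_le)
    show "(\<lambda>t. B t * (N (V y) + norm (V y t))) integrable_on {0..pi}"
      by (intro abs_int_imp_int abs_int_J g)
    show "(\<lambda>t. nv * Y * B t + Y * (B t * v t)) integrable_on {0..pi}"
      by (intro abs_int_imp_int set_integral_add abs_int_cmult B_abs_int Bv_abs_int)
    fix t assume t: "t \<in> {0..pi}"
    have "N (V y) + norm (V y t) \<le> nv * Y + v t * Y"
      using NV norm_V_le[of y t] mult_left_mono[OF le[OF t] v_nonneg[of t]] by linarith
    from mult_left_mono[OF this B_nonneg[of t]]
    show "B t * (N (V y) + norm (V y t)) \<le> nv * Y * B t + Y * (B t * v t)"
      by (simp add: algebra_simps)
  qed
  also have "\<dots> = nv * Y * intB + Y * intBv"
    by (subst integral_add) (auto intro!: abs_int_imp_int abs_int_cmult B_abs_int Bv_abs_int)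
  finally have "(B pi + B x) * N (V y) + J (V y)
      \<le> (B pi + B x) * (nv * Y) + (nv * Y * intB + Y * intBv)"
    using NV B_nonneg by (intro add_mono mult_left_mono) auto
  also have "\<dots> = Y * (nv * B x + nv * (B pi + intB) + intBv)"
    by (simp add: algebra_simps)
  also have "\<dots> \<le> Y * (nv * B x + nv * \<beta> + \<beta>)"
    using nv_nonneg B_int_nonneg B_nonneg[of pi] Y
    by (intro mult_left_mono add_mono) (auto simp: \<beta>_def)
  finally have "(B pi + B x) * N (V y) + J (V y) \<le> Y * (nv * B x + nv * \<beta> + \<beta>)" .
  from mult_left_mono[OF this K_ge(2)] show ?thesis
    using norm_S_V_S_le[OF g x] by (simp add: T_def algebra_simps)
qed

text \<open>The outer \<open>S\<close> sees T (T y) only through the L1 norm after multiplication by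
  \<open>V\<close>. This integrates the surviving \<open>B x\<close> against \<open>v\<close>, and
  \<open>\<beta>\<close> covers the result.\<close>

lemma norm_T3_le:
  assumes y: "continuous_on {0..pi} y" and le: "\<And>t. t \<in> {0..pi} \<Longrightarrow> norm (y t) \<le> Y" and x: "x \<in> {0..pi}"
  shows "norm (T (T (T y)) x) \<le> \<kappa> * Y"
proof -
  have Y: "0 \<le> Y" using le[OF x] norm_ge_zero order_trans by blast
  have "N (V (T (T y))) \<le> integral {0..pi} (\<lambda>t. v t * (K * Y * (nv * B t + (nv + 1) * \<beta>)))"
    by (rule N_V_le) (intro T_continuous_on y norm_T2_le le continuous_intros B_continuous_on | assumption)+
  also have "\<dots> = integral {0..pi} (\<lambda>t. K * Y * nv * (B t * v t) + K * Y * (nv + 1) * \<beta> * v t)"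
    by (rule integral_cong) (simp add: algebra_simps)
  also have "\<dots> = K * Y * nv * intBv + K * Y * (nv + 1) * \<beta> * nv"
    unfolding nv_def
    by (subst integral_add) (auto intro!: abs_int_imp_int abs_int_cmult v_abs_int Bv_abs_int)
  also have "\<dots> \<le> K * Y * nv * \<beta> + K * Y * (nv + 1) * \<beta> * nv"
    using nv_nonneg B_int_nonneg B_nonneg[of pi] Y K_ge
    by (intro mult_left_mono add_mono) (auto simp: \<beta>_def)
  also have "\<dots> = K * nv * (nv + 2) * \<beta> * Y" by (simp add: algebra_simps)
  finally have "K * N (V (T (T y))) \<le> K * (K * nv * (nv + 2) * \<beta> * Y)"
    by (intro mult_left_mono K_ge)
  moreover have "norm (T (T (T y)) x) \<le> K * N (V (T (T y)))"
    unfolding T_def[of "T (T y)"]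
    by (intro norm_S_le V_abs_int T_continuous_on y x)
  ultimately show ?thesis by (simp add: \<kappa>_def power2_eq_square algebra_simps)
qed

definition solution :: "(real \<Rightarrow> complex \<times> complex) \<Rightarrow> (real \<Rightarrow> complex \<times> complex) \<Rightarrow> bool" where
  "solution f y \<longleftrightarrow> continuous_on {0..pi} y \<and> (\<forall>x\<in>{0..pi}. y x = S (\<lambda>t. f t + V y t) x)"

lemma S_add:
  assumes g: "abs_int g" and h: "abs_int h" and x: "x \<in> {0..pi}"
  shows "S (\<lambda>x. g x + h x) x = S g x + S h x"
proof -
  have "abs_int (\<lambda>x. g x + h x)" by (intro set_integral_add g h)
  from S_diff[OF this h x] show ?thesis by simp
qed

lemma solution_iff:
  assumes f: "abs_int f"
  shows "solution f y \<longleftrightarrow> continuous_on {0..pi} y \<and> (\<forall>x\<in>{0..pi}. y x = S f x + T y x)"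
  unfolding solution_def T_def using S_add[OF f V_abs_int] by auto

lemma solution_diff:
  assumes f: "abs_int f" and g: "abs_int g"
    and y: "solution f y" and z: "solution g z"
  shows "solution (\<lambda>t. f t - g t) (\<lambda>t. y t - z t)"
proof -
  have c: "continuous_on {0..pi} y" "continuous_on {0..pi} z" using y z by (auto simp: solution_def)
  have "abs_int (\<lambda>t. f t - g t)" by (intro set_integral_diff f g)
  from solution_iff[OF this] show ?thesis
    using y z c by (auto simp: solution_iff[OF f] solution_iff[OF g] S_diff[OF f g] T_diff intro!: continuous_on_diff)
qed

context
  assumes \<kappa>: "\<kappa> \<le> 1/2"
begin

text \<open>Iterating y = S f + T y gives y = S f + T (S f) + T (T (S f)) + T (T (T y)). At a point
  where |y| is maximal the last term is at most half of the left side and is absorbed there.\<close>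

lemma norm_solution_le:
  assumes f: "abs_int f" and y: "solution f y" and x: "x \<in> {0..pi}"
  shows "norm (y x) \<le> L * N f"
proof -
  have c: "continuous_on {0..pi} y" and eq: "\<And>x. x \<in> {0..pi} \<Longrightarrow> y x - T y x = S f x"
    using y by (auto simp: solution_iff[OF f])
  have cS: "continuous_on {0..pi} (S f)" by (rule S_continuous_on[OF f])
  have eq2: "T y x - T (T y) x = T (S f) x" if x: "x \<in> {0..pi}" for x
    using T_diff[OF c T_continuous_on[OF c] x] T_cong[OF eq x] by simp
  have eq3: "T (T y) x - T (T (T y)) x = T (T (S f)) x" if x: "x \<in> {0..pi}" for x
    using T_diff[OF T_continuous_on[OF c] T_continuous_on[OF T_continuous_on[OF c]] x] T_cong[OF eq2 x] by simp
  have s1: "norm (S f t) \<le> K * N f" if "t \<in> {0..pi}" for t by (rule norm_S_le[OF f that])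
  have s2: "norm (T (S f) t) \<le> K * nv * (K * N f)" if "t \<in> {0..pi}" for t by (rule norm_T_le[OF cS s1 that])
  have s3: "norm (T (T (S f)) t) \<le> K * nv * (K * nv * (K * N f))" if "t \<in> {0..pi}" for t
    by (rule norm_T_le[OF T_continuous_on[OF cS] s2 that])
  have "continuous_on {0..pi} (\<lambda>x. norm (y x))" by (intro continuous_intros c)
  then obtain x0 where x0: "x0 \<in> {0..pi}" "\<And>t. t \<in> {0..pi} \<Longrightarrow> norm (y t) \<le> norm (y x0)"
    using continuous_attains_sup[of "{0..pi}" "\<lambda>x. norm (y x)"] by fastforce
  have "y x0 = S f x0 + T (S f) x0 + T (T (S f)) x0 + T (T (T y)) x0"
    using eq[OF x0(1)] eq2[OF x0(1)] eq3[OF x0(1)] by (simp add: algebra_simps)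
  then have "norm (y x0) \<le> norm (S f x0) + norm (T (S f) x0) + norm (T (T (S f)) x0) + norm (T (T (T y)) x0)"
    by (simp only:) (intro norm_triangle_mono order_refl)
  also have "\<dots> \<le> K * N f + K * nv * (K * N f) + K * nv * (K * nv * (K * N f)) + \<kappa> * norm (y x0)"
    by (intro add_mono s1 s2 s3 norm_T3_le c x0)
  also have "\<dots> \<le> K * N f + K * nv * (K * N f) + K * nv * (K * nv * (K * N f)) + 1/2 * norm (y x0)"
    by (intro add_left_mono mult_right_mono \<kappa>) auto
  finally have "norm (y x0) \<le> K * N f + K * nv * (K * N f) + K * nv * (K * nv * (K * N f)) + 1/2 * norm (y x0)" .
  moreover have "a \<le> r + 1/2 * a \<Longrightarrow> a \<le> 2 * r" for a r :: real by simp
  ultimately have "norm (y x0) \<le> 2 * (K * N f + K * nv * (K * N f) + K * nv * (K * nv * (K * N f)))" by blast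
  also have "\<dots> = L * N f" by (simp add: L_def power2_eq_square algebra_simps)
  finally show ?thesis using x0(2)[OF x] by simp
qed

lemma solution_unique:
  assumes f: "abs_int f" and y: "solution f y" and z: "solution f z" and x: "x \<in> {0..pi}"
  shows "y x = z x"
proof -
  have "abs_int (\<lambda>t. f t - f t)" by simp
  from norm_solution_le[OF this solution_diff[OF f f y z] x] show ?thesis
    by (simp add: N_def)
qed

text \<open>The affine map \<open>F\<close> itself need not be a contraction, but its third iterate
  is one; uniqueness of the fixed point of the iterate makes it a fixed point of
  \<open>F\<close>.\<close>

lemma solution_exists:
  assumes f: "abs_int f"
  obtains y where "solution f y"
proof -
  \<comment> \<open>The type of bounded continuous functions lives on the whole line; clamping the
    argument to [0, pi] extends functions from the interval without changing suprema.\<close>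
  define cl :: "real \<Rightarrow> real" where "cl x = max 0 (min pi x)" for x
  have cl: "cl x \<in> {0..pi}" "x \<in> {0..pi} \<Longrightarrow> cl x = x" for x by (auto simp: cl_def)
  define F :: "(real \<Rightarrow>\<^sub>C (complex \<times> complex)) \<Rightarrow> (real \<Rightarrow>\<^sub>C (complex \<times> complex))" where
    "F z = Bcontfun (\<lambda>x. S f (cl x) + T (apply_bcontfun z) (cl x))" for z
  have F: "F z x = S f (cl x) + T (apply_bcontfun z) (cl x)" for z x
  proof -
    have c: "continuous_on {0..pi} (\<lambda>x. S f x + T (apply_bcontfun z) x)"
      by (intro continuous_on_add S_continuous_on f T_continuous_on) simp
    then have "continuous_on UNIV (\<lambda>x. S f (cl x) + T (apply_bcontfun z) (cl x))"
      by (rule continuous_on_compose2[of _ _ _ cl]) (use cl in \<open>auto simp: cl_def intro!: continuous_intros\<close>)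
    moreover obtain C where C: "\<And>x. x \<in> {0..pi} \<Longrightarrow> norm (S f x + T (apply_bcontfun z) x) \<le> C"
      by (rule bounded_continuous_Icc[OF c]) blast
    ultimately have "(\<lambda>x. S f (cl x) + T (apply_bcontfun z) (cl x)) \<in> bcontfun"
      by (rule bcontfun_normI) (use C cl in blast)
    then show ?thesis unfolding F_def by (simp add: Bcontfun_inverse)
  qed
  have F_diff: "F z x - F w x = T (\<lambda>t. z t - w t) x" if "x \<in> {0..pi}" for z w x
    using T_diff[of "apply_bcontfun z" "apply_bcontfun w", OF _ _ that] that by (simp add: F cl)
  have "dist (F (F (F z))) (F (F (F w))) \<le> 1/2 * dist z w" for z w
  proof (rule dist_bound)
    fix x
    define x' where "x' = cl x"
    have x': "x' \<in> {0..pi}" unfolding x'_def by (rule cl(1))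
    have "F (F (F z)) x - F (F (F w)) x = F (F (F z)) x' - F (F (F w)) x'"
      using cl x' by (simp add: F x'_def)
    also have "\<dots> = T (\<lambda>t. F (F z) t - F (F w) t) x'" by (rule F_diff[OF x'])
    also have "\<dots> = T (T (T (\<lambda>t. z t - w t))) x'"
    proof (rule T_cong[OF _ x'])
      fix t assume t: "t \<in> {0..pi}"
      have "F (F z) t - F (F w) t = T (\<lambda>t. F z t - F w t) t" by (rule F_diff[OF t])
      also have "\<dots> = T (T (\<lambda>t. z t - w t)) t" by (rule T_cong[OF F_diff t])
      finally show "F (F z) t - F (F w) t = T (T (\<lambda>t. z t - w t)) t" .
    qed
    finally have "dist (F (F (F z)) x) (F (F (F w)) x) = norm (T (T (T (\<lambda>t. z t - w t))) x')"
      by (simp add: dist_norm)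
    also have "\<dots> \<le> \<kappa> * dist z w"
      by (intro norm_T3_le x' continuous_intros) (auto simp: dist_norm[symmetric] dist_bounded)
    also have "\<dots> \<le> 1/2 * dist z w" by (intro mult_right_mono \<kappa>) auto
    finally show "dist (F (F (F z)) x) (F (F (F w)) x) \<le> 1/2 * dist z w" .
  qed
  then have "\<exists>!z. (F \<circ> F \<circ> F) z = z"
    by (intro banach_fix_type[of "1/2"]) auto
  then obtain z where z: "F (F (F z)) = z" "\<And>w. F (F (F w)) = w \<Longrightarrow> w = z" by auto
  \<comment> \<open>F z is again fixed by the third iterate of \<open>F\<close>.\<close>
  have "F z = z" by (rule z(2)) (simp add: z(1))
  then have "z x = S f x + T (apply_bcontfun z) x" if "x \<in> {0..pi}" for x
    using F[of z x] cl that by simp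
  then have "solution f (apply_bcontfun z)" by (simp add: solution_iff[OF f])
  then show ?thesis by (rule that)
qed

text \<open>Here y - S f = T y, and replacing y by S (f + V y) inside \<open>T\<close> produces
  \<open>S V S\<close>. The part V y is controlled by the supremum bound on y; f has no pointwise
  bound, so the integral of B |f| stays and is later treated by Cauchy-Schwarz.\<close>

lemma norm_solution_diff_le:
  assumes f: "abs_int f" and y: "solution f y" and x: "x \<in> {0..pi}"
  shows "norm (y x - S f x)
    \<le> K * ((1 + nv * L + L) * N f * (B x + \<beta>) + integral {0..pi} (\<lambda>t. B t * norm (f t)))"
proof -
  have c: "continuous_on {0..pi} y" using y by (simp add: solution_def)
  define Y where "Y = L * N f"
  have Y: "\<And>t. t \<in> {0..pi} \<Longrightarrow> norm (y t) \<le> Y" unfolding Y_def by (rule norm_solution_le[OF f y])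
  have Y0: "0 \<le> Y" using Y[OF x] norm_ge_zero order_trans by blast
  define g where "g t = f t + V y t" for t
  have g: "abs_int g"
    unfolding g_def[abs_def] by (intro set_integral_add f V_abs_int c)
  have yS: "\<And>t. t \<in> {0..pi} \<Longrightarrow> y t = S g t" using y unfolding solution_def g_def[abs_def] by blast
  have "y x - S f x = T y x" using y x by (auto simp: solution_iff[OF f])
  also have "\<dots> = S (V (S g)) x" using T_cong[OF yS x] by (simp add: T_def)
  finally have le1: "norm (y x - S f x) \<le> K * ((B pi + B x) * N g + J g)"
    using norm_S_V_S_le[OF g x] by simp
  have normg: "norm (g t) \<le> norm (f t) + Y * v t" if "t \<in> {0..pi}" for t
    using norm_triangle_ineq[of "f t" "V y t"] norm_V_le[of y t] mult_left_mono[OF Y[OF that] v_nonneg[of t]]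
    unfolding g_def by (simp add: mult.commute)
  have "N g \<le> integral {0..pi} (\<lambda>t. norm (f t) + Y * v t)"
    unfolding N_def
    by (intro integral_le abs_int_imp_int set_integral_add abs_int_cmult v_abs_int abs_int_norm f g normg)
  also have "\<dots> = N f + Y * nv"
    unfolding N_def nv_def
    by (subst integral_add) (auto intro!: abs_int_imp_int abs_int_cmult v_abs_int abs_int_norm f)
  finally have Ng: "N g \<le> N f + Y * nv" .
  have Bf: "abs_int (\<lambda>t. B t * norm (f t))"
    by (intro abs_int_mult_continuous B_continuous_on abs_int_norm f)
  have "J g \<le> integral {0..pi} (\<lambda>t. (N f + Y * nv) * B t + (B t * norm (f t) + Y * (B t * v t)))"
    unfolding J_def
  proof (intro integral_le abs_int_imp_int set_integral_add abs_int_cmult B_abs_int Bv_abs_int Bf abs_int_J g)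
    fix t assume t: "t \<in> {0..pi}"
    have "B t * (N g + norm (g t)) \<le> B t * ((N f + Y * nv) + (norm (f t) + Y * v t))"
      by (intro mult_left_mono add_mono Ng normg t B_nonneg)
    then show "B t * (N g + norm (g t)) \<le> (N f + Y * nv) * B t + (B t * norm (f t) + Y * (B t * v t))"
      by (simp add: algebra_simps)
  qed
  also have "\<dots> = (N f + Y * nv) * intB
      + (integral {0..pi} (\<lambda>t. B t * norm (f t)) + Y * intBv)"
    by (simp add: integral_add abs_int_imp_int set_integral_add abs_int_cmult B_abs_int Bv_abs_int Bf)
  finally have Jg: "J g \<le> (N f + Y * nv) * intB
      + (integral {0..pi} (\<lambda>t. B t * norm (f t)) + Y * intBv)" .
  have "(B pi + B x) * N g + J g \<le> (B pi + B x) * (N f + Y * nv) + ((N f + Y * nv) * intB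
      + (integral {0..pi} (\<lambda>t. B t * norm (f t)) + Y * intBv))"
    using B_nonneg[of x] B_nonneg[of pi] by (intro add_mono mult_left_mono Ng Jg) auto
  also have "\<dots> = (N f + Y * nv) * (B x + (B pi + intB)) + Y * intBv
      + integral {0..pi} (\<lambda>t. B t * norm (f t))"
    by (simp add: algebra_simps)
  also have "\<dots> \<le> (N f + Y * nv) * (B x + \<beta>) + Y * (B x + \<beta>) + integral {0..pi} (\<lambda>t. B t * norm (f t))"
    using Y0 nv_nonneg N_nonneg[OF f] B_int_nonneg B_nonneg[of x] B_nonneg[of pi]
    by (intro add_mono mult_left_mono order_refl) (auto simp: \<beta>_def)
  also have "\<dots> = (1 + nv * L + L) * N f * (B x + \<beta>) + integral {0..pi} (\<lambda>t. B t * norm (f t))"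
    by (simp add: Y_def algebra_simps)
  finally have "(B pi + B x) * N g + J g
    \<le> (1 + nv * L + L) * N f * (B x + \<beta>) + integral {0..pi} (\<lambda>t. B t * norm (f t))" .
  from mult_left_mono[OF this K_ge(2)] le1 show ?thesis by linarith
qed

end

end

section \<open>Bessel's inequality and summation over the spectrum\<close>

lemma integral_exp_2i:
  fixes k :: int
  shows "((\<lambda>t. exp (2 * \<i> * of_int k * of_real t)) has_integral (if k = 0 then of_real pi else 0)) {0..pi}"
proof (cases "k = 0")
  case True
  then show ?thesis using has_integral_const_real[of "1::complex" 0 pi] by (simp add: scaleR_conv_of_real)
next
  case False
  let ?c = "2 * \<i> * of_int k"
  have "((\<lambda>t. exp (?c * of_real t)) has_integral exp (?c * of_real pi) / ?c - exp (?c * of_real 0) / ?c) {0..pi}"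
  proof (rule fundamental_theorem_of_calculus)
    show "((\<lambda>t. exp (?c * of_real t) / ?c) has_vector_derivative exp (?c * of_real t)) (at t within {0..pi})" for t
      by (rule has_vector_derivative_real_field[where f = "\<lambda>z. exp (?c * z) / ?c"])
        (use False in \<open>auto intro!: derivative_eq_intros\<close>)
  qed simp
  moreover have "exp (?c * of_real pi) = 1"
    unfolding exp_eq_1 by (auto intro!: exI[of _ k])
  ultimately show ?thesis using False by simp
qed

lemma integral_norm_exp_sum_square:
  fixes c :: "int \<Rightarrow> complex"
  assumes "finite A"
  shows "((\<lambda>t. (cmod (\<Sum>n\<in>A. c n * exp (2 * \<i> * of_int n * of_real t)))\<^sup>2) has_integral
    pi * (\<Sum>n\<in>A. (cmod (c n))\<^sup>2)) {0..pi}"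
proof -
  let ?e = "\<lambda>n t. exp (2 * \<i> * of_int n * of_real t)"
  have "((\<lambda>t. \<Sum>n\<in>A. \<Sum>m\<in>A. c n * cnj (c m) * ?e (n - m) t) has_integral
      (\<Sum>n\<in>A. \<Sum>m\<in>A. c n * cnj (c m) * (if n - m = 0 then of_real pi else 0))) {0..pi}"
    using assms by (intro has_integral_sum has_integral_mult_right integral_exp_2i)
  also have "(\<Sum>n\<in>A. \<Sum>m\<in>A. c n * cnj (c m) * (if n - m = 0 then of_real pi else 0)) =
      (\<Sum>n\<in>A. of_real (pi * (cmod (c n))\<^sup>2))"
  proof (rule sum.cong[OF refl])
    fix n assume "n \<in> A"
    have "(\<Sum>m\<in>A. c n * cnj (c m) * (if n - m = 0 then of_real pi else 0))
        = (\<Sum>m\<in>A. if n = m then c n * cnj (c m) * of_real pi else 0)"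
      by (rule sum.cong) auto
    also have "\<dots> = of_real (pi * (cmod (c n))\<^sup>2)"
      using assms \<open>n \<in> A\<close> by (simp add: sum.delta' complex_norm_square mult.commute del: of_real_power)
    finally show "(\<Sum>m\<in>A. c n * cnj (c m) * (if n - m = 0 then of_real pi else 0)) = of_real (pi * (cmod (c n))\<^sup>2)" .
  qed
  also have "(\<lambda>t. \<Sum>n\<in>A. \<Sum>m\<in>A. c n * cnj (c m) * ?e (n - m) t)
      = (\<lambda>t. of_real ((cmod (\<Sum>n\<in>A. c n * ?e n t))\<^sup>2))"
  proof
    fix t
    have cn: "cnj (?e m t) = ?e (- m) t" for m by (simp add: exp_cnj)
    have "of_real ((cmod (\<Sum>n\<in>A. c n * ?e n t))\<^sup>2) = (\<Sum>n\<in>A. c n * ?e n t) * cnj (\<Sum>n\<in>A. c n * ?e n t)"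
      by (rule complex_norm_square)
    also have "\<dots> = (\<Sum>n\<in>A. \<Sum>m\<in>A. (c n * ?e n t) * (cnj (c m) * ?e (- m) t))"
      by (simp add: cnj_sum sum_product cn del: of_int_minus)
    also have "\<dots> = (\<Sum>n\<in>A. \<Sum>m\<in>A. c n * cnj (c m) * ?e (n - m) t)"
      by (intro sum.cong refl) (simp add: exp_add[symmetric] algebra_simps)
    finally show "(\<Sum>n\<in>A. \<Sum>m\<in>A. c n * cnj (c m) * ?e (n - m) t)
      = of_real ((cmod (\<Sum>n\<in>A. c n * ?e n t))\<^sup>2)" by simp
  qed
  finally have "((\<lambda>t. complex_of_real ((cmod (\<Sum>n\<in>A. c n * ?e n t))\<^sup>2)) has_integral
      of_real (\<Sum>n\<in>A. pi * (cmod (c n))\<^sup>2)) {0..pi}" by simp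
  from has_integral_Re[OF this] show ?thesis by (simp add: sum_distrib_left)
qed

text \<open>A duality argument: the sum s of the squares is the integral over {0..x} of h f, with h
  the trigonometric sum with coefficients cnj (c n). Only after passing to absolute values is the
  integral extended to {0..pi}, where orthogonality gives pi s for the integral of |h|^2.
  Cauchy-Schwarz then bounds s^2 by a multiple of s, and one factor s cancels.\<close>

lemma Bessel_initial_segment:
  fixes f :: "real \<Rightarrow> complex"
  assumes A: "finite A" and f: "square_integrable f" and x: "x \<in> {0..pi}"
  shows "(\<Sum>n\<in>A. (cmod (integral {0..x} (\<lambda>t. exp (2 * \<i> * of_int n * of_real t) * f t)))\<^sup>2)
    \<le> pi * integral {0..pi} (\<lambda>t. (cmod (f t))\<^sup>2)"
proof -
  let ?e = "\<lambda>n t. exp (2 * \<i> * of_int n * complex_of_real t)"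
  define c where "c n = integral {0..x} (\<lambda>t. ?e n t * f t)" for n
  define s where "s = (\<Sum>n\<in>A. (cmod (c n))\<^sup>2)"
  define h where "h t = (\<Sum>n\<in>A. cnj (c n) * ?e n t)" for t
  have ef: "abs_int (\<lambda>t. ?e n t * f t)" for n
    by (intro abs_int_exp_mult square_integrableD(1) f)
  have ch: "continuous_on {0..pi} h" unfolding h_def by (intro continuous_intros)
  have hf: "abs_int (\<lambda>t. h t * f t)"
    by (intro abs_int_mult_continuous ch square_integrableD(1) f)
  have hf': "abs_int (\<lambda>t. cmod (h t) * cmod (f t))"
    by (intro abs_int_mult_continuous continuous_intros ch square_integrableD(6) f)
  have "complex_of_real s = (\<Sum>n\<in>A. cnj (c n) * c n)"
    by (simp add: s_def complex_norm_square mult.commute del: of_real_power)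
  also have "\<dots> = (\<Sum>n\<in>A. integral {0..x} (\<lambda>t. cnj (c n) * (?e n t * f t)))"
    by (simp add: c_def)
  also have "\<dots> = integral {0..x} (\<lambda>t. \<Sum>n\<in>A. cnj (c n) * (?e n t * f t))"
    by (rule integral_sum[symmetric, OF A])
      (intro abs_int_initial_segment[OF _ x] abs_int_cmult ef)
  also have "\<dots> = integral {0..x} (\<lambda>t. h t * f t)"
    by (simp add: h_def sum_distrib_right mult.assoc)
  finally have s: "complex_of_real s = integral {0..x} (\<lambda>t. h t * f t)" .
  have s0: "0 \<le> s" by (simp add: s_def sum_nonneg)
  have "s = cmod (complex_of_real s)" using s0 by simp
  also have "\<dots> \<le> integral {0..pi} (\<lambda>t. cmod (h t) * cmod (f t))"
    unfolding s by (rule integral_initial_segment_le[OF hf hf' _ x]) (simp add: norm_mult)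
  finally have "s\<^sup>2 \<le> (integral {0..pi} (\<lambda>t. cmod (h t) * cmod (f t)))\<^sup>2"
    using s0 by (intro power_mono)
  also have "\<dots> \<le> integral {0..pi} (\<lambda>t. (cmod (h t))\<^sup>2) * integral {0..pi} (\<lambda>t. (cmod (f t))\<^sup>2)"
    by (intro integral_Cauchy_Schwarz square_integrableD(5) f square_integrable_continuous ch
        absolutely_integrable_on_def[THEN iffD1, THEN conjunct1, OF hf'])
  also have "integral {0..pi} (\<lambda>t. (cmod (h t))\<^sup>2) = pi * s"
    using integral_norm_exp_sum_square[OF A, of "\<lambda>n. cnj (c n)"]
    by (intro integral_unique) (simp add: h_def s_def)
  finally have le: "s * s \<le> s * (pi * integral {0..pi} (\<lambda>t. (cmod (f t))\<^sup>2))"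
    by (simp add: power2_eq_square algebra_simps)
  have "0 \<le> pi * integral {0..pi} (\<lambda>t. (cmod (f t))\<^sup>2)"
    using square_integrableD(5)[OF f] by (intro mult_nonneg_nonneg integral_nonneg) auto
  then have "s \<le> pi * integral {0..pi} (\<lambda>t. (cmod (f t))\<^sup>2)"
    using le s0 by (cases "s = 0") auto
  then show ?thesis by (simp add: s_def c_def)
qed

text \<open>Subtracting n from l does not change exp (2 i pi l), so all the circles reduce to one
  compact circle around 0. The function vanishes only at integers, and no integer has modulus 1/2,
  so its minimum there is positive.\<close>

lemma norm_one_minus_exp_ge:
  obtains c where "c > 0" "\<And>n l. cmod (l - of_int n) = 1/2 \<Longrightarrow> c \<le> cmod (1 - (exp (\<i> * l * of_real pi))\<^sup>2)"
proof -
  let ?f = "\<lambda>m. cmod (1 - exp (2 * of_real pi * \<i> * m))"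
  have ne: "(sphere 0 (1/2) :: complex set) \<noteq> {}" by simp
  have co: "continuous_on (sphere 0 (1/2)) ?f" by (intro continuous_intros)
  obtain m0 where m0: "m0 \<in> sphere 0 (1/2)" "\<And>m. m \<in> sphere 0 (1/2) \<Longrightarrow> ?f m0 \<le> ?f m"
    using continuous_attains_inf[OF compact_sphere ne co] by blast
  have "exp (2 * of_real pi * \<i> * m0) \<noteq> 1"
  proof
    assume "exp (2 * of_real pi * \<i> * m0) = 1"
    then obtain k :: int where k: "Im m0 = 0" "2 * pi * Re m0 = of_int (2 * k) * pi"
      by (auto simp: exp_eq_1)
    then have "m0 = of_int k" by (auto simp: complex_eq_iff)
    moreover have "cmod m0 = 1/2" using m0(1) by simp
    ultimately have "\<bar>real_of_int k\<bar> = 1/2" by (simp only: norm_of_int)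
    then have "2 * \<bar>real_of_int k\<bar> = 1" by (simp only:)
    then have "real_of_int (2 * \<bar>k\<bar>) = real_of_int 1"
      by (simp only: of_int_mult of_int_abs of_int_numeral of_int_1)
    then have "2 * \<bar>k\<bar> = 1" by (simp only: of_int_eq_iff)
    then show False by presburger
  qed
  then have "?f m0 > 0" by simp
  moreover have "?f m0 \<le> cmod (1 - (exp (\<i> * l * of_real pi))\<^sup>2)" if "cmod (l - of_int n) = 1/2" for n l
  proof -
    have "(exp (\<i> * l * of_real pi))\<^sup>2 = exp (2 * (\<i> * l * of_real pi))"
      by (rule exp_double[symmetric])
    also have "2 * (\<i> * l * of_real pi) = 2 * of_real pi * \<i> * (l - of_int n) + 2 * of_real pi * \<i> * of_int n"
      by (simp add: algebra_simps)
    also have "exp \<dots> = exp (2 * of_real pi * \<i> * (l - of_int n)) * exp (2 * of_real pi * \<i> * of_int n)"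
      by (rule exp_add)
    also have "exp (2 * of_real pi * \<i> * of_int n) = 1"
      unfolding exp_eq_1 by (auto intro!: exI[of _ n])
    finally show ?thesis using m0(2)[of "l - of_int n"] that by simp
  qed
  ultimately show ?thesis by (rule that)
qed

text \<open>With Z = exp (i l pi), solving the boundary conditions for y(0) leads to the
  denominators 1 - Z, 1 + Z or 1 - Z^2. All are bounded away from 0 uniformly in n, which gives one
  \<open>M\<close> for all circles.\<close>

lemma dirac_bvp_exists:
  obtains M where "\<And>n l. cmod (l - of_int n) = 1/2 \<Longrightarrow> \<exists>m11 m12 m21 m22. \<forall>P Q.
      square_integrable P \<longrightarrow> square_integrable Q \<longrightarrow> dirac_bvp b l n m11 m12 m21 m22 M P Q"
proof -
  obtain c where c: "c > 0" "\<And>n l. cmod (l - of_int n) = 1/2 \<Longrightarrow> c \<le> cmod (1 - (exp (\<i> * l * of_real pi))\<^sup>2)"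
    by (rule norm_one_minus_exp_ge) (erule that, blast)
  define E where "E = exp (pi / 2)"
  have E: "1 \<le> E" by (simp add: E_def)
  \<comment> \<open>Numerators are at most E^2 in modulus, denominators at least c / (1 +
    E).\<close>
  define M where "M = E * E * (1 + E) / c"
  have "\<exists>m11 m12 m21 m22. \<forall>P Q. square_integrable P \<longrightarrow> square_integrable Q \<longrightarrow> dirac_bvp b l n m11 m12 m21 m22 M P Q"
    if l: "cmod (l - of_int n) = 1/2" for n l
  proof -
    define Z where "Z = exp (\<i> * l * of_real pi)"
    have Z0: "Z \<noteq> 0" by (simp add: Z_def)
    have Zi: "exp (- (\<i> * l) * of_real pi) = inverse Z" by (simp add: Z_def exp_minus)
    have "\<bar>Im l\<bar> \<le> 1/2" using abs_Im_le_cmod[of "l - of_int n"] l by simp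
    from norm_exp_imaginary_le(1)[OF this, of pi] have ZE: "cmod Z \<le> E" by (simp add: Z_def E_def)
    have c2: "c \<le> cmod (1 - Z\<^sup>2)" unfolding Z_def by (rule c(2)[OF l])
    \<comment> \<open>A lower bound for the product and an upper bound for one factor give a lower
      bound for the other factor.\<close>
    have "cmod (1 - Z\<^sup>2) = cmod (1 - Z) * cmod (1 + Z)"
      unfolding norm_mult[symmetric] by (simp add: power2_eq_square algebra_simps)
    moreover have pm: "cmod (1 - Z) \<le> 1 + E" "cmod (1 + Z) \<le> 1 + E"
      using ZE norm_triangle_ineq4[of 1 Z] norm_triangle_ineq[of 1 Z] by auto
    ultimately have "c \<le> cmod (1 - Z) * (1 + E)" "c \<le> (1 + E) * cmod (1 + Z)"
      using c2 mult_left_mono[OF pm(2), of "cmod (1 - Z)"] mult_right_mono[OF pm(1), of "cmod (1 + Z)"] by auto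
    then have low: "c / (1 + E) \<le> cmod (1 - Z)" "c / (1 + E) \<le> cmod (1 + Z)"
      using E by (auto simp: divide_le_eq mult.commute)
    have cE: "c / (1 + E) > 0" using c E by auto
    have low3: "c / (1 + E) \<le> cmod (1 - Z\<^sup>2)"
      using c2 c E by (intro order_trans[OF _ c2]) (simp add: divide_le_eq)
    have quot: "cmod (a / d) \<le> M" if "cmod a \<le> E * E" "c / (1 + E) \<le> cmod d" for a d
    proof -
      have "cmod (a / d) \<le> (E * E) / (c / (1 + E))"
        unfolding norm_divide using that cE by (intro frac_le) auto
      then show ?thesis by (simp add: M_def)
    qed
    have nz: "1 - Z \<noteq> 0" "1 + Z \<noteq> 0" "1 - Z\<^sup>2 \<noteq> 0" using low low3 cE by auto
    have a: "cmod 1 \<le> E * E" "cmod Z \<le> E * E" "cmod (Z\<^sup>2) \<le> E * E" "cmod (-1) \<le> E * E" "cmod 0 \<le> E * E"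
      using ZE E mult_mono[of 1 E 1 E] mult_mono[of 1 E "cmod Z" E] mult_mono[of "cmod Z" E "cmod Z" E]
      by (auto simp: norm_mult power2_eq_square)
    note qs = quot[OF a(3)] quot[OF a(4)]
    have per: ?thesis if e: "e = 1 \<or> e = - 1"
      and bc: "\<And>y1 y2. satisfies_bc b y1 y2 \<longleftrightarrow> y1 0 = e * y1 pi \<and> y2 0 = e * y2 pi" for e :: complex
    proof -
      have "1 - e * Z = 1 - Z \<or> 1 - e * Z = 1 + Z" "cmod (e * Z) = cmod Z" using e by auto
      then have d: "1 - e * Z \<noteq> 0" "c / (1 + E) \<le> cmod (1 - e * Z)" "cmod (e * Z) \<le> E * E"
        using nz low a(2) by metis+
      \<comment> \<open>Periodic and antiperiodic conditions are the cases e = 1 and e = -1. The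
        zero coefficients are written as quotients so that \<open>quot\<close> bounds all four
        alike.\<close>
      have "dirac_bvp b l n (-1 / (1 - e * Z)) (0 / (1 - e * Z)) (0 / (1 - e * Z)) (e * Z / (1 - e * Z)) M P Q"
        if PQ: "square_integrable P" "square_integrable Q" for P Q
      proof
        fix y1 y2 :: "real \<Rightarrow> complex" and \<phi>1 \<phi>2
        assume y: "y1 pi = exp (- (\<i> * l) * of_real pi) * (y1 0 + \<phi>1)" "y2 pi = exp (\<i> * l * of_real pi) * (y2 0 + \<phi>2)"
        show "satisfies_bc b y1 y2 \<longleftrightarrow> y1 0 = (-1 / (1 - e * Z)) * \<phi>1 + (0 / (1 - e * Z)) * \<phi>2 \<and> y2 0 = (0 / (1 - e * Z)) * \<phi>1 + (e * Z / (1 - e * Z)) * \<phi>2"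
          unfolding bc y Zi Z_def[symmetric] by (rule disjE[OF e]) (use nz Z0 in \<open>auto simp: field_simps\<close>)
      qed (use l PQ quot[OF a(4) d(2)] quot[OF a(5) d(2)] quot[OF d(3,2)] in auto)
      then show ?thesis by blast
    qed
    show ?thesis
    proof (cases b)
      case Per_plus
      then show ?thesis by (intro per[of 1]) auto
    next
      case Per_minus
      then show ?thesis by (intro per[of "- 1"]) auto
    next
      case Dir
      have "dirac_bvp b l n (-1 / (1 - Z\<^sup>2)) (Z\<^sup>2 / (1 - Z\<^sup>2)) (-1 / (1 - Z\<^sup>2)) (Z\<^sup>2 / (1 - Z\<^sup>2)) M P Q"
        if PQ: "square_integrable P" "square_integrable Q" for P Q
      proof
        fix y1 y2 :: "real \<Rightarrow> complex" and \<phi>1 \<phi>2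
        assume y: "y1 pi = exp (- (\<i> * l) * of_real pi) * (y1 0 + \<phi>1)" "y2 pi = exp (\<i> * l * of_real pi) * (y2 0 + \<phi>2)"
        have "inverse Z * (s + \<phi>1) = Z * (s + \<phi>2) \<longleftrightarrow> s = (-1 / (1 - Z\<^sup>2)) * \<phi>1 + (Z\<^sup>2 / (1 - Z\<^sup>2)) * \<phi>2" for s
        proof -
          have "inverse Z * (s + \<phi>1) = Z * (s + \<phi>2) \<longleftrightarrow> s + \<phi>1 = Z\<^sup>2 * (s + \<phi>2)"
            using Z0 by (simp add: field_simps power2_eq_square)
          also have "\<dots> \<longleftrightarrow> s * (1 - Z\<^sup>2) = Z\<^sup>2 * \<phi>2 - \<phi>1"
            by (auto simp: algebra_simps)
          also have "\<dots> \<longleftrightarrow> s = (Z\<^sup>2 * \<phi>2 - \<phi>1) / (1 - Z\<^sup>2)"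
            using nz(3) by (simp add: eq_divide_eq)
          also have "(Z\<^sup>2 * \<phi>2 - \<phi>1) / (1 - Z\<^sup>2) = (-1 / (1 - Z\<^sup>2)) * \<phi>1 + (Z\<^sup>2 / (1 - Z\<^sup>2)) * \<phi>2"
            by (simp add: diff_divide_distrib)
          finally show ?thesis .
        qed
        then show "satisfies_bc b y1 y2 \<longleftrightarrow> y1 0 = (-1 / (1 - Z\<^sup>2)) * \<phi>1 + (Z\<^sup>2 / (1 - Z\<^sup>2)) * \<phi>2 \<and>
            y2 0 = (-1 / (1 - Z\<^sup>2)) * \<phi>1 + (Z\<^sup>2 / (1 - Z\<^sup>2)) * \<phi>2"
          unfolding Dir satisfies_bc.simps y Zi Z_def[symmetric] by metis
      qed (use l PQ qs low3 in auto)
      then show ?thesis by blast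
    qed
  qed
  then show ?thesis by (rule that)
qed

section \<open>Summing the squares of the oscillating primitives over n\<close>

context dirac_bvp
begin

text \<open>The quadratic counterpart of \<open>\<beta>\<close>: in each of the three terms the sum
  over n acts on the square of \<open>B\<close> at a fixed point, where Bessel's inequality
  applies.\<close>

definition \<theta> :: real where
  "\<theta> = (B pi)\<^sup>2 + intB2 + intB2v"

lemma B2_abs_int:
  "abs_int (\<lambda>t. (B t)\<^sup>2)" "abs_int (\<lambda>t. (B t)\<^sup>2 * v t)"
  by (intro absolutely_integrable_continuous_real abs_int_mult_continuous continuous_intros
      B_continuous_on v_abs_int)+

lemma B2_int_nonneg: "0 \<le> intB2" "0 \<le> intB2v"
  by (intro integral_nonneg abs_int_imp_int B2_abs_int mult_nonneg_nonneg v_nonneg zero_le_power2)+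

lemma \<theta>_nonneg: "0 \<le> \<theta>" using B2_int_nonneg by (simp add: \<theta>_def)

text \<open>Cauchy-Schwarz for each integral in \<open>\<beta>\<close>. The 3 comes from the square
  of a sum of three terms, and 1 + pi + nv dominates each of the factors 1, pi and nv.\<close>

lemma \<beta>_square_le: "\<beta>\<^sup>2 \<le> 3 * (1 + pi + nv) * \<theta>"
proof -
  have three: "(a + b + c)\<^sup>2 \<le> 3 * (a\<^sup>2 + b\<^sup>2 + c\<^sup>2)" for a b c :: real
    using sum_squares_bound[of a b] sum_squares_bound[of a c] sum_squares_bound[of b c]
    by (simp add: power2_eq_square algebra_simps)
  have "(integral {0..pi} (\<lambda>t. B t * 1))\<^sup>2 \<le> intB2 * integral {0..pi} (\<lambda>t. 1\<^sup>2)"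
    by (rule integral_Cauchy_Schwarz) (use B2_abs_int B_abs_int in \<open>auto intro: abs_int_imp_int\<close>)
  then have 1: "(intB)\<^sup>2 \<le> pi * intB2" by (simp add: mult.commute)
  have vs: "sqrt (v t) * sqrt (v t) = v t" for t using v_nonneg by simp
  \<comment> \<open>Splitting off sqrt v yields \<open>intB2v\<close> and \<open>nv\<close>, for
    which integrability of \<open>v\<close> suffices.\<close>
  have "(integral {0..pi} (\<lambda>t. (B t * sqrt (v t)) * sqrt (v t)))\<^sup>2
      \<le> integral {0..pi} (\<lambda>t. (B t * sqrt (v t))\<^sup>2) * integral {0..pi} (\<lambda>t. (sqrt (v t))\<^sup>2)"
    by (rule integral_Cauchy_Schwarz)
      (use B2_abs_int Bv_abs_int v_abs_int v_nonneg in \<open>auto intro: abs_int_imp_int simp: power_mult_distrib vs mult.assoc\<close>)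
  then have 2: "(intBv)\<^sup>2 \<le> intB2v * nv"
    using v_nonneg by (simp add: nv_def mult.assoc power_mult_distrib)
  have "\<beta>\<^sup>2 \<le> 3 * ((B pi)\<^sup>2 + (intB)\<^sup>2 + (intBv)\<^sup>2)"
    unfolding \<beta>_def by (rule three)
  also have "\<dots> \<le> 3 * ((B pi)\<^sup>2 + pi * intB2 + intB2v * nv)"
    using 1 2 by simp
  also have "\<dots> \<le> 3 * ((1 + pi + nv) * (B pi)\<^sup>2 + (1 + pi + nv) * intB2
      + (1 + pi + nv) * intB2v)"
    using nv_nonneg B2_int_nonneg mult_right_mono[of 1 "1 + pi + nv" "(B pi)\<^sup>2"]
      mult_right_mono[of pi "1 + pi + nv" "intB2"]
      mult_right_mono[of nv "1 + pi + nv" "intB2v"]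
    by (simp add: mult.commute)
  also have "\<dots> = 3 * (1 + pi + nv) * \<theta>" by (simp add: \<theta>_def algebra_simps)
  finally show ?thesis .
qed

lemma B_square_le: "(B x)\<^sup>2 \<le> 2 * (cmod (HP x))\<^sup>2 + 2 * (cmod (HQ x))\<^sup>2"
  using sum_squares_bound[of "cmod (HP x)" "cmod (HQ x)"] by (simp add: B_def power2_sum)

end

lemma sum_weighted_square_integrals_le:
  fixes f :: "int \<Rightarrow> real \<Rightarrow> real" and v :: "real \<Rightarrow> real"
  assumes A: "finite A" and f: "\<And>n. continuous_on {0..pi} (f n)"
    and v: "abs_int v" "\<And>t. 0 \<le> v t"
    and C: "\<And>x. x \<in> {0..pi} \<Longrightarrow> (\<Sum>n\<in>A. (f n x)\<^sup>2) \<le> C"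
  shows "(\<Sum>n\<in>A. (f n pi)\<^sup>2 + integral {0..pi} (\<lambda>t. (f n t)\<^sup>2) + integral {0..pi} (\<lambda>t. (f n t)\<^sup>2 * v t))
    \<le> C * (1 + pi + integral {0..pi} v)"
proof -
  note int = absolutely_integrable_on_def[THEN iffD1, THEN conjunct1]
  have 1: "(\<lambda>t. (f n t)\<^sup>2) integrable_on {0..pi}" for n
    by (intro integrable_continuous_real continuous_intros f)
  have 2: "(\<lambda>t. (f n t)\<^sup>2 * v t) integrable_on {0..pi}" for n
    by (intro int abs_int_mult_continuous continuous_intros f v)
  have "(\<Sum>n\<in>A. integral {0..pi} (\<lambda>t. (f n t)\<^sup>2)) = integral {0..pi} (\<lambda>t. \<Sum>n\<in>A. (f n t)\<^sup>2)"
    by (rule integral_sum[symmetric, OF A 1])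
  also have "\<dots> \<le> integral {0..pi} (\<lambda>t. C)"
    by (intro integral_le integrable_sum A 1 C) auto
  finally have i1: "(\<Sum>n\<in>A. integral {0..pi} (\<lambda>t. (f n t)\<^sup>2)) \<le> C * pi" by (simp add: mult.commute)
  have "(\<Sum>n\<in>A. integral {0..pi} (\<lambda>t. (f n t)\<^sup>2 * v t)) = integral {0..pi} (\<lambda>t. \<Sum>n\<in>A. (f n t)\<^sup>2 * v t)"
    by (rule integral_sum[symmetric, OF A 2])
  also have "\<dots> \<le> integral {0..pi} (\<lambda>t. C * v t)"
  proof (intro integral_le integrable_sum A 2)
    show "(\<lambda>t. C * v t) integrable_on {0..pi}" by (intro int abs_int_cmult v)
    show "(\<Sum>n\<in>A. (f n t)\<^sup>2 * v t) \<le> C * v t" if "t \<in> {0..pi}" for t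
      unfolding sum_distrib_right[symmetric] by (intro mult_right_mono C that v)
  qed
  finally have i2: "(\<Sum>n\<in>A. integral {0..pi} (\<lambda>t. (f n t)\<^sup>2 * v t)) \<le> C * integral {0..pi} v" by simp
  have "(\<Sum>n\<in>A. (f n pi)\<^sup>2) \<le> C" by (rule C) simp
  with i1 i2 show ?thesis by (simp add: sum.distrib algebra_simps)
qed

lemma sum_\<theta>_le:
  assumes bvp: "\<And>n. \<exists>l m11 m12 m21 m22. dirac_bvp b l n m11 m12 m21 m22 M P Q"
    and A: "finite A"
  shows "(\<Sum>n\<in>A. dirac_bvp.\<theta> n P Q) \<le>
    2 * pi * (integral {0..pi} (\<lambda>t. (cmod (P t))\<^sup>2) + integral {0..pi} (\<lambda>t. (cmod (Q t))\<^sup>2)) * (1 + pi + dirac_bvp.nv P Q)"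
proof -
  \<comment> \<open>\<open>B\<close>, \<open>HP\<close> and \<open>HQ\<close> depend on n, P and Q
    only, so any admissible l and coefficients give the required instance for each n.\<close>
  obtain l m11 m12 m21 m22 where "\<And>n. dirac_bvp b (l n) n (m11 n) (m12 n) (m21 n) (m22 n) M P Q"
    using bvp by metis
  then interpret dirac_bvp b "l n" n "m11 n" "m12 n" "m21 n" "m22 n" M P Q for n .
  have "(\<Sum>n\<in>A. (B n x)\<^sup>2) \<le> 2 * pi * (integral {0..pi} (\<lambda>t. (cmod (P t))\<^sup>2) + integral {0..pi} (\<lambda>t. (cmod (Q t))\<^sup>2))"
    if x: "x \<in> {0..pi}" for x
  proof -
    have "(\<Sum>n\<in>A. (B n x)\<^sup>2) \<le> (\<Sum>n\<in>A. 2 * (cmod (HP n x))\<^sup>2 + 2 * (cmod (HQ n x))\<^sup>2)"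
      by (intro sum_mono B_square_le)
    also have "\<dots> = 2 * (\<Sum>n\<in>A. (cmod (HP n x))\<^sup>2) + 2 * (\<Sum>n\<in>A. (cmod (HQ n x))\<^sup>2)"
      by (simp add: sum.distrib sum_distrib_left)
    also have "(\<Sum>n\<in>A. (cmod (HP n x))\<^sup>2) \<le> pi * integral {0..pi} (\<lambda>t. (cmod (P t))\<^sup>2)"
      unfolding HP_def by (rule Bessel_initial_segment[OF A P x])
    \<comment> \<open>\<open>HQ\<close> carries the frequency -2 n; reflecting the index set brings
      it to the form of Bessel's inequality.\<close>
    also have "(\<Sum>n\<in>A. (cmod (HQ n x))\<^sup>2)
        = (\<Sum>n\<in>uminus ` A. (cmod (integral {0..x} (\<lambda>t. exp (2 * \<i> * of_int n * of_real t) * Q t)))\<^sup>2)"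
      by (subst sum.reindex) (auto simp: HQ_def)
    also have "\<dots> \<le> pi * integral {0..pi} (\<lambda>t. (cmod (Q t))\<^sup>2)"
      by (rule Bessel_initial_segment[OF _ Q x]) (simp add: A)
    finally show ?thesis by (simp add: algebra_simps)
  qed
  from sum_weighted_square_integrals_le[OF A B_continuous_on v_abs_int v_nonneg this]
  show ?thesis by (simp add: \<theta>_def nv_def)
qed

section \<open>Resolvents\<close>

lemma satisfies_bc_cong:
  assumes "f1 0 = g1 0" "f1 pi = g1 pi" "f2 0 = g2 0" "f2 pi = g2 pi"
  shows "satisfies_bc b f1 f2 \<longleftrightarrow> satisfies_bc b g1 g2"
  using assms by (cases b) auto

abbreviation L2_of :: "(real \<Rightarrow> complex \<times> complex) \<Rightarrow> L2_space" where
  "L2_of y \<equiv> L2_class (\<lambda>t. fst (y t)) (\<lambda>t. snd (y t))"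

lemma si_components:
  assumes "square_integrable f"
  shows "square_integrable (\<lambda>t. fst (f t :: complex \<times> complex))" "square_integrable (\<lambda>t. snd (f t))"
  using assms square_integrable_Pair_iff[of "\<lambda>t. fst (f t)" "\<lambda>t. snd (f t)"] by simp_all

lemma norm_L2_of_square:
  assumes f: "square_integrable f"
  shows "pi * (norm (L2_of f))\<^sup>2 = integral {0..pi} (\<lambda>t. (norm (f t))\<^sup>2)"
proof -
  have "(\<lambda>t. (norm (f t))\<^sup>2) = (\<lambda>t. (cmod (fst (f t)))\<^sup>2 + (cmod (snd (f t)))\<^sup>2)"
    by (simp add: fun_eq_iff norm_prod_def)
  then have "integral {0..pi} (\<lambda>t. (norm (f t))\<^sup>2)
      = integral {0..pi} (\<lambda>t. (cmod (fst (f t)))\<^sup>2) + integral {0..pi} (\<lambda>t. (cmod (snd (f t)))\<^sup>2)"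
    using si_components[OF f] by (simp add: integral_add square_integrableD(5))
  then show ?thesis
    using norm_L2_class[OF si_components[OF f] si_components[OF f]] by simp
qed

lemma L2_of_add:
  assumes "square_integrable f" "square_integrable g"
  shows "L2_of f + L2_of g = L2_of (\<lambda>t. f t + g t)"
  using L2_class_add[OF si_components[OF assms(1)] si_components[OF assms(2)]] by simp

lemma L2_of_scaleR:
  assumes "square_integrable f" shows "r *\<^sub>R L2_of f = L2_of (\<lambda>t. r *\<^sub>R f t)"
  using assms by (simp add: L2_class_def scaleR_L2_space.abs_eq L2_equiv_refl_iff scaleR_prod_def)

lemma norm_L2_of_le:
  assumes y: "continuous_on {0..pi} y" and le: "\<And>t. t \<in> {0..pi} \<Longrightarrow> norm (y t) \<le> Y"
  shows "norm (L2_of y) \<le> 2 * Y"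
proof -
  have Y: "0 \<le> Y" by (rule order_trans[OF norm_ge_zero le[of 0]]) simp
  have "(norm (L2_of y))\<^sup>2 \<le> integral {0..pi} (\<lambda>t. Y\<^sup>2)"
    by (intro norm_L2_class_le si_components square_integrable_continuous y integrable_const_ivl
        order_trans[OF norm_fst_snd_le(1) le] order_trans[OF norm_fst_snd_le(2) le]) simp_all
  also have "\<dots> = pi * Y\<^sup>2" by simp
  also have "\<dots> \<le> 4 * Y\<^sup>2" using pi_less_4 by (intro mult_right_mono) auto
  also have "\<dots> = (2 * Y)\<^sup>2" by (simp add: power_mult_distrib)
  finally show ?thesis by (rule power2_le_imp_le) (use Y in simp)
qed

section \<open>Solutions of the integral equation as values of the resolvent\<close>

context dirac_bvp
begin

abbreviation D :: "L2_space set" where "D \<equiv> dirac_domain b"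

abbreviation G :: "L2_space \<Rightarrow> L2_space" where "G \<equiv> (\<lambda>F. scaleC_L2 l F - dirac_op P Q F)"

lemma V_square_integrable:
  assumes "continuous_on {0..pi} y" shows "square_integrable (V y)"
  unfolding V_def[abs_def] square_integrable_Pair_iff
  by (intro conjI square_integrable_mult_continuous P Q continuous_intros assms)

text \<open>The derivatives can be read off the integral equation: they combine the continuous y
  with f and V y, which are square integrable.\<close>

lemma solution_imp_sobolev1:
  assumes f: "square_integrable f" and y: "solution f y"
  shows "ac_primitive 0 pi (\<lambda>x. - (\<i> * l) * fst (y x) + \<i> * fst (f x + V y x)) (\<lambda>x. fst (y x))"
    "ac_primitive 0 pi (\<lambda>x. \<i> * l * snd (y x) + - \<i> * snd (f x + V y x)) (\<lambda>x. snd (y x))"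
    "sobolev1 (\<lambda>t. fst (y t))" "sobolev1 (\<lambda>t. snd (y t))"
    "satisfies_bc b (\<lambda>t. fst (y t)) (\<lambda>t. snd (y t))"
proof -
  have c: "continuous_on {0..pi} y" using y by (simp add: solution_def)
  define g where "g t = f t + V y t" for t
  have g: "square_integrable g"
    unfolding g_def[abs_def] by (intro square_integrable_add f V_square_integrable c)
  have yS: "y x = S g x" if "x \<in> {0..pi}" for x
    using y that unfolding solution_def g_def[abs_def] by blast
  note s = S_solves[OF square_integrableD(1)[OF g]]
  have "ac_primitive 0 pi (\<lambda>x. - (\<i> * l) * fst (S g x) + \<i> * fst (g x)) (\<lambda>x. fst (y x))"
    by (rule ac_primitive_cong[OF s(1)]) (simp_all add: yS)
  then show 1: "ac_primitive 0 pi (\<lambda>x. - (\<i> * l) * fst (y x) + \<i> * fst (f x + V y x)) (\<lambda>x. fst (y x))"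
    by (rule ac_primitive_spike[where N = "{}"]) (simp_all add: yS g_def)
  have "ac_primitive 0 pi (\<lambda>x. \<i> * l * snd (S g x) + - \<i> * snd (g x)) (\<lambda>x. snd (y x))"
    by (rule ac_primitive_cong[OF s(2)]) (simp_all add: yS)
  then show 2: "ac_primitive 0 pi (\<lambda>x. \<i> * l * snd (y x) + - \<i> * snd (f x + V y x)) (\<lambda>x. snd (y x))"
    by (rule ac_primitive_spike[where N = "{}"]) (simp_all add: yS g_def)
  show "sobolev1 (\<lambda>t. fst (y t))"
    by (rule sobolev1I[OF 1])
      (intro square_integrable_add square_integrable_mult_continuous(1) square_integrable_continuous
        si_components g[unfolded g_def[abs_def]] continuous_intros c)
  show "sobolev1 (\<lambda>t. snd (y t))"
    by (rule sobolev1I[OF 2])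
      (intro square_integrable_add square_integrable_mult_continuous(1) square_integrable_continuous
        si_components g[unfolded g_def[abs_def]] continuous_intros c)
  show "satisfies_bc b (\<lambda>t. fst (y t)) (\<lambda>t. snd (y t))"
    using s(3) by (rule satisfies_bc_cong[THEN iffD1, rotated -1]) (simp_all add: yS)
qed

text \<open>Equality of L2 classes means a differential equation off a null set. As
  \<open>ac_primitive\<close> does not see null sets, this together with the boundary conditions
  says the same as the integral equation.\<close>

lemma dirac_equation_iff:
  assumes y: "sobolev1 y1" "sobolev1 y2" "satisfies_bc b y1 y2" and f: "square_integrable f"
  shows "G (L2_class y1 y2) = L2_of f \<longleftrightarrow> solution f (\<lambda>t. (y1 t, y2 t))"
proof -
  let ?d = "\<lambda>y x. vector_derivative y (at x within {0..pi})"
  let ?y = "\<lambda>t. (y1 t, y2 t)"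
  let ?E = "\<exists>N. negligible N \<and> (\<forall>x\<in>{0..pi} - N.
      l * y1 x - (\<i> * ?d y1 x + P x * y2 x) = fst (f x) \<and> l * y2 x - (- \<i> * ?d y2 x + Q x * y1 x) = snd (f x))"
  note si = square_integrable_add square_integrable_mult_continuous sobolev1_has_ac_primitive(2)
        sobolev1_continuous_on continuous_intros y P Q sobolev1_square_integrable
  have a: "square_integrable (\<lambda>x. l * y1 x)" "square_integrable (\<lambda>x. l * y2 x)"
    "square_integrable (\<lambda>x. \<i> * ?d y1 x + P x * y2 x)" "square_integrable (\<lambda>x. - \<i> * ?d y2 x + Q x * y1 x)"
    by (intro si)+
  have "G (L2_class y1 y2) = L2_class (\<lambda>x. l * y1 x - (\<i> * ?d y1 x + P x * y2 x)) (\<lambda>x. l * y2 x - (- \<i> * ?d y2 x + Q x * y1 x))"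
    unfolding dirac_op_L2_class[OF y(1,2) P Q] L2_class_diff[OF a, symmetric]
    using scaleC_L2_class[of y1 y2 y1 y2] y by (simp add: sobolev1_square_integrable)
  then have "G (L2_class y1 y2) = L2_of f \<longleftrightarrow> ?E"
    using a by (simp only:) (intro L2_class_eq_iff square_integrable_diff a si_components f)
  also have "\<dots> \<longleftrightarrow> solution f ?y"
  proof
    assume "?E"
    then obtain N where N: "negligible N" "\<And>x. x \<in> {0..pi} - N \<Longrightarrow> fst (f x) = l * y1 x - (\<i> * ?d y1 x + P x * y2 x)"
      "\<And>x. x \<in> {0..pi} - N \<Longrightarrow> snd (f x) = l * y2 x - (- \<i> * ?d y2 x + Q x * y1 x)" by metis
    have c: "continuous_on {0..pi} ?y" by (intro continuous_on_Pair sobolev1_continuous_on y)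
    have 1: "ac_primitive 0 pi (\<lambda>x. - (\<i> * l) * y1 x + \<i> * fst (f x + V ?y x)) y1"
      by (rule ac_primitive_spike[OF sobolev1_has_ac_primitive(1)[OF y(1)] N(1)])
        (simp add: N(2) V_def algebra_simps)
    have 2: "ac_primitive 0 pi (\<lambda>x. \<i> * l * y2 x + - \<i> * snd (f x + V ?y x)) y2"
      by (rule ac_primitive_spike[OF sobolev1_has_ac_primitive(1)[OF y(2)] N(1)])
        (simp add: N(3) V_def algebra_simps)
    have "abs_int (\<lambda>x. f x + V ?y x)"
      by (intro square_integrableD square_integrable_add f V_square_integrable c)
    from S_unique[OF this 1 2 y(3)] c show "solution f ?y" by (simp add: solution_def)
  next
    assume "solution f ?y"
    note s = solution_imp_sobolev1[OF f this, simplified fst_conv snd_conv]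
    obtain N1 where N1: "negligible N1"
      "\<And>x. x \<in> {0..pi} - N1 \<Longrightarrow> ?d y1 x = - (\<i> * l) * y1 x + \<i> * fst (f x + V ?y x)"
      using ac_primitive_vector_derivative[OF s(1)] by metis
    obtain N2 where N2: "negligible N2"
      "\<And>x. x \<in> {0..pi} - N2 \<Longrightarrow> ?d y2 x = \<i> * l * y2 x + - \<i> * snd (f x + V ?y x)"
      using ac_primitive_vector_derivative[OF s(2)] by metis
    show "?E"
    proof (intro exI[of _ "N1 \<union> N2"] conjI ballI)
      fix x assume x: "x \<in> {0..pi} - (N1 \<union> N2)"
      have d: "?d y1 x = - (\<i> * l) * y1 x + \<i> * fst (f x + V ?y x)" "?d y2 x = \<i> * l * y2 x + - \<i> * snd (f x + V ?y x)"
        using N1(2) N2(2) x by auto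
      show "l * y1 x - (\<i> * ?d y1 x + P x * y2 x) = fst (f x)"
        "l * y2 x - (- \<i> * ?d y2 x + Q x * y1 x) = snd (f x)"
        unfolding d by (simp_all add: V_def algebra_simps)
    qed (use N1 N2 in auto)
  qed
  finally show ?thesis .
qed

lemma N_le_norm:
  assumes f: "square_integrable f" shows "N f \<le> pi * norm (L2_of f)"
proof -
  have "(integral {0..pi} (\<lambda>t. norm (f t) * 1))\<^sup>2 \<le> integral {0..pi} (\<lambda>t. (norm (f t))\<^sup>2) * integral {0..pi} (\<lambda>t. 1\<^sup>2)"
    by (rule integral_Cauchy_Schwarz) (use square_integrableD[OF f] in auto)
  then have "(N f)\<^sup>2 \<le> (pi * (norm (L2_of f))\<^sup>2) * pi"
    by (simp add: N_def norm_L2_of_square[OF f])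
  then have "(N f)\<^sup>2 \<le> (pi * norm (L2_of f))\<^sup>2" by (simp add: power2_eq_square mult_ac)
  then show ?thesis by (rule power2_le_imp_le) simp
qed

lemma integral_B_norm_le:
  assumes f: "square_integrable f"
  shows "integral {0..pi} (\<lambda>t. B t * norm (f t)) \<le> sqrt (intB2) * (pi * norm (L2_of f))"
proof -
  have "(integral {0..pi} (\<lambda>t. B t * norm (f t)))\<^sup>2 \<le> intB2 * integral {0..pi} (\<lambda>t. (norm (f t))\<^sup>2)"
    by (intro integral_Cauchy_Schwarz abs_int_imp_int abs_int_mult_continuous B_continuous_on
        B2_abs_int square_integrableD f)
  also have "\<dots> \<le> intB2 * (pi * norm (L2_of f))\<^sup>2"
  proof (intro mult_left_mono B2_int_nonneg)
    \<comment> \<open>Enlarges the constant so that pi times the norm appears, as in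
      \<open>N_le_norm\<close>.\<close>
    have "pi * 1 \<le> pi * pi" using pi_gt3 by (intro mult_left_mono) auto
    then have "pi * 1 * (norm (L2_of f))\<^sup>2 \<le> pi * pi * (norm (L2_of f))\<^sup>2" by (rule mult_right_mono) simp
    then show "integral {0..pi} (\<lambda>t. (norm (f t))\<^sup>2) \<le> (pi * norm (L2_of f))\<^sup>2"
      unfolding norm_L2_of_square[OF f, symmetric] by (simp add: power2_eq_square algebra_simps)
  qed
  also have "\<dots> = (sqrt (intB2) * (pi * norm (L2_of f)))\<^sup>2"
    using B2_int_nonneg by (simp add: power_mult_distrib)
  finally show ?thesis by (rule power2_le_imp_le) (simp add: B2_int_nonneg)
qed

lemma S_scaleR:
  assumes x: "x \<in> {0..pi}"
  shows "S (\<lambda>x. r *\<^sub>R g x) x = r *\<^sub>R S g x"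
proof -
  have *: "(\<lambda>t. a t * (c * fst (r *\<^sub>R g t))) = (\<lambda>t. of_real r * (a t * (c * fst (g t))))"
    "(\<lambda>t. a t * (c * snd (r *\<^sub>R g t))) = (\<lambda>t. of_real r * (a t * (c * snd (g t))))" for a :: "real \<Rightarrow> complex" and c
    by (simp_all add: fun_eq_iff scaleR_conv_of_real)
  have eq: "\<Phi>1 (\<lambda>x. r *\<^sub>R g x) y = of_real r * \<Phi>1 g y" "\<Phi>2 (\<lambda>x. r *\<^sub>R g x) y = of_real r * \<Phi>2 g y" for y
    unfolding \<Phi>1_def \<Phi>2_def * by simp_all
  show ?thesis unfolding S_def u1_def u2_def eq by (simp add: scaleR_conv_of_real algebra_simps)
qed

lemma solution_add:
  assumes f: "abs_int f" and g: "abs_int g"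
    and y: "solution f y" and z: "solution g z"
  shows "solution (\<lambda>t. f t + g t) (\<lambda>t. y t + z t)"
proof -
  have V: "V (\<lambda>t. y t + z t) = (\<lambda>t. V y t + V z t)" by (simp add: V_def fun_eq_iff algebra_simps)
  have c: "continuous_on {0..pi} y" "continuous_on {0..pi} z" using y z by (auto simp: solution_def)
  have s: "S (\<lambda>t. (f t + V y t) + (g t + V z t)) x = S (\<lambda>t. f t + V y t) x + S (\<lambda>t. g t + V z t) x" if "x \<in> {0..pi}" for x
    by (intro S_add that set_integral_add f g V_abs_int c)
  have "(\<lambda>t. f t + g t + V (\<lambda>t. y t + z t) t) = (\<lambda>t. (f t + V y t) + (g t + V z t))"
    by (simp add: V fun_eq_iff algebra_simps)
  then show ?thesis using y z s c by (auto simp: solution_def intro!: continuous_on_add)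
qed

lemma solution_scaleR:
  assumes y: "solution f y"
  shows "solution (\<lambda>t. r *\<^sub>R f t) (\<lambda>t. r *\<^sub>R y t)"
proof -
  have "V (\<lambda>t. r *\<^sub>R y t) = (\<lambda>t. r *\<^sub>R V y t)" by (simp add: V_def fun_eq_iff)
  then have "(\<lambda>t. r *\<^sub>R f t + V (\<lambda>t. r *\<^sub>R y t) t) = (\<lambda>t. r *\<^sub>R (f t + V y t))"
    by (simp add: fun_eq_iff scaleR_add_right)
  then show ?thesis using y by (auto simp: solution_def S_scaleR intro!: continuous_on_scaleR)
qed

context
  assumes \<kappa>: "\<kappa> \<le> 1/2"
begin

text \<open>Through \<open>dirac_equation_iff\<close>, injectivity is uniqueness of solutions of the
  integral equation and surjectivity is their existence.\<close>

lemma G_bij_betw: "bij_betw G D UNIV"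
  and inv_into_G: "square_integrable f \<Longrightarrow> solution f y \<Longrightarrow> inv_into D G (L2_of f) = L2_of y"
proof -
  have D: "L2_of y \<in> D \<and> G (L2_of y) = L2_of f" if f: "square_integrable f" and y: "solution f y" for f y
  proof -
    note s = solution_imp_sobolev1[OF f y]
    have "L2_of y \<in> D" unfolding dirac_domain_def using s(3-5) by blast
    moreover have "G (L2_of y) = L2_of f"
      using dirac_equation_iff[OF s(3-5) f] y by simp
    ultimately show ?thesis by blast
  qed
  have inj: "inj_on G D"
  proof (rule inj_onI)
    fix Y Z assume Y: "Y \<in> D" and Z: "Z \<in> D" and eq: "G Y = G Z"
    obtain y1 y2 where y: "sobolev1 y1" "sobolev1 y2" "satisfies_bc b y1 y2" "Y = L2_class y1 y2"
      using Y unfolding dirac_domain_def by blast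
    obtain z1 z2 where z: "sobolev1 z1" "sobolev1 z2" "satisfies_bc b z1 z2" "Z = L2_class z1 z2"
      using Z unfolding dirac_domain_def by blast
    \<comment> \<open>One representative of the common image, so that both functions solve the
      equation with literally the same right hand side.\<close>
    obtain f1 f2 where f: "square_integrable f1" "square_integrable f2" "G Y = L2_class f1 f2"
      by (rule L2_class_exhaust)
    let ?f = "\<lambda>t. (f1 t, f2 t)"
    have sf: "square_integrable ?f" using f by (simp add: square_integrable_Pair_iff)
    have "solution ?f (\<lambda>t. (y1 t, y2 t))" "solution ?f (\<lambda>t. (z1 t, z2 t))"
      using dirac_equation_iff[OF y(1-3) sf] dirac_equation_iff[OF z(1-3) sf] f(3) eq y(4) z(4) by auto
    from solution_unique[OF \<kappa> square_integrableD(1)[OF sf] this]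
    have "y1 x = z1 x \<and> y2 x = z2 x" if "x \<in> {0..pi}" for x using that by auto
    then show "Y = Z"
      unfolding y(4) z(4)
      using L2_class_eq_iff[OF sobolev1_square_integrable[OF y(1)] sobolev1_square_integrable[OF y(2)]
          sobolev1_square_integrable[OF z(1)] sobolev1_square_integrable[OF z(2)]] negligible_empty by blast
  qed
  have "G ` D = UNIV"
  proof (rule equalityI[OF subset_UNIV], rule subsetI)
    fix F :: L2_space
    obtain f1 f2 where f: "square_integrable f1" "square_integrable f2" "F = L2_class f1 f2"
      by (rule L2_class_exhaust)
    let ?f = "\<lambda>t. (f1 t, f2 t)"
    have sf: "square_integrable ?f" using f by (simp add: square_integrable_Pair_iff)
    obtain y where "solution ?f y" by (rule solution_exists[OF \<kappa> square_integrableD(1)[OF sf]])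
    from D[OF sf this] have "L2_of y \<in> D" "F = G (L2_of y)" using f(3) by simp_all
    then show "F \<in> G ` D" by blast
  qed
  with inj show "bij_betw G D UNIV" by (simp add: bij_betw_def)
  show "inv_into D G (L2_of f) = L2_of y" if f: "square_integrable f" and y: "solution f y" for f y
    using D[OF f y] inv_into_f_f[OF inj, of "L2_of y"] by simp
qed

lemma solutionE:
  obtains f y where "square_integrable f" "F = L2_of f" "solution f y" "inv_into D G F = L2_of y"
proof -
  obtain f1 f2 where f: "square_integrable f1" "square_integrable f2" "F = L2_class f1 f2"
    by (rule L2_class_exhaust)
  let ?f = "\<lambda>t. (f1 t, f2 t)"
  have sf: "square_integrable ?f" using f by (simp add: square_integrable_Pair_iff)
  obtain y where y: "solution ?f y" by (rule solution_exists[OF \<kappa> square_integrableD(1)[OF sf]])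
  from that[OF sf _ y] inv_into_G[OF sf y] f(3) show ?thesis by simp
qed

lemma norm_inv_into_G_le: "norm (inv_into D G F) \<le> norm F * (2 * L * pi)"
proof -
  obtain f y where *: "square_integrable f" "F = L2_of f" "solution f y" "inv_into D G F = L2_of y"
    by (rule solutionE)
  have L0: "0 \<le> L" unfolding L_def using K_ge nv_nonneg by auto
  have "norm (L2_of y) \<le> 2 * (L * (pi * norm (L2_of f)))"
  proof (rule norm_L2_of_le)
    show "continuous_on {0..pi} y" using *(3) by (simp add: solution_def)
    show "norm (y t) \<le> L * (pi * norm (L2_of f))" if "t \<in> {0..pi}" for t
      using norm_solution_le[OF \<kappa> square_integrableD(1)[OF *(1)] *(3) that]
        mult_left_mono[OF N_le_norm[OF *(1)] L0] by linarith
  qed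
  then show ?thesis using * by (simp add: mult_ac)
qed

lemma bounded_linear_inv_into_G: "bounded_linear (inv_into D G)"
proof (rule bounded_linear_intro)
  fix F H :: L2_space and r :: real
  obtain f y where f: "square_integrable f" "F = L2_of f" "solution f y" "inv_into D G F = L2_of y"
    by (rule solutionE)
  obtain h z where h: "square_integrable h" "H = L2_of h" "solution h z" "inv_into D G H = L2_of z"
    by (rule solutionE)
  have c: "square_integrable y" "square_integrable z"
    using f(3) h(3) by (auto simp: solution_def intro: square_integrable_continuous)
  show "inv_into D G (F + H) = inv_into D G F + inv_into D G H"
    unfolding f(4) h(4) L2_of_add[OF c]
    using inv_into_G[OF square_integrable_add[OF f(1) h(1)]
        solution_add[OF square_integrableD(1)[OF f(1)] square_integrableD(1)[OF h(1)] f(3) h(3)]]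
    unfolding f(2) h(2) L2_of_add[OF f(1) h(1)] .
  show "inv_into D G (r *\<^sub>R F) = r *\<^sub>R inv_into D G F"
    unfolding f(4) L2_of_scaleR[OF c(1)]
    using inv_into_G[OF square_integrable_scaleR[OF f(1)] solution_scaleR[OF f(3)]]
    unfolding f(2) L2_of_scaleR[OF f(1)] .
  show "norm (inv_into D G F) \<le> norm F * (2 * L * pi)" by (rule norm_inv_into_G_le)
qed

lemma in_resolvent_set: "l \<in> resolvent_set D (dirac_op P Q)"
  unfolding resolvent_set_def using G_bij_betw bounded_linear_inv_into_G by simp

lemma resolvent_apply: "blinfun_apply (resolvent D (dirac_op P Q) l) F = inv_into D G F"
  unfolding resolvent_def by (simp add: bounded_linear_Blinfun_apply bounded_linear_inv_into_G)

lemma norm_resolvent_le: "norm (resolvent D (dirac_op P Q) l) \<le> 2 * L * pi"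
proof (rule norm_blinfun_bound)
  show "0 \<le> 2 * L * pi" unfolding L_def using K_ge nv_nonneg by auto
  show "norm (blinfun_apply (resolvent D (dirac_op P Q) l) F) \<le> 2 * L * pi * norm F" for F
    using norm_inv_into_G_le[of F] by (simp add: resolvent_apply mult.commute)
qed

end

end

section \<open>Riesz projections\<close>

lemma scaleC_L2_add_left: "scaleC_L2 (c + d) F = scaleC_L2 c F + scaleC_L2 d F"
proof -
  obtain f1 f2 where f: "square_integrable f1" "square_integrable f2" "F = L2_class f1 f2"
    by (rule L2_class_exhaust)
  have s: "square_integrable (\<lambda>x. a * f1 x)" "square_integrable (\<lambda>x. a * f2 x)" for a
    by (intro square_integrable_mult_continuous f continuous_intros)+
  show ?thesis
    unfolding f(3) scaleC_L2_class[OF f(1,2) f(1,2)] L2_class_add[OF s s]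
    by (simp add: distrib_right)
qed

lemma scaleC_L2_scaleR_left: "scaleC_L2 (r *\<^sub>R c) F = r *\<^sub>R scaleC_L2 c F"
proof -
  obtain f1 f2 where f: "square_integrable f1" "square_integrable f2" "F = L2_class f1 f2"
    by (rule L2_class_exhaust)
  have s: "square_integrable (\<lambda>x. (c * f1 x, c * f2 x))"
    unfolding square_integrable_Pair_iff
    by (intro conjI square_integrable_mult_continuous f continuous_intros)
  show ?thesis
    unfolding f(3) scaleC_L2_class[OF f(1,2) f(1,2)]
    using s by (simp add: L2_class_def scaleR_L2_space.abs_eq L2_equiv_refl_iff)
qed

lemma norm_scaleC_op_le: "norm (scaleC_op c R) \<le> cmod c * norm R"
proof (rule norm_blinfun_bound)
  show "norm (blinfun_apply (scaleC_op c R) F) \<le> cmod c * norm R * norm F" for F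
    using mult_left_mono[OF norm_blinfun[of R F] norm_ge_zero[of c]]
    by (simp add: scaleC_op_apply norm_scaleC_L2 mult.assoc)
qed simp

lemma bounded_bilinear_scaleC_op: "bounded_bilinear scaleC_op"
proof
  fix c d :: complex and R R' :: "L2_space \<Rightarrow>\<^sub>L L2_space" and r :: real
  show "scaleC_op (c + d) R = scaleC_op c R + scaleC_op d R"
    by (rule blinfun_eqI) (simp add: scaleC_op_apply scaleC_L2_add_left blinfun.add_left)
  show "scaleC_op c (R + R') = scaleC_op c R + scaleC_op c R'"
    by (rule blinfun_eqI)
      (simp add: scaleC_op_apply blinfun.add_left linear_add[OF bounded_linear.linear[OF bounded_linear_scaleC_L2]])
  show "scaleC_op (r *\<^sub>R c) R = r *\<^sub>R scaleC_op c R"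
    by (rule blinfun_eqI) (simp add: scaleC_op_apply scaleC_L2_scaleR_left blinfun.scaleR_left del: scaleR_conv_of_real)
  show "scaleC_op c (r *\<^sub>R R) = r *\<^sub>R scaleC_op c R"
    by (rule blinfun_eqI)
      (simp add: scaleC_op_apply blinfun.scaleR_left linear_scale[OF bounded_linear.linear[OF bounded_linear_scaleC_L2]])
  show "\<exists>K. \<forall>c R. norm (scaleC_op c R) \<le> norm c * norm R * K"
    by (intro exI[of _ 1]) (simp add: norm_scaleC_op_le)
qed

text \<open>The first resolvent identity R(z) - R(w) = - (z - w) R(z) R(w), evaluated at a vector.
  It makes the resolvent Lipschitz wherever it is bounded, so that the contour integrals
  exist.\<close>

lemma resolvent_diff_norm_le:
  assumes z: "z \<in> resolvent_set D A" and w: "w \<in> resolvent_set D A"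
  shows "norm (resolvent D A z - resolvent D A w) \<le> norm (resolvent D A z) * norm (resolvent D A w) * cmod (z - w)"
proof (rule norm_blinfun_bound)
  fix F
  let ?G = "\<lambda>z F. scaleC_L2 z F - A F"
  have app: "blinfun_apply (resolvent D A u) H = inv_into D (?G u) H" if "u \<in> resolvent_set D A" for u H
    using that unfolding resolvent_def resolvent_set_def by (simp add: bounded_linear_Blinfun_apply)
  define y where "y = blinfun_apply (resolvent D A w) F"
  have yD: "y \<in> D" "?G w y = F"
    using w unfolding y_def app[OF w] resolvent_set_def bij_betw_def
    by (auto intro: inv_into_into f_inv_into_f)
  have "y = inv_into D (?G z) (?G z y)"
    using z yD(1) inv_into_f_f[of "?G z" D y] unfolding resolvent_set_def bij_betw_def by simp
  also have "?G z y = F + scaleC_L2 (z - w) y"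
    using yD(2) scaleC_L2_add_left[of w "z - w" y] by (simp add: algebra_simps)
  finally have "y - blinfun_apply (resolvent D A z) (scaleC_L2 (z - w) y) = blinfun_apply (resolvent D A z) F"
    unfolding app[OF z, symmetric] by (simp only: blinfun.add_right diff_eq_eq)
  note eq = this[symmetric]
  have "blinfun_apply (resolvent D A z - resolvent D A w) F = - blinfun_apply (resolvent D A z) (scaleC_L2 (z - w) y)"
    unfolding blinfun.diff_left y_def[symmetric] eq by simp
  then have "norm (blinfun_apply (resolvent D A z - resolvent D A w) F)
      \<le> norm (resolvent D A z) * (cmod (z - w) * norm y)"
    using norm_blinfun[of "resolvent D A z" "scaleC_L2 (z - w) y"] by (simp add: norm_scaleC_L2)
  also have "\<dots> \<le> norm (resolvent D A z) * (cmod (z - w) * (norm (resolvent D A w) * norm F))"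
    unfolding y_def by (intro mult_left_mono norm_blinfun) auto
  finally show "norm (blinfun_apply (resolvent D A z - resolvent D A w) F)
    \<le> norm (resolvent D A z) * norm (resolvent D A w) * cmod (z - w) * norm F"
    by (simp add: mult_ac)
qed simp

lemma continuous_on_resolvent:
  assumes sub: "X \<subseteq> resolvent_set D A" and C: "\<And>z. z \<in> X \<Longrightarrow> norm (resolvent D A z) \<le> C"
  shows "continuous_on X (resolvent D A)"
proof (rule lipschitz_on_continuous_on)
  show "(C * C)-lipschitz_on X (resolvent D A)"
  proof (rule lipschitz_onI)
    fix z w assume zw: "z \<in> X" "w \<in> X"
    have "norm (resolvent D A z) * norm (resolvent D A w) * cmod (z - w) \<le> C * C * cmod (z - w)"
      using C[OF zw(1)] C[OF zw(2)] order_trans[OF norm_ge_zero C[OF zw(1)]]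
      by (intro mult_right_mono mult_mono) auto
    then show "dist (resolvent D A z) (resolvent D A w) \<le> C * C * dist z w"
      unfolding dist_norm using resolvent_diff_norm_le[of z D A w] zw sub by (auto intro: order_trans)
  qed simp
qed

text \<open>Continuity makes both operator integrals exist, so their difference is a single
  integral; the circle has length pi, and pi e / (2 pi) = e / 2.\<close>

lemma norm_riesz_projection_diff_le:
  assumes R: "continuous_on (sphere (of_int n) (1/2)) (resolvent D A)"
    and R0: "continuous_on (sphere (of_int n) (1/2)) (resolvent D A0)"
    and le: "\<And>z. z \<in> sphere (of_int n) (1/2) \<Longrightarrow> norm (resolvent D A z - resolvent D A0 z) \<le> e"
  shows "norm (riesz_projection D A n - riesz_projection D A0 n) \<le> e / 2"
proof -
  let ?\<gamma> = "circlepath (of_int n) (1/2) :: real \<Rightarrow> complex"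
  \<comment> \<open>The derivative of the parametrised circle, 2 pi i exp (2 pi i t) times the
    radius 1/2.\<close>
  define d :: "real \<Rightarrow> complex" where "d t = of_real pi * \<i> * exp (2 * of_real pi * \<i> * of_real t)" for t
  have \<gamma>: "?\<gamma> t \<in> sphere (of_int n) (1/2)" if "t \<in> {0..1}" for t
    using that path_image_circlepath_nonneg[of "1/2" "of_int n :: complex"] unfolding path_image_def by auto
  have c\<gamma>: "continuous_on {0..1} ?\<gamma>"
    using path_circlepath[of "of_int n" "1/2"] by (simp add: path_def)
  have dn: "cmod (d t) = pi" for t by (simp add: d_def norm_mult norm_exp_eq_Re)
  have ci: "contour_integral_op ?\<gamma> X = integral {0..1} (\<lambda>t. scaleC_op (d t) (X (?\<gamma> t)))" for X
    unfolding contour_integral_op_def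
    by (rule integral_cong) (simp add: vector_derivative_circlepath01 d_def)
  have co: "continuous_on {0..1} (\<lambda>t. scaleC_op (d t) (X (?\<gamma> t)))"
    if "continuous_on (sphere (of_int n) (1/2)) X" for X
    by (intro bounded_bilinear.continuous_on[OF bounded_bilinear_scaleC_op] continuous_on_compose2[OF that c\<gamma>])
      (use \<gamma> in \<open>auto simp: d_def intro!: continuous_intros\<close>)
  let ?f = "\<lambda>t. scaleC_op (d t) (resolvent D A (?\<gamma> t))" and ?g = "\<lambda>t. scaleC_op (d t) (resolvent D A0 (?\<gamma> t))"
  let ?F = "contour_integral_op ?\<gamma> (resolvent D A)" and ?H = "contour_integral_op ?\<gamma> (resolvent D A0)"
  have "?F - ?H
      = integral {0..1} (\<lambda>t. ?f t - ?g t)"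
    unfolding ci by (intro integral_diff[symmetric] integrable_continuous_real co R R0)
  also have "norm \<dots> \<le> pi * e * (1 - 0)"
  proof (rule integral_bound)
    show "continuous_on {0..1} (\<lambda>t. ?f t - ?g t)"
      by (intro continuous_on_diff co R R0)
    show "norm (?f t - ?g t) \<le> pi * e"
      if "t \<in> {0..1}" for t
    proof -
      have "norm (?f t - ?g t)
          = norm (scaleC_op (d t) (resolvent D A (?\<gamma> t) - resolvent D A0 (?\<gamma> t)))"
        by (simp add: bounded_bilinear.diff_right[OF bounded_bilinear_scaleC_op])
      also have "\<dots> \<le> cmod (d t) * norm (resolvent D A (?\<gamma> t) - resolvent D A0 (?\<gamma> t))"
        by (rule norm_scaleC_op_le)
      also have "\<dots> \<le> pi * e" unfolding dn by (intro mult_left_mono le \<gamma> that) simp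
      finally show ?thesis .
    qed
  qed simp
  finally have int: "norm (?F - ?H) \<le> pi * e"
    by simp
  have "norm (riesz_projection D A n - riesz_projection D A0 n)
      = norm (scaleC_op (1 / (2 * of_real pi * \<i>)) (?F - ?H))"
    unfolding riesz_projection_def by (simp add: bounded_bilinear.diff_right[OF bounded_bilinear_scaleC_op])
  also have "\<dots> \<le> cmod (1 / (2 * of_real pi * \<i>)) * (pi * e)"
    by (intro order_trans[OF norm_scaleC_op_le] mult_left_mono int) simp
  also have "\<dots> = e / 2" by (simp add: norm_divide norm_mult)
  finally show ?thesis .
qed

section \<open>Comparison of the perturbed and the free resolvent\<close>

context dirac_bvp
begin

text \<open>The first factor is the square of the constant in the pointwise bound; the second comes
  from integrating 3 (B^2 + \<beta>^2 + intB2) over [0, pi] and bounding each term by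
  \<open>\<theta>\<close>.\<close>

definition C :: real where
  "C = (K * (1 + nv * L + L) * pi)\<^sup>2 * (3 * (1 + pi + 3 * pi * (1 + pi + nv)))"

text \<open>The coefficients m depend on l and the boundary conditions only, so the results on the
  perturbed operator also cover the free one; there \<open>V\<close> vanishes and the resolvent is
  given by \<open>S\<close>.\<close>

lemma free: "dirac_bvp b l n m11 m12 m21 m22 M (\<lambda>_. 0) (\<lambda>_. 0)"
  by unfold_locales (use l M bc_iff square_integrable_zero in auto)

lemma free_\<kappa>: "dirac_bvp.\<kappa> n M (\<lambda>_. 0) (\<lambda>_. 0) \<le> 1/2"
proof -
  interpret Z: dirac_bvp b l n m11 m12 m21 m22 M "\<lambda>_. 0" "\<lambda>_. 0" by (rule free)
  show ?thesis by (simp add: Z.\<kappa>_def Z.nv_def Z.v_def[abs_def])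
qed

lemma L_nonneg: "0 \<le> L" unfolding L_def using K_ge nv_nonneg by auto

text \<open>The pointwise bound for y - S f still contains \<open>B x\<close>; squaring and
  integrating in x turns it into \<open>intB2\<close>, so that the squared norm is at most a
  multiple of \<open>\<theta>\<close>.\<close>

lemma norm_resolvent_diff_free_le:
  assumes \<kappa>: "\<kappa> \<le> 1/2"
  shows "norm (resolvent D (dirac_op P Q) l - resolvent D (dirac_op (\<lambda>_. 0) (\<lambda>_. 0)) l) \<le> sqrt (C * \<theta>)"
proof (rule norm_blinfun_bound)
  show "0 \<le> sqrt (C * \<theta>)"
    using nv_nonneg \<theta>_nonneg by (simp add: C_def)
  interpret Z: dirac_bvp b l n m11 m12 m21 m22 M "\<lambda>_. 0" "\<lambda>_. 0" by (rule free)
  note Z\<kappa> = free_\<kappa>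
  fix F :: L2_space
  let ?R = "resolvent D (dirac_op P Q) l" and ?Rfree = "resolvent D (dirac_op (\<lambda>_. 0) (\<lambda>_. 0)) l"
  obtain f y where f: "square_integrable f" "F = L2_of f" and y: "solution f y" "inv_into D G F = L2_of y"
    by (rule solutionE[OF \<kappa>])
  note fi = square_integrableD(1)[OF f(1)]
  have Zsol: "Z.solution f (S f)"
    using S_continuous_on[OF fi] by (simp add: Z.solution_def Z.V_def zero_prod_def[symmetric])
  have R: "?R F = L2_of y" using resolvent_apply[OF \<kappa>] y(2) by simp
  have R0: "?Rfree F = L2_of (S f)"
    using Z.resolvent_apply[OF Z\<kappa>, of F] Z.inv_into_G[OF Z\<kappa> f(1) Zsol] f(2) by simp
  have cont: "continuous_on {0..pi} y" "continuous_on {0..pi} (S f)"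
    using y(1) S_continuous_on[OF fi] by (auto simp: solution_def)
  define a where "a = K * (1 + nv * L + L) * pi * norm F"
  define b2 where "b2 = sqrt (intB2)"
  have b2: "0 \<le> b2" "b2\<^sup>2 = intB2" using B2_int_nonneg by (auto simp: b2_def)
  have c1: "1 \<le> 1 + nv * L + L" using nv_nonneg L_nonneg by simp
  have ptw: "norm (y x - S f x) \<le> a * (B x + \<beta> + b2)" if x: "x \<in> {0..pi}" for x
  proof -
    have "norm (y x - S f x) \<le> K * ((1 + nv * L + L) * N f * (B x + \<beta>) + integral {0..pi} (\<lambda>t. B t * norm (f t)))"
      by (rule norm_solution_diff_le[OF \<kappa> fi y(1) x])
    also have "\<dots> \<le> K * ((1 + nv * L + L) * (pi * norm F) * (B x + \<beta>) + (1 + nv * L + L) * (b2 * (pi * norm F)))"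
    proof (intro mult_left_mono add_mono mult_right_mono K_ge)
      show "N f \<le> pi * norm F" unfolding f(2) by (rule N_le_norm[OF f(1)])
      have "integral {0..pi} (\<lambda>t. B t * norm (f t)) \<le> b2 * (pi * norm F)"
        unfolding f(2) b2_def by (rule integral_B_norm_le[OF f(1)])
      also have "\<dots> \<le> (1 + nv * L + L) * (b2 * (pi * norm F))"
        using mult_right_mono[OF c1, of "b2 * (pi * norm F)"] b2 by simp
      finally show "integral {0..pi} (\<lambda>t. B t * norm (f t)) \<le> (1 + nv * L + L) * (b2 * (pi * norm F))" .
    qed (use c1 B_nonneg[of x] \<beta>_nonneg in auto)
    also have "\<dots> = a * (B x + \<beta> + b2)" by (simp add: a_def algebra_simps)
    finally show ?thesis .
  qed
  have sq: "(\<lambda>t. (a * (B t + \<beta> + b2))\<^sup>2) integrable_on {0..pi}"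
    by (intro integrable_continuous_real continuous_intros B_continuous_on)
  have "blinfun_apply (?R - ?Rfree) F = L2_of (\<lambda>x. y x - S f x)"
    unfolding blinfun.diff_left R R0
    using L2_class_diff[OF si_components[OF square_integrable_continuous[OF cont(1)]]
        si_components[OF square_integrable_continuous[OF cont(2)]]] by simp
  then have "(norm (blinfun_apply (?R - ?Rfree) F))\<^sup>2 \<le> integral {0..pi} (\<lambda>t. (a * (B t + \<beta> + b2))\<^sup>2)"
    by (simp only:)
      (intro norm_L2_class_le si_components square_integrable_continuous continuous_on_diff cont sq
        order_trans[OF norm_fst_snd_le(1) ptw] order_trans[OF norm_fst_snd_le(2) ptw])
  also have "\<dots> \<le> integral {0..pi} (\<lambda>t. a\<^sup>2 * (3 * ((B t)\<^sup>2 + (\<beta>\<^sup>2 + b2\<^sup>2))))"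
  proof (rule integral_le[OF sq])
    show "(\<lambda>t. a\<^sup>2 * (3 * ((B t)\<^sup>2 + (\<beta>\<^sup>2 + b2\<^sup>2)))) integrable_on {0..pi}"
      by (intro integrable_continuous_real continuous_intros B_continuous_on)
    fix t
    have "(B t + \<beta> + b2)\<^sup>2 \<le> 3 * ((B t)\<^sup>2 + (\<beta>\<^sup>2 + b2\<^sup>2))"
      using sum_squares_bound[of "B t" \<beta>] sum_squares_bound[of "B t" b2] sum_squares_bound[of \<beta> b2]
      by (simp add: power2_eq_square algebra_simps)
    then show "(a * (B t + \<beta> + b2))\<^sup>2 \<le> a\<^sup>2 * (3 * ((B t)\<^sup>2 + (\<beta>\<^sup>2 + b2\<^sup>2)))"
      unfolding power_mult_distrib by (intro mult_left_mono) auto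
  qed
  also have "\<dots> = a\<^sup>2 * (3 * (intB2 + pi * (\<beta>\<^sup>2 + b2\<^sup>2)))"
    unfolding integral_mult_right
    using integral_add[OF abs_int_imp_int[OF B2_abs_int(1)] integrable_const_ivl[of "\<beta>\<^sup>2 + b2\<^sup>2" 0 pi]]
    by simp
  also have "\<dots> \<le> a\<^sup>2 * (3 * (\<theta> + pi * (3 * (1 + pi + nv) * \<theta> + \<theta>)))"
    using \<beta>_square_le B2_int_nonneg
    by (intro mult_left_mono add_mono) (auto simp: b2(2) \<theta>_def)
  also have "\<dots> = C * \<theta> * (norm F)\<^sup>2"
  proof -
    define s where "s = K * (1 + nv * L + L) * pi"
    have "a = s * norm F" "C = s\<^sup>2 * (3 * (1 + pi + 3 * pi * (1 + pi + nv)))"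
      by (simp_all add: a_def C_def s_def)
    then show ?thesis by (simp add: power_mult_distrib algebra_simps)
  qed
  also have "\<dots> = (sqrt (C * \<theta>) * norm F)\<^sup>2"
    using nv_nonneg \<theta>_nonneg by (simp add: C_def power_mult_distrib)
  finally show "norm (blinfun_apply (?R - ?Rfree) F) \<le> sqrt (C * \<theta>) * norm F"
    by (rule power2_le_imp_le) (use nv_nonneg \<theta>_nonneg in \<open>simp add: C_def\<close>)
qed

lemma \<kappa>_square_le: "\<kappa>\<^sup>2 \<le> (K\<^sup>2 * nv * (nv + 2))\<^sup>2 * (3 * (1 + pi + nv)) * \<theta>"
  unfolding \<kappa>_def power_mult_distrib[of _ \<beta>] using \<beta>_square_le
  by (subst mult.assoc) (intro mult_left_mono, auto simp: mult.assoc)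

end

lemma finite_of_bounded_sums:
  fixes f :: "'a \<Rightarrow> real"
  assumes C: "\<And>A. finite A \<Longrightarrow> sum f A \<le> C" and d: "d > 0"
  shows "finite {n. d < f n}"
proof (rule ccontr)
  assume "infinite {n. d < f n}"
  then obtain A where A: "finite A" "card A = Suc (nat \<lceil>C / d\<rceil>)" "A \<subseteq> {n. d < f n}"
    using infinite_arbitrarily_large by blast
  have "C / d < real (card A)" unfolding A(2) by linarith
  then have "C < real (card A) * d" using d by (simp add: divide_less_eq)
  also have "\<dots> \<le> sum f A" using sum_bounded_below[of A d f] A(3) by (auto simp: subset_eq less_imp_le)
  finally show False using C[OF A(1)] by simp
qed

theorem theorem3:
  fixes P Q :: "real \<Rightarrow> complex" and b :: bc
  assumes "square_integrable P" and "square_integrable Q"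
  shows "\<exists>N::nat.
    (\<forall>n \<in> free_spectrum b. \<bar>n\<bar> > int N \<longrightarrow>
       sphere (of_int n) (1/2) \<subseteq> resolvent_set (dirac_domain b) (dirac_op P Q) \<and>
       sphere (of_int n) (1/2) \<subseteq> resolvent_set (dirac_domain b) (dirac_op (\<lambda>_. 0) (\<lambda>_. 0))) \<and>
    (\<lambda>n. (norm (riesz_projection (dirac_domain b) (dirac_op P Q) n
               - riesz_projection (dirac_domain b) (dirac_op (\<lambda>_. 0) (\<lambda>_. 0)) n))\<^sup>2)
      summable_on {n \<in> free_spectrum b. \<bar>n\<bar> > int N}"
proof -
  let ?D = "dirac_domain b" and ?A = "dirac_op P Q" and ?Afree = "dirac_op (\<lambda>_. 0) (\<lambda>_. 0)"
  let ?d = "\<lambda>n. norm (riesz_projection ?D ?A n - riesz_projection ?D ?Afree n)"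
  obtain M where M: "\<And>n l. cmod (l - of_int n) = 1/2 \<Longrightarrow> \<exists>m11 m12 m21 m22. \<forall>P Q.
      square_integrable P \<longrightarrow> square_integrable Q \<longrightarrow> dirac_bvp b l n m11 m12 m21 m22 M P Q"
    by (rule dirac_bvp_exists) blast
  have bvp: "\<exists>m11 m12 m21 m22. dirac_bvp b l n m11 m12 m21 m22 M P Q" if "cmod (l - of_int n) = 1/2" for l n
    using M[OF that] assms by blast
  have bvp': "\<exists>l m11 m12 m21 m22. dirac_bvp b l n m11 m12 m21 m22 M P Q" for n
  proof -
    \<comment> \<open>One point of the circle suffices for an instance at n: the quantities used
      through it do not depend on l.\<close>
    have "cmod (of_int n + 1/2 - of_int n) = 1/2" by simp
    from bvp[OF this] show ?thesis by blast
  qed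
  define th where "th n = dirac_bvp.\<theta> n P Q" for n
  define c where "c = dirac_bvp.C M P Q"
  define k where "k = ((dirac_bvp.K M)\<^sup>2 * dirac_bvp.nv P Q * (dirac_bvp.nv P Q + 2))\<^sup>2 * (3 * (1 + pi + dirac_bvp.nv P Q))"
  obtain T where T: "\<And>A. finite A \<Longrightarrow> sum th A \<le> T"
    using sum_\<theta>_le[of b M P Q, OF bvp'] unfolding th_def by blast
  \<comment> \<open>Absolute values stand in for the signs of k and T, which are not worked
    out.\<close>
  have "k * sum th A \<le> \<bar>k\<bar> * \<bar>T\<bar>" if "finite A" for A
  proof -
    have "0 \<le> sum th A" unfolding th_def
      using bvp' dirac_bvp.\<theta>_nonneg by (intro sum_nonneg) metis
    then show ?thesis using T[OF that] by (intro mult_mono) auto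
  qed
  then have "finite {n. 1/4 < k * th n}"
    by (intro finite_of_bounded_sums[where C = "\<bar>k\<bar> * \<bar>T\<bar>"]) (auto simp: sum_distrib_left[symmetric])
  then have "finite ((\<lambda>n. nat \<bar>n\<bar>) ` {n. 1/4 < k * th n})" by simp
  then obtain N where N: "\<And>n. 1/4 < k * th n \<Longrightarrow> nat \<bar>n\<bar> \<le> N"
    unfolding finite_nat_set_iff_bounded_le by blast
  \<comment> \<open>\<open>\<kappa>\<close> does not depend on l, so one N serves every point of the
    circle; the threshold 1/4 in the choice of N is the square of 1/2.\<close>
  have \<kappa>: "dirac_bvp.\<kappa> n M P Q \<le> 1/2" if "\<bar>n\<bar> > int N" for n
  proof (rule ccontr)
    assume "\<not> dirac_bvp.\<kappa> n M P Q \<le> 1/2"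
    then have "(1/2)\<^sup>2 < (dirac_bvp.\<kappa> n M P Q)\<^sup>2" by (intro power_strict_mono) auto
    also have "\<dots> \<le> k * th n"
      unfolding k_def th_def using bvp' dirac_bvp.\<kappa>_square_le by metis
    finally show False using N[of n] that by (simp add: power2_eq_square)
  qed
  \<comment> \<open>The two norm bounds are the same at all points of a circle; they give continuity
    of the resolvents there.\<close>
  have res: "l \<in> resolvent_set ?D ?A \<and> l \<in> resolvent_set ?D ?Afree \<and>
      norm (resolvent ?D ?A l) \<le> 2 * dirac_bvp.L M P Q * pi \<and>
      norm (resolvent ?D ?Afree l) \<le> 2 * dirac_bvp.L M (\<lambda>_. 0) (\<lambda>_. 0) * pi \<and>
      norm (resolvent ?D ?A l - resolvent ?D ?Afree l) \<le> sqrt (c * th n)"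
    if n: "\<bar>n\<bar> > int N" and l: "l \<in> sphere (of_int n) (1/2)" for n l
  proof -
    have "cmod (l - of_int n) = 1/2" using l by (simp add: dist_norm norm_minus_commute)
    from bvp[OF this] obtain m11 m12 m21 m22 where "dirac_bvp b l n m11 m12 m21 m22 M P Q" by blast
    then interpret dirac_bvp b l n m11 m12 m21 m22 M P Q .
    interpret Z: dirac_bvp b l n m11 m12 m21 m22 M "\<lambda>_. 0" "\<lambda>_. 0" by (rule free)
    show ?thesis
      using in_resolvent_set[OF \<kappa>[OF n]] Z.in_resolvent_set[OF free_\<kappa>] norm_resolvent_le[OF \<kappa>[OF n]]
        Z.norm_resolvent_le[OF free_\<kappa>] norm_resolvent_diff_free_le[OF \<kappa>[OF n]]
      unfolding c_def th_def by blast
  qed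
  have le: "(?d n)\<^sup>2 \<le> \<bar>c\<bar> * th n" if n: "\<bar>n\<bar> > int N" for n
  proof -
    have th0: "0 \<le> th n" unfolding th_def using bvp' dirac_bvp.\<theta>_nonneg by metis
    have "?d n \<le> sqrt (c * th n) / 2"
    proof (rule norm_riesz_projection_diff_le)
      show "continuous_on (sphere (of_int n) (1/2)) (resolvent ?D ?A)"
        by (rule continuous_on_resolvent) (use res[OF n] in blast)+
      show "continuous_on (sphere (of_int n) (1/2)) (resolvent ?D ?Afree)"
        by (rule continuous_on_resolvent) (use res[OF n] in blast)+
    qed (use res[OF n] in blast)
    also have "\<dots> \<le> sqrt (\<bar>c\<bar> * th n)"
    proof -
      have "sqrt (c * th n) \<le> sqrt (\<bar>c\<bar> * th n)" "0 \<le> sqrt (\<bar>c\<bar> * th n)"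
        using th0 by (auto intro!: real_sqrt_le_mono mult_right_mono)
      then show ?thesis by linarith
    qed
    finally have "(?d n)\<^sup>2 \<le> (sqrt (\<bar>c\<bar> * th n))\<^sup>2"
      by (intro power_mono) auto
    then show ?thesis using th0 by simp
  qed
  have "(\<lambda>n. (?d n)\<^sup>2)
      summable_on {n \<in> free_spectrum b. \<bar>n\<bar> > int N}"
  proof (rule nonneg_bdd_above_summable_on)
    show "bdd_above (sum (\<lambda>n. (?d n)\<^sup>2) `
        {F. F \<subseteq> {n \<in> free_spectrum b. \<bar>n\<bar> > int N} \<and> finite F})"
    proof (rule bdd_aboveI2)
      fix F assume F: "F \<in> {F. F \<subseteq> {n \<in> free_spectrum b. \<bar>n\<bar> > int N} \<and> finite F}"
      have "(\<Sum>n\<in>F. (?d n)\<^sup>2) \<le> (\<Sum>n\<in>F. \<bar>c\<bar> * th n)"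
        using F by (intro sum_mono le) auto
      also have "\<dots> \<le> \<bar>c\<bar> * T"
        using F by (auto simp: sum_distrib_left[symmetric] intro!: mult_left_mono T)
      finally show "(\<Sum>n\<in>F. (?d n)\<^sup>2) \<le> \<bar>c\<bar> * T" .
    qed
  qed simp
  moreover have "sphere (of_int n) (1/2) \<subseteq> resolvent_set ?D ?A \<and> sphere (of_int n) (1/2) \<subseteq> resolvent_set ?D ?Afree"
    if "\<bar>n\<bar> > int N" for n
    using res[OF that] by blast
  ultimately show ?thesis by blast
qed

end
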